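(* Let $k\ge1$ and let $\Sigma_{F^k}=(M,F,Fe)$ be a Finslerian mechanical system of order $k$. Then: 1. The operator $S=\mathring S+\frac12Fe$, where $$\mathring S=y^{(1)i}\frac{\partial}{\partial x^i}+2y^{(2)i}\frac{\partial}{\partial y^{(1)i}}+\dots+ky^{(k)i}\frac{\partial}{\partial y^{(k-1)i}}-(k+1)\mathring G^i\frac{\partial}{\partial y^{(k)i}},\quad (k+1)\mathring G^i=\frac12g^{ij}\left[\Gamma\left(\frac{\partial F^2}{\partial y^{(k)j}}\right)-\frac{\partial F^2}{\partial y^{(k-1)j}}\right],$$ is a $k$-semispray which depends only on $\Sigma_{F^k}$. 2. The integral curves of $S$ are the evolution curves of $\Sigma_{F^k}$.
   Context: The summation convention is used. $M$ is a real $n$-dimensional smooth manifold. $T^kM$ is the bundle of accelerations of order $k$ (the manifold of $k$-jets at $0$ of curves in $M$), with local coordinates $(x^i,y^{(1)i},\dots,y^{(k)i})$, where the $k$-jet of a curve $x(t)$ has $y^{(\alpha)i}=\frac1{\alpha!}\frac{d^\alpha x^i}{dt^\alpha}(0)$; $y^{(0)i}=x^i$; $\widetilde{T^kM}$ is $T^kM$ without the null section. The $k$-tangent structure is $J=\frac{\partial}{\partial y^{(1)i}}\otimes dx^i+\dots+\frac{\partial}{\partial y^{(k)i}}\otimes dy^{(k-1)i}$ and $\overset{k}{\Gamma}=y^{(1)i}\frac{\partial}{\partial y^{(1)i}}+2y^{(2)i}\frac{\partial}{\partial y^{(2)i}}+\dots+ky^{(k)i}\frac{\partial}{\partial y^{(k)i}}$;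 both are globally defined. A $k$-semispray is a (globally defined) vector field $S$ with $JS=\overset{k}{\Gamma}$. $\Gamma$ is the local operator $\Gamma=y^{(1)i}\frac{\partial}{\partial x^i}+2y^{(2)i}\frac{\partial}{\partial y^{(1)i}}+\dots+ky^{(k)i}\frac{\partial}{\partial y^{(k-1)i}}$. A Finsler space of order $k$ is a pair $(M,F)$ with $F:T^kM\to\mathbb R$ smooth on $\widetilde{T^kM}$, continuous on the null section, positive, $k$-homogeneous on the fibres (i.e. $F(x,ay^{(1)},a^2y^{(2)},\dots,a^ky^{(k)})=a^kF(x,y^{(1)},\dots,y^{(k)})$ for $a>0$), and with $g_{ij}=\frac12\frac{\partial^2F^2}{\partial y^{(k)i}\partial y^{(k)j}}$ positive definite on $\widetilde{T^kM}$; $(g^{ij})$ is the inverse matrix. A Finslerian mechanical system of order $k$ is a triple $\Sigma_{F^k}=(M,F,Fe)$ where $(M,F)$ is a Finsler space of order $k$ and $Fe=F^i(x,y^{(1)},\dots,y^{(k)})\frac{\partial}{\partial y^{(k)i}}$ is a given vertical vector field; $F_i=g_{ij}F^j$. Its evolution curves are the solutions of the Lagrange equations $\frac{d}{dt}\frac{\partial F^2}{\partial y^{(k)i}}-\frac{\partial F^2}{\partial y^{(k-1)i}}=F_i$, $y^{(\alpha)i}=\frac1{\alpha!}\frac{d^\alpha x^i}{dt^\alpha}$ $(\alpha=1,\dots,k)$ (regarded as curves in $T^kM$ via their extensions). All objects involving $g^{ij}$ are considered on $\widetilde{T^kM}$. *)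

theory Defs
  imports "HOL-Analysis.Analysis"
begin

section \<open>Smooth maps and smooth manifolds\<close>

text \<open>Both notions of smoothness below are meant for open sets \<open>S\<close>.\<close>

primrec times_differentiable_on ::
  "nat \<Rightarrow> 'a::real_normed_vector set \<Rightarrow> ('a \<Rightarrow> 'b::real_normed_vector) \<Rightarrow> bool" where
  "times_differentiable_on 0 S f \<longleftrightarrow> continuous_on S f"
| "times_differentiable_on (Suc r) S f \<longleftrightarrow>
     (\<forall>x\<in>S. f differentiable (at x)) \<and>
     (\<forall>v. times_differentiable_on r S (\<lambda>x. frechet_derivative f (at x) v))"

definition smooth_on ::
  "'a::real_normed_vector set \<Rightarrow> ('a \<Rightarrow> 'b::real_normed_vector) \<Rightarrow> bool" where
  "smooth_on S f \<longleftrightarrow> (\<forall>r. times_differentiable_on r S f)"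

definition nth_deriv :: "nat \<Rightarrow> (real \<Rightarrow> 'a::real_normed_vector) \<Rightarrow> real \<Rightarrow> 'a" where
  "nth_deriv r f = ((\<lambda>g t. vector_derivative g (at t)) ^^ r) f"

type_synonym ('m, 'n) chart = "'m set \<times> ('m \<Rightarrow> real ^ 'n)"

text \<open>The manifold is the whole type \<open>'m\<close> (Hausdorff and second countable by its type classes),
  of dimension \<open>CARD('n)\<close>. The atlas \<open>A\<close> is not required to be maximal; the maximal atlas is one
  of the admissible choices.\<close>

definition smooth_manifold ::
  "('m::{t2_space,second_countable_topology}, 'n::finite) chart set \<Rightarrow> bool" where
  "smooth_manifold A \<longleftrightarrow>
     (\<Union>(U, \<phi>)\<in>A. U) = UNIV \<and>
     (\<forall>(U, \<phi>)\<in>A. open U \<and> open (\<phi> ` U) \<and> (\<exists>\<psi>. homeomorphism U (\<phi> ` U) \<phi> \<psi>)) \<and>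
     (\<forall>(U, \<phi>)\<in>A. \<forall>(V, \<psi>)\<in>A. smooth_on (\<phi> ` (U \<inter> V)) (\<psi> \<circ> inv_into U \<phi>))"

text \<open>Curves are total functions; only their values on the open set \<open>I\<close> matter.\<close>

definition smooth_curve ::
  "('m::topological_space, 'n::finite) chart set \<Rightarrow> real set \<Rightarrow> (real \<Rightarrow> 'm) \<Rightarrow> bool" where
  "smooth_curve A I x \<longleftrightarrow>
     continuous_on I x \<and> (\<forall>(U, \<phi>)\<in>A. smooth_on (I \<inter> x -` U) (\<phi> \<circ> x))"

section \<open>The bundle of accelerations of order \<open>k\<close>\<close>

definition smooth_near_0 ::
  "('m::topological_space, 'n::finite) chart set \<Rightarrow> (real \<Rightarrow> 'm) \<Rightarrow> bool" where
  "smooth_near_0 A x \<longleftrightarrow> (\<exists>I. open I \<and> 0 \<in> I \<and> smooth_curve A I x)"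

text \<open>A \<open>k\<close>-jet at 0 is a class of curves with contact of order \<open>k\<close> at 0.\<close>

type_synonym 'm jet = "(real \<Rightarrow> 'm) set"

definition jet ::
  "('m::topological_space, 'n::finite) chart set \<Rightarrow> nat \<Rightarrow> (real \<Rightarrow> 'm) \<Rightarrow> 'm jet" where
  "jet A k x = {z. smooth_near_0 A z \<and> z 0 = x 0 \<and>
     (\<forall>(U, \<phi>)\<in>A. x 0 \<in> U \<longrightarrow> (\<forall>\<alpha>\<le>k. nth_deriv \<alpha> (\<phi> \<circ> z) 0 = nth_deriv \<alpha> (\<phi> \<circ> x) 0))}"

definition jet_bundle ::
  "('m::topological_space, 'n::finite) chart set \<Rightarrow> nat \<Rightarrow> 'm jet set" where
  "jet_bundle A k = {jet A k x | x. smooth_near_0 A x}"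

definition null_section ::
  "('m::topological_space, 'n::finite) chart set \<Rightarrow> nat \<Rightarrow> 'm jet set" where
  "null_section A k = {jet A k (\<lambda>t. a) | a. True}"

definition slit_bundle ::
  "('m::topological_space, 'n::finite) chart set \<Rightarrow> nat \<Rightarrow> 'm jet set" where
  "slit_bundle A k = jet_bundle A k - null_section A k"

definition jet_rep :: "'m jet \<Rightarrow> real \<Rightarrow> 'm" where
  "jet_rep p = (SOME x. x \<in> p)"

definition jet_dom ::
  "('m::topological_space, 'n::finite) chart set \<Rightarrow> nat \<Rightarrow> ('m, 'n) chart \<Rightarrow> 'm jet set" where
  "jet_dom A k c = {p \<in> jet_bundle A k. jet_rep p 0 \<in> fst c}"

text \<open>The induced coordinates \<open>(x, y\<^sup>(\<^sup>1\<^sup>), \<dots>, y\<^sup>(\<^sup>k\<^sup>))\<close> are collected in one vector of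
  \<open>real ^ 'n ^ 'j\<close>. Since \<open>k\<close> is a number and not a type, the blocks are labelled by a type \<open>'j\<close>
  with \<open>k + 1\<close> elements and a numbering \<open>e\<close>, a bijection from \<open>{..k}\<close> onto \<open>'j\<close>:
  block \<open>e \<alpha>\<close> holds \<open>y\<^sup>(\<^sup>\<alpha>\<^sup>)\<close>, with \<open>y\<^sup>(\<^sup>0\<^sup>) = x\<close>.\<close>

definition jet_coord ::
  "nat \<Rightarrow> (nat \<Rightarrow> 'j::finite) \<Rightarrow> ('m, 'n::finite) chart \<Rightarrow> 'm jet \<Rightarrow> real ^ 'n ^ 'j" where
  "jet_coord k e c p =
     (\<chi> \<beta>. let \<alpha> = inv_into {..k} e \<beta> in
        (1 / fact \<alpha>) *\<^sub>R nth_deriv \<alpha> (snd c \<circ> jet_rep p) 0)"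

definition yc ::
  "nat \<Rightarrow> (nat \<Rightarrow> 'j::finite) \<Rightarrow> ('m, 'n::finite) chart \<Rightarrow> nat \<Rightarrow> 'n \<Rightarrow> 'm jet \<Rightarrow> real" where
  "yc k e c \<alpha> i p = jet_coord k e c p $ e \<alpha> $ i"

definition jet_topology ::
  "nat \<Rightarrow> (nat \<Rightarrow> 'j::finite) \<Rightarrow> ('m::topological_space, 'n::finite) chart set \<Rightarrow> 'm jet topology"
  where
  "jet_topology k e A = topology_generated_by
     {jet_dom A k c \<inter> jet_coord k e c -` W | c W. c \<in> A \<and> open W}"

definition local_rep ::
  "nat \<Rightarrow> (nat \<Rightarrow> 'j::finite) \<Rightarrow> ('m::topological_space, 'n::finite) chart set \<Rightarrow> ('m, 'n) chart \<Rightarrow>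
   ('m jet \<Rightarrow> real) \<Rightarrow> real ^ 'n ^ 'j \<Rightarrow> real" where
  "local_rep k e A c f u = f (inv_into (jet_dom A k c) (jet_coord k e c) u)"

definition smooth_fun ::
  "nat \<Rightarrow> (nat \<Rightarrow> 'j::finite) \<Rightarrow> ('m::topological_space, 'n::finite) chart set \<Rightarrow>
   'm jet set \<Rightarrow> ('m jet \<Rightarrow> real) \<Rightarrow> bool" where
  "smooth_fun k e A W f \<longleftrightarrow>
     (\<forall>c\<in>A. smooth_on (jet_coord k e c ` (W \<inter> jet_dom A k c)) (local_rep k e A c f))"

definition smooth_near ::
  "nat \<Rightarrow> (nat \<Rightarrow> 'j::finite) \<Rightarrow> ('m::topological_space, 'n::finite) chart set \<Rightarrow>
   'm jet \<Rightarrow> ('m jet \<Rightarrow> real) \<Rightarrow> bool" where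
  "smooth_near k e A p f \<longleftrightarrow> (\<exists>W. openin (jet_topology k e A) W \<and> p \<in> W \<and> smooth_fun k e A W f)"

text \<open>\<open>pd k e A c \<alpha> i f p\<close> is \<open>\<partial>f/\<partial>y\<^sup>(\<^sup>\<alpha>\<^sup>)\<^sup>i\<close> at \<open>p\<close>, in the coordinates induced by the chart \<open>c\<close>.\<close>

definition pd ::
  "nat \<Rightarrow> (nat \<Rightarrow> 'j::finite) \<Rightarrow> ('m::topological_space, 'n::finite) chart set \<Rightarrow> ('m, 'n) chart \<Rightarrow>
   nat \<Rightarrow> 'n \<Rightarrow> ('m jet \<Rightarrow> real) \<Rightarrow> 'm jet \<Rightarrow> real" where
  "pd k e A c \<alpha> i f p =
     frechet_derivative (local_rep k e A c f) (at (jet_coord k e c p)) (axis (e \<alpha>) (axis i 1))"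

section \<open>Vector fields, semisprays and integral curves\<close>

text \<open>A vector field on the slit bundle is an operator \<open>X\<close> which, applied to functions that are
  smooth near a point, has in every induced chart the form
  \<open>X\<^sup>(\<^sup>\<alpha>\<^sup>)\<^sup>i \<partial>/\<partial>y\<^sup>(\<^sup>\<alpha>\<^sup>)\<^sup>i\<close> with smooth components. Necessarily \<open>X\<^sup>(\<^sup>\<alpha>\<^sup>)\<^sup>i = X(y\<^sup>(\<^sup>\<alpha>\<^sup>)\<^sup>i)\<close>. Its values on
  other functions, or off the slit bundle, are irrelevant.\<close>

type_synonym 'm operator = "('m jet \<Rightarrow> real) \<Rightarrow> 'm jet \<Rightarrow> real"

definition vector_field ::
  "nat \<Rightarrow> (nat \<Rightarrow> 'j::finite) \<Rightarrow> ('m::topological_space, 'n::finite) chart set \<Rightarrow>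
   'm operator \<Rightarrow> bool" where
  "vector_field k e A X \<longleftrightarrow> (\<forall>c\<in>A.
     (\<forall>\<alpha>\<le>k. \<forall>i. smooth_fun k e A (slit_bundle A k \<inter> jet_dom A k c) (X (yc k e c \<alpha> i))) \<and>
     (\<forall>p \<in> slit_bundle A k \<inter> jet_dom A k c. \<forall>f. smooth_near k e A p f \<longrightarrow>
        X f p = (\<Sum>\<alpha>\<le>k. \<Sum>i\<in>UNIV. X (yc k e c \<alpha> i) p * pd k e A c \<alpha> i f p)))"

text \<open>The coordinate expressions of \<open>J X\<close> and of the Liouville field
  \<open>y\<^sup>(\<^sup>1\<^sup>)\<^sup>i \<partial>/\<partial>y\<^sup>(\<^sup>1\<^sup>)\<^sup>i + \<dots> + k y\<^sup>(\<^sup>k\<^sup>)\<^sup>i \<partial>/\<partial>y\<^sup>(\<^sup>k\<^sup>)\<^sup>i\<close>.\<close>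

definition tangent_structure ::
  "nat \<Rightarrow> (nat \<Rightarrow> 'j::finite) \<Rightarrow> ('m::topological_space, 'n::finite) chart set \<Rightarrow> ('m, 'n) chart \<Rightarrow>
   'm operator \<Rightarrow> 'm operator" where
  "tangent_structure k e A c X f p =
     (\<Sum>\<alpha>=1..k. \<Sum>i\<in>UNIV. X (yc k e c (\<alpha> - 1) i) p * pd k e A c \<alpha> i f p)"

definition liouville ::
  "nat \<Rightarrow> (nat \<Rightarrow> 'j::finite) \<Rightarrow> ('m::topological_space, 'n::finite) chart set \<Rightarrow> ('m, 'n) chart \<Rightarrow>
   'm operator" where
  "liouville k e A c f p =
     (\<Sum>\<alpha>=1..k. \<Sum>i\<in>UNIV. real \<alpha> * yc k e c \<alpha> i p * pd k e A c \<alpha> i f p)"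

definition semispray ::
  "nat \<Rightarrow> (nat \<Rightarrow> 'j::finite) \<Rightarrow> ('m::topological_space, 'n::finite) chart set \<Rightarrow>
   'm operator \<Rightarrow> bool" where
  "semispray k e A S \<longleftrightarrow> vector_field k e A S \<and>
     (\<forall>c\<in>A. \<forall>p \<in> slit_bundle A k \<inter> jet_dom A k c. \<forall>f. smooth_near k e A p f \<longrightarrow>
        tangent_structure k e A c S f p = liouville k e A c f p)"

definition integral_curve ::
  "nat \<Rightarrow> (nat \<Rightarrow> 'j::finite) \<Rightarrow> ('m::topological_space, 'n::finite) chart set \<Rightarrow>
   'm operator \<Rightarrow> real set \<Rightarrow> (real \<Rightarrow> 'm jet) \<Rightarrow> bool" where
  "integral_curve k e A X I \<gamma> \<longleftrightarrow>
     \<gamma> ` I \<subseteq> slit_bundle A k \<and>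
     continuous_map (top_of_set I) (jet_topology k e A) \<gamma> \<and>
     (\<forall>t\<in>I. \<forall>f. smooth_near k e A (\<gamma> t) f \<longrightarrow>
        ((\<lambda>s. f (\<gamma> s)) has_real_derivative X f (\<gamma> t)) (at t))"

section \<open>Finslerian mechanical systems of order \<open>k\<close>\<close>

definition metric_tensor ::
  "nat \<Rightarrow> (nat \<Rightarrow> 'j::finite) \<Rightarrow> ('m::topological_space, 'n::finite) chart set \<Rightarrow>
   ('m jet \<Rightarrow> real) \<Rightarrow> ('m, 'n) chart \<Rightarrow> 'm jet \<Rightarrow> real ^ 'n ^ 'n" where
  "metric_tensor k e A F c p =
     (\<chi> i j. 1 / 2 * pd k e A c k i (pd k e A c k j (\<lambda>q. (F q)\<^sup>2)) p)"

definition finsler_space ::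
  "nat \<Rightarrow> (nat \<Rightarrow> 'j::finite) \<Rightarrow>
   ('m::{t2_space,second_countable_topology}, 'n::finite) chart set \<Rightarrow> ('m jet \<Rightarrow> real) \<Rightarrow> bool" where
  "finsler_space k e A F \<longleftrightarrow>
     smooth_manifold A \<and>
     smooth_fun k e A (slit_bundle A k) F \<and>
     continuous_map (jet_topology k e A) euclideanreal F \<and>
     (\<forall>p \<in> slit_bundle A k. F p > 0) \<and>
     (\<forall>c\<in>A. \<forall>p \<in> jet_dom A k c. \<forall>q \<in> jet_dom A k c. \<forall>a>0.
        (\<forall>\<alpha>\<le>k. \<forall>i. yc k e c \<alpha> i q = a ^ \<alpha> * yc k e c \<alpha> i p) \<longrightarrow> F q = a ^ k * F p) \<and>
     (\<forall>c\<in>A. \<forall>p \<in> slit_bundle A k \<inter> jet_dom A k c. \<forall>v. v \<noteq> 0 \<longrightarrow>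
        v \<bullet> (metric_tensor k e A F c p *v v) > 0)"

text \<open>\<open>Fe = F\<^sup>i \<partial>/\<partial>y\<^sup>(\<^sup>k\<^sup>)\<^sup>i\<close>: all other components vanish, and \<open>F\<^sup>i = Fe(y\<^sup>(\<^sup>k\<^sup>)\<^sup>i)\<close>.\<close>

definition mechanical_system ::
  "nat \<Rightarrow> (nat \<Rightarrow> 'j::finite) \<Rightarrow>
   ('m::{t2_space,second_countable_topology}, 'n::finite) chart set \<Rightarrow>
   ('m jet \<Rightarrow> real) \<Rightarrow> 'm operator \<Rightarrow> bool" where
  "mechanical_system k e A F Fe \<longleftrightarrow>
     finsler_space k e A F \<and> vector_field k e A Fe \<and>
     (\<forall>c\<in>A. \<forall>p \<in> slit_bundle A k \<inter> jet_dom A k c. \<forall>\<alpha><k. \<forall>i. Fe (yc k e c \<alpha> i) p = 0)"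

definition lower_force ::
  "nat \<Rightarrow> (nat \<Rightarrow> 'j::finite) \<Rightarrow> ('m::topological_space, 'n::finite) chart set \<Rightarrow>
   ('m jet \<Rightarrow> real) \<Rightarrow> 'm operator \<Rightarrow> ('m, 'n) chart \<Rightarrow> 'n \<Rightarrow> 'm jet \<Rightarrow> real" where
  "lower_force k e A F Fe c i p =
     (\<Sum>j\<in>UNIV. metric_tensor k e A F c p $ i $ j * Fe (yc k e c k j) p)"

definition Gamma_op ::
  "nat \<Rightarrow> (nat \<Rightarrow> 'j::finite) \<Rightarrow> ('m::topological_space, 'n::finite) chart set \<Rightarrow> ('m, 'n) chart \<Rightarrow>
   'm operator" where
  "Gamma_op k e A c f p =
     (\<Sum>\<alpha>=1..k. \<Sum>i\<in>UNIV. real \<alpha> * yc k e c \<alpha> i p * pd k e A c (\<alpha> - 1) i f p)"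

definition G_coeff ::
  "nat \<Rightarrow> (nat \<Rightarrow> 'j::finite) \<Rightarrow> ('m::topological_space, 'n::finite) chart set \<Rightarrow>
   ('m jet \<Rightarrow> real) \<Rightarrow> ('m, 'n) chart \<Rightarrow> 'n \<Rightarrow> 'm jet \<Rightarrow> real" where
  "G_coeff k e A F c i p = 1 / (real k + 1) * (1 / 2 *
     (\<Sum>j\<in>UNIV. matrix_inv (metric_tensor k e A F c p) $ i $ j *
        (Gamma_op k e A c (pd k e A c k j (\<lambda>q. (F q)\<^sup>2)) p - pd k e A c (k - 1) j (\<lambda>q. (F q)\<^sup>2) p)))"

definition canonical_spray_in ::
  "nat \<Rightarrow> (nat \<Rightarrow> 'j::finite) \<Rightarrow> ('m::topological_space, 'n::finite) chart set \<Rightarrow>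
   ('m jet \<Rightarrow> real) \<Rightarrow> ('m, 'n) chart \<Rightarrow> 'm operator" where
  "canonical_spray_in k e A F c f p =
     Gamma_op k e A c f p - (real k + 1) * (\<Sum>i\<in>UNIV. G_coeff k e A F c i p * pd k e A c k i f p)"

text \<open>The coordinate formula for \<open>S\<close> in the chart \<open>c\<close>, and the operator obtained by using at each
  point some chart of the atlas around it.\<close>

definition mechanical_spray_in ::
  "nat \<Rightarrow> (nat \<Rightarrow> 'j::finite) \<Rightarrow> ('m::topological_space, 'n::finite) chart set \<Rightarrow>
   ('m jet \<Rightarrow> real) \<Rightarrow> 'm operator \<Rightarrow> ('m, 'n) chart \<Rightarrow> 'm operator" where
  "mechanical_spray_in k e A F Fe c f p = canonical_spray_in k e A F c f p + 1 / 2 * Fe f p"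

definition mechanical_spray ::
  "nat \<Rightarrow> (nat \<Rightarrow> 'j::finite) \<Rightarrow> ('m::topological_space, 'n::finite) chart set \<Rightarrow>
   ('m jet \<Rightarrow> real) \<Rightarrow> 'm operator \<Rightarrow> 'm operator" where
  "mechanical_spray k e A F Fe f p =
     mechanical_spray_in k e A F Fe (SOME c. c \<in> A \<and> p \<in> jet_dom A k c) f p"

text \<open>The third conjunct is the Lagrange equation
  \<open>d/dt \<partial>F\<^sup>2/\<partial>y\<^sup>(\<^sup>k\<^sup>)\<^sup>i - \<partial>F\<^sup>2/\<partial>y\<^sup>(\<^sup>k\<^sup>-\<^sup>1\<^sup>)\<^sup>i = F\<^sub>i\<close> along the extension \<open>\<gamma>\<close> of the curve \<open>x\<close>.\<close>

definition evolution_curve ::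
  "nat \<Rightarrow> (nat \<Rightarrow> 'j::finite) \<Rightarrow> ('m::topological_space, 'n::finite) chart set \<Rightarrow>
   ('m jet \<Rightarrow> real) \<Rightarrow> 'm operator \<Rightarrow> real set \<Rightarrow> (real \<Rightarrow> 'm jet) \<Rightarrow> bool" where
  "evolution_curve k e A F Fe I \<gamma> \<longleftrightarrow>
     (\<exists>x. smooth_curve A I x \<and>
        (\<forall>t\<in>I. \<gamma> t = jet A k (\<lambda>s. x (t + s)) \<and> \<gamma> t \<in> slit_bundle A k) \<and>
        (\<forall>c\<in>A. \<forall>t\<in>I. \<gamma> t \<in> jet_dom A k c \<longrightarrow> (\<forall>i.
           ((\<lambda>s. pd k e A c k i (\<lambda>q. (F q)\<^sup>2) (\<gamma> s)) has_real_derivative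
              pd k e A c (k - 1) i (\<lambda>q. (F q)\<^sup>2) (\<gamma> t) + lower_force k e A F Fe c i (\<gamma> t)) (at t))))"

end

theory Submission
  imports Defs
begin

text \<open>
  In an induced chart a jet is a vector \<open>u\<close> with blocks \<open>u\<^sub>\<alpha> = y\<^sup>(\<^sup>\<alpha>\<^sup>)\<close>. The semispray condition prescribes
  all blocks of a semispray except the last one: block \<open>\<alpha> < k\<close> is \<open>(\<alpha> + 1) y\<^sup>(\<^sup>\<alpha>\<^sup>+\<^sup>1\<^sup>)\<close>. So a semispray
  vector at \<open>u\<close> is \<open>\<xi> = shift u + w \<partial>/\<partial>y\<^sup>(\<^sup>k\<^sup>)\<close> with \<open>w\<close> free, and the velocity of the extension of a
  curve in \<open>M\<close> is of this form. When \<open>\<xi>\<close> is inserted as velocity into the Lagrange equations, they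
  become a linear system for \<open>w\<close> with matrix \<open>2 g\<close>. Its unique solution is the last block
  of the mechanical spray, \<open>-(k + 1) G\<close> plus half the force (\<open>Lagrange_equation_iff\<close>). Both parts of
  the theorem rest on this characterization.

  Chart independence. The left-hand side of the force-free Lagrange equations is a covector: under the
  prolongation \<open>T\<close> of a coordinate change \<open>\<tau>\<close> it is pulled back by \<open>D\<tau>\<close>
  (\<open>Lagrange_expression_transform\<close>), while \<open>DT\<close> maps semispray vectors to semispray vectors
  (\<open>prolongation_derivative_semispray\<close>). So \<open>DT\<close> maps the unique solution in one chart to the unique
  solution in the other (\<open>geodesic_field_transform\<close>). The force is an operator on functions and thus
  chart independent from the outset. The covector law needs only two facts on \<open>T\<close>: block \<open>k\<close> of \<open>T\<close>
  depends on \<open>y\<^sup>(\<^sup>k\<^sup>)\<close> through \<open>D\<tau>\<close>, and on \<open>y\<^sup>(\<^sup>k\<^sup>-\<^sup>1\<^sup>)\<close> through the time derivative of \<open>D\<tau>\<close>. With \<open>\<Gamma>\<close> the local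
  operator whose coefficients are \<open>shift u\<close>, both follow by induction from
  \<open>(\<alpha> + 1) T\<^sub>\<alpha>\<^sub>+\<^sub>1 = \<Gamma> T\<^sub>\<alpha>\<close>, because \<open>\<partial>/\<partial>y\<^sup>(\<^sup>\<beta>\<^sup>)\<close> and \<open>\<Gamma>\<close> commute up to
  \<open>\<beta> \<partial>/\<partial>y\<^sup>(\<^sup>\<beta>\<^sup>-\<^sup>1\<^sup>)\<close>.

  Curves. For an integral curve the blocks below the top say that it is the extension of its projection
  to \<open>M\<close>, and the top block says that the Lagrange equations hold; conversely the extension of a curve has
  a semispray vector as velocity, and the Lagrange equations determine its top block. That the projection
  of an integral curve is smooth follows from \<open>u' = Y u\<close> with smooth \<open>Y\<close>, one derivative at a time.
\<close>

section \<open>Calculus of smooth maps\<close>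

lemma frechet_derivative_eq:
  assumes "(f has_derivative f') (at x)"
  shows "frechet_derivative f (at x) = f'"
  using frechet_derivative_at[OF assms] by simp

text \<open>A derivative at a point of \<open>S\<close> sees \<open>f\<close> on a neighbourhood of that point, so agreement on \<open>S\<close> is
  enough only because \<open>S\<close> is open.\<close>

lemma times_differentiable_on_cong:
  assumes "open S" "\<And>x. x \<in> S \<Longrightarrow> f x = g x" "times_differentiable_on r S f"
  shows "times_differentiable_on r S g"
  using assms(2,3)
proof (induction r arbitrary: f g)
  case 0
  then show ?case using continuous_on_cong[of S S f g] by simp
next
  case (Suc r)
  have d: "(g has_derivative frechet_derivative f (at x)) (at x)" if "x \<in> S" for x
  proof (rule has_derivative_transform_within_open[OF _ assms(1) that])
    show "(f has_derivative frechet_derivative f (at x)) (at x)"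
      using Suc.prems(2) that by (simp add: frechet_derivative_works)
  qed (use Suc.prems(1) in auto)
  have "times_differentiable_on r S (\<lambda>x. frechet_derivative g (at x) v)" for v
    by (rule Suc.IH[of "\<lambda>x. frechet_derivative f (at x) v"])
      (use Suc.prems frechet_derivative_eq[OF d] in auto)
  then show ?case using d by (auto simp: differentiable_def)
qed

lemma times_differentiable_on_SucI:
  assumes "open S" "\<And>x. x \<in> S \<Longrightarrow> (f has_derivative f' x) (at x)"
    and "\<And>v. times_differentiable_on r S (\<lambda>x. f' x v)"
  shows "times_differentiable_on (Suc r) S f"
proof -
  have "times_differentiable_on r S (\<lambda>x. frechet_derivative f (at x) v)" for v
    by (rule times_differentiable_on_cong[OF assms(1) _ assms(3)[of v]])
      (simp add: frechet_derivative_eq[OF assms(2)])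
  then show ?thesis using assms(2) by (auto simp: differentiable_def)
qed

lemma times_differentiable_on_SucD:
  assumes "times_differentiable_on (Suc r) S f" "x \<in> S"
  shows "(f has_derivative frechet_derivative f (at x)) (at x)"
  using assms by (simp add: frechet_derivative_works)

lemma times_differentiable_on_subset:
  "times_differentiable_on r S f \<Longrightarrow> T \<subseteq> S \<Longrightarrow> times_differentiable_on r T f"
  by (induction r arbitrary: f) (auto intro: continuous_on_subset)

lemma times_differentiable_on_Suc_imp:
  "times_differentiable_on (Suc r) S f \<Longrightarrow> times_differentiable_on r S f"
proof (induction r arbitrary: f)
  case 0
  then show ?case
    by (auto intro!: continuous_at_imp_continuous_on differentiable_imp_continuous_within)
next
  case (Suc r)
  then show ?case using times_differentiable_on.simps(2) by blast
qed

lemma times_differentiable_on_const: "times_differentiable_on r S (\<lambda>x. c)"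
  by (induction r arbitrary: c) auto

lemma times_differentiable_on_bounded_linear:
  assumes "bounded_linear L" "open S" "times_differentiable_on r S f"
  shows "times_differentiable_on r S (\<lambda>x. L (f x))"
  using assms(3)
proof (induction r arbitrary: f)
  case 0
  then show ?case using bounded_linear.continuous_on[OF assms(1)] by simp
next
  case (Suc r)
  show ?case
    by (rule times_differentiable_on_SucI[OF assms(2)
          bounded_linear.has_derivative[OF assms(1) times_differentiable_on_SucD[OF Suc.prems]]])
      (use Suc.IH Suc.prems in auto)
qed

lemma times_differentiable_on_ident: "open S \<Longrightarrow> times_differentiable_on r S (\<lambda>x. x)"
  by (cases r) (auto simp: times_differentiable_on_const)

lemma times_differentiable_on_add:
  assumes "open S" "times_differentiable_on r S f" "times_differentiable_on r S g"
  shows "times_differentiable_on r S (\<lambda>x. f x + g x)"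
  using assms(2,3)
proof (induction r arbitrary: f g)
  case 0
  then show ?case by (simp add: continuous_on_add)
next
  case (Suc r)
  show ?case
    by (rule times_differentiable_on_SucI[OF assms(1) has_derivative_add[OF
          times_differentiable_on_SucD[OF Suc.prems(1)] times_differentiable_on_SucD[OF Suc.prems(2)]]])
      (use Suc.IH Suc.prems in auto)
qed

lemma times_differentiable_on_sum:
  assumes "open S" "\<And>i. i \<in> I \<Longrightarrow> times_differentiable_on r S (f i)"
  shows "times_differentiable_on r S (\<lambda>x. \<Sum>i\<in>I. f i x)"
  using assms(2)
  by (induction I rule: infinite_finite_induct)
    (auto intro: times_differentiable_on_add[OF assms(1)] times_differentiable_on_const)

lemma times_differentiable_on_scaleR:
  fixes f :: "_ \<Rightarrow> real"
  assumes "open S" "times_differentiable_on r S f" "times_differentiable_on r S g"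
  shows "times_differentiable_on r S (\<lambda>x. f x *\<^sub>R g x)"
  using assms(2,3)
proof (induction r arbitrary: f g)
  case 0
  then show ?case by (simp add: continuous_on_scaleR)
next
  case (Suc r)
  have "times_differentiable_on r S (\<lambda>x. f x *\<^sub>R frechet_derivative g (at x) v
      + frechet_derivative f (at x) v *\<^sub>R g x)" for v
    by (intro times_differentiable_on_add assms(1) Suc.IH
        times_differentiable_on_Suc_imp[OF Suc.prems(1)] times_differentiable_on_Suc_imp[OF Suc.prems(2)])
      (use Suc.prems in simp_all)
  then show ?case
    using times_differentiable_on_SucI[OF assms(1) has_derivative_scaleR[OF
          times_differentiable_on_SucD[OF Suc.prems(1)] times_differentiable_on_SucD[OF Suc.prems(2)]]]
    by blast
qed

lemmas times_differentiable_on_mult =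
  times_differentiable_on_scaleR[where g = "g :: _ \<Rightarrow> real" for g, unfolded real_scaleR_def]

lemma times_differentiable_on_inverse:
  fixes f :: "_ \<Rightarrow> real"
  assumes "open S" "\<And>x. x \<in> S \<Longrightarrow> f x \<noteq> 0" "times_differentiable_on r S f"
  shows "times_differentiable_on r S (\<lambda>x. inverse (f x))"
  using assms(3)
proof (induction r)
  case 0
  then show ?case using assms(2) by (simp add: continuous_on_inverse)
next
  case (Suc r)
  have inv: "times_differentiable_on r S (\<lambda>x. inverse (f x))"
    using Suc.IH times_differentiable_on_Suc_imp[OF Suc.prems] by blast
  show ?case
  proof (rule times_differentiable_on_SucI[OF assms(1)])
    show "((\<lambda>x. inverse (f x)) has_derivative
        (\<lambda>v. (-1) * (inverse (f x) * frechet_derivative f (at x) v * inverse (f x)))) (at x)"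
      if "x \<in> S" for x
      using Deriv.has_derivative_inverse[OF assms(2)[OF that] times_differentiable_on_SucD[OF Suc.prems that]]
      by simp
    show "times_differentiable_on r S
        (\<lambda>x. (-1) * (inverse (f x) * frechet_derivative f (at x) v * inverse (f x)))" for v
      by (intro times_differentiable_on_mult[OF assms(1)] inv times_differentiable_on_const)
        (use Suc.prems in auto)
  qed
qed

lemma linear_basis_expansion:
  fixes L :: "'a::euclidean_space \<Rightarrow> 'b::real_vector"
  assumes "linear L"
  shows "L w = (\<Sum>b\<in>Basis. (w \<bullet> b) *\<^sub>R L b)"
proof -
  have "L (\<Sum>b\<in>Basis. (w \<bullet> b) *\<^sub>R b) = (\<Sum>b\<in>Basis. (w \<bullet> b) *\<^sub>R L b)"
    by (simp add: linear_sum[OF assms] linear_scale[OF assms])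
  then show ?thesis by (simp only: euclidean_representation)
qed

text \<open>The chain rule in coordinates: \<open>D(g \<circ> f)(x) v\<close> is the sum over the basis of the real factors
  \<open>Df(x) v \<bullet> b\<close> times \<open>Dg(f x) b\<close>, and in the second factor the direction no longer depends on \<open>x\<close>,
  so that the induction hypothesis applies to it.\<close>

lemma times_differentiable_on_compose:
  fixes f :: "'a::real_normed_vector \<Rightarrow> 'b::euclidean_space" and g :: "'b \<Rightarrow> 'c::real_normed_vector"
  assumes "open S" "f ` S \<subseteq> T" "times_differentiable_on r S f" "times_differentiable_on r T g"
  shows "times_differentiable_on r S (\<lambda>x. g (f x))"
  using assms(3,4)
proof (induction r arbitrary: g)
  case 0
  then show ?case using assms(2) by (auto intro: continuous_on_compose2)
next
  case (Suc r)
  have fin: "f x \<in> T" if "x \<in> S" for x using assms(2) that by auto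
  show ?case
  proof (rule times_differentiable_on_SucI[OF assms(1)])
    fix x assume x: "x \<in> S"
    have dg: "(g has_derivative frechet_derivative g (at (f x))) (at (f x))"
      by (rule times_differentiable_on_SucD[OF Suc.prems(2) fin[OF x]])
    have lin: "linear (frechet_derivative g (at (f x)))"
      using dg has_derivative_linear by blast
    from linear_basis_expansion[OF lin, symmetric] show "((\<lambda>x. g (f x)) has_derivative (\<lambda>v. \<Sum>b\<in>Basis.
        (frechet_derivative f (at x) v \<bullet> b) *\<^sub>R frechet_derivative g (at (f x)) b)) (at x)"
      using has_derivative_compose[OF times_differentiable_on_SucD[OF Suc.prems(1) x] dg] by (simp only:)
  next
    fix v
    show "times_differentiable_on r S (\<lambda>x. \<Sum>b\<in>Basis.
        (frechet_derivative f (at x) v \<bullet> b) *\<^sub>R frechet_derivative g (at (f x)) b)"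
    proof (intro times_differentiable_on_sum times_differentiable_on_scaleR assms(1))
      fix b :: 'b
      show "times_differentiable_on r S (\<lambda>x. frechet_derivative f (at x) v \<bullet> b)"
        by (intro times_differentiable_on_bounded_linear[OF bounded_linear_inner_left assms(1)])
          (use Suc.prems in auto)
      show "times_differentiable_on r S (\<lambda>x. frechet_derivative g (at (f x)) b)"
        by (rule Suc.IH[OF times_differentiable_on_Suc_imp[OF Suc.prems(1)]]) (use Suc.prems in simp)
    qed
  qed
qed

lemma smooth_on_cong:
  "open S \<Longrightarrow> smooth_on S f \<Longrightarrow> (\<And>x. x \<in> S \<Longrightarrow> f x = g x) \<Longrightarrow> smooth_on S g"
  unfolding smooth_on_def using times_differentiable_on_cong by blast

lemma smooth_on_subset: "smooth_on S f \<Longrightarrow> T \<subseteq> S \<Longrightarrow> smooth_on T f"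
  unfolding smooth_on_def using times_differentiable_on_subset by blast

lemma smooth_on_const: "smooth_on S (\<lambda>x. c)"
  unfolding smooth_on_def using times_differentiable_on_const by blast

lemma smooth_on_ident: "open S \<Longrightarrow> smooth_on S (\<lambda>x. x)"
  unfolding smooth_on_def using times_differentiable_on_ident by blast

lemma smooth_on_bounded_linear:
  "bounded_linear L \<Longrightarrow> open S \<Longrightarrow> smooth_on S f \<Longrightarrow> smooth_on S (\<lambda>x. L (f x))"
  unfolding smooth_on_def using times_differentiable_on_bounded_linear by blast

lemma smooth_on_add:
  "open S \<Longrightarrow> smooth_on S f \<Longrightarrow> smooth_on S g \<Longrightarrow> smooth_on S (\<lambda>x. f x + g x)"
  unfolding smooth_on_def using times_differentiable_on_add by blast

lemma smooth_on_sum: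
  "open S \<Longrightarrow> (\<And>i. i \<in> I \<Longrightarrow> smooth_on S (f i)) \<Longrightarrow> smooth_on S (\<lambda>x. \<Sum>i\<in>I. f i x)"
  unfolding smooth_on_def by (auto intro: times_differentiable_on_sum)

lemma smooth_on_scaleR:
  fixes f :: "_ \<Rightarrow> real"
  shows "open S \<Longrightarrow> smooth_on S f \<Longrightarrow> smooth_on S g \<Longrightarrow> smooth_on S (\<lambda>x. f x *\<^sub>R g x)"
  unfolding smooth_on_def using times_differentiable_on_scaleR by blast

lemma smooth_on_mult:
  fixes f :: "_ \<Rightarrow> real"
  shows "open S \<Longrightarrow> smooth_on S f \<Longrightarrow> smooth_on S g \<Longrightarrow> smooth_on S (\<lambda>x. f x * g x)"
  unfolding smooth_on_def using times_differentiable_on_mult by blast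

lemma smooth_on_diff:
  fixes f :: "_ \<Rightarrow> 'a::real_normed_vector"
  assumes "open S" "smooth_on S f" "smooth_on S g"
  shows "smooth_on S (\<lambda>x. f x - g x)"
  using smooth_on_add[OF assms(1,2)
      smooth_on_bounded_linear[OF bounded_linear_minus[OF bounded_linear_ident] assms(1,3)]] by simp

lemma smooth_on_prod:
  fixes f :: "_ \<Rightarrow> _ \<Rightarrow> real"
  assumes "open S" "\<And>i. i \<in> I \<Longrightarrow> smooth_on S (f i)"
  shows "smooth_on S (\<lambda>x. \<Prod>i\<in>I. f i x)"
  using assms(2)
  by (induction I rule: infinite_finite_induct)
    (auto intro: smooth_on_mult[OF assms(1)] smooth_on_const)

lemma smooth_on_inverse:
  fixes f :: "_ \<Rightarrow> real"
  shows "open S \<Longrightarrow> (\<And>x. x \<in> S \<Longrightarrow> f x \<noteq> 0) \<Longrightarrow> smooth_on S f \<Longrightarrow> smooth_on S (\<lambda>x. inverse (f x))"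
  unfolding smooth_on_def using times_differentiable_on_inverse by blast

lemma smooth_on_compose:
  fixes f :: "'a::real_normed_vector \<Rightarrow> 'b::euclidean_space" and g :: "'b \<Rightarrow> 'c::real_normed_vector"
  shows "open S \<Longrightarrow> f ` S \<subseteq> T \<Longrightarrow> smooth_on S f \<Longrightarrow> smooth_on T g \<Longrightarrow> smooth_on S (\<lambda>x. g (f x))"
  unfolding smooth_on_def using times_differentiable_on_compose by blast

lemma smooth_on_frechet_derivative:
  "smooth_on S f \<Longrightarrow> smooth_on S (\<lambda>x. frechet_derivative f (at x) v)"
  unfolding smooth_on_def by (metis times_differentiable_on.simps(2))

lemma smooth_on_has_derivative:
  "smooth_on S f \<Longrightarrow> x \<in> S \<Longrightarrow> (f has_derivative frechet_derivative f (at x)) (at x)"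
  unfolding smooth_on_def by (metis times_differentiable_on_SucD)

lemma smooth_on_linear_derivative:
  "smooth_on S f \<Longrightarrow> x \<in> S \<Longrightarrow> linear (frechet_derivative f (at x))"
  using smooth_on_has_derivative has_derivative_linear by blast

lemma smooth_on_continuous_on: "smooth_on S f \<Longrightarrow> continuous_on S f"
  unfolding smooth_on_def by (metis times_differentiable_on.simps(1))

lemma smooth_on_directional_derivative:
  fixes f :: "'b::euclidean_space \<Rightarrow> 'c::real_normed_vector" and a :: "'a::real_normed_vector \<Rightarrow> 'b"
  assumes "open S" "h ` S \<subseteq> T" "smooth_on S h" "smooth_on T f" "smooth_on S a"
  shows "smooth_on S (\<lambda>x. frechet_derivative f (at (h x)) (a x))"
proof (rule smooth_on_cong[OF assms(1)])
  show "smooth_on S (\<lambda>x. \<Sum>b\<in>Basis. (a x \<bullet> b) *\<^sub>R frechet_derivative f (at (h x)) b)"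
    by (intro smooth_on_sum smooth_on_scaleR assms
        smooth_on_bounded_linear[OF bounded_linear_inner_left]
        smooth_on_compose[OF assms(1-3) smooth_on_frechet_derivative])
  fix x assume "x \<in> S"
  then show "(\<Sum>b\<in>Basis. (a x \<bullet> b) *\<^sub>R frechet_derivative f (at (h x)) b) =
      frechet_derivative f (at (h x)) (a x)"
    using linear_basis_expansion[OF smooth_on_linear_derivative[OF assms(4)]] assms(2)
    by (metis image_subset_iff)
qed

text \<open>Product rule for \<open>Df(h x)(a x)\<close>, in which the base point and the direction both move. The expansion of
  \<open>a x\<close> in the basis reduces it to fixed directions.\<close>

lemma has_derivative_directional_derivative:
  fixes f :: "'b::euclidean_space \<Rightarrow> 'c::real_normed_vector" and a :: "'a::real_normed_vector \<Rightarrow> 'b"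
  assumes "open T" "smooth_on T f" "(h has_derivative h') (at x)" "(a has_derivative a') (at x)"
    and "h x \<in> T"
  shows "((\<lambda>x. frechet_derivative f (at (h x)) (a x)) has_derivative
    (\<lambda>v. frechet_derivative (\<lambda>y. frechet_derivative f (at y) (a x)) (at (h x)) (h' v)
       + frechet_derivative f (at (h x)) (a' v))) (at x)"
proof -
  let ?D = "\<lambda>y. frechet_derivative f (at y)"
  obtain U where U: "open U" "x \<in> U" "h ` U \<subseteq> T"
  proof -
    have "eventually (\<lambda>y. h y \<in> T) (nhds x)"
      using has_derivative_continuous[OF assms(3)] assms(1,5)
      by (metis continuous_within tendsto_def eventually_nhds_conv_at)
    then show ?thesis using that unfolding eventually_nhds by blast
  qed
  have exp: "?D y w = (\<Sum>b\<in>Basis. (w \<bullet> b) *\<^sub>R ?D y b)" if "y \<in> T" for y w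
    by (rule linear_basis_expansion[OF smooth_on_linear_derivative[OF assms(2) that]])
  have d2: "((\<lambda>y. ?D y b) has_derivative frechet_derivative (\<lambda>y. ?D y b) (at (h x))) (at (h x))" for b
    by (rule smooth_on_has_derivative[OF smooth_on_frechet_derivative[OF assms(2)] assms(5)])
  have main: "((\<lambda>x. \<Sum>b\<in>Basis. (a x \<bullet> b) *\<^sub>R ?D (h x) b) has_derivative
    (\<lambda>v. \<Sum>b\<in>Basis. (a x \<bullet> b) *\<^sub>R frechet_derivative (\<lambda>y. ?D y b) (at (h x)) (h' v)
        + (a' v \<bullet> b) *\<^sub>R ?D (h x) b)) (at x)"
    by (intro has_derivative_sum has_derivative_scaleR has_derivative_inner_left assms(4)
        has_derivative_compose[OF assms(3) d2])
  have e2: "frechet_derivative (\<lambda>y. ?D y w) (at (h x)) z =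
      (\<Sum>b\<in>Basis. (w \<bullet> b) *\<^sub>R frechet_derivative (\<lambda>y. ?D y b) (at (h x)) z)" for w z
  proof -
    have "((\<lambda>y. \<Sum>b\<in>Basis. (w \<bullet> b) *\<^sub>R ?D y b) has_derivative
        (\<lambda>z. \<Sum>b\<in>Basis. (w \<bullet> b) *\<^sub>R frechet_derivative (\<lambda>y. ?D y b) (at (h x)) z)) (at (h x))"
      by (intro has_derivative_sum has_derivative_scaleR_right d2)
    then have "((\<lambda>y. ?D y w) has_derivative
        (\<lambda>z. \<Sum>b\<in>Basis. (w \<bullet> b) *\<^sub>R frechet_derivative (\<lambda>y. ?D y b) (at (h x)) z)) (at (h x))"
      by (rule has_derivative_transform_within_open[OF _ assms(1,5)]) (rule exp[symmetric])
    from frechet_derivative_eq[OF this] show ?thesis by simp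
  qed
  have "((\<lambda>x. ?D (h x) (a x)) has_derivative
    (\<lambda>v. \<Sum>b\<in>Basis. (a x \<bullet> b) *\<^sub>R frechet_derivative (\<lambda>y. ?D y b) (at (h x)) (h' v)
        + (a' v \<bullet> b) *\<^sub>R ?D (h x) b)) (at x)"
    by (rule has_derivative_transform_within_open[OF main U(1,2)])
      (use U(3) in \<open>blast intro: exp[symmetric]\<close>)
  moreover have "(\<Sum>b\<in>Basis. (a x \<bullet> b) *\<^sub>R frechet_derivative (\<lambda>y. ?D y b) (at (h x)) (h' v)
        + (a' v \<bullet> b) *\<^sub>R ?D (h x) b) =
      frechet_derivative (\<lambda>y. ?D y (a x)) (at (h x)) (h' v) + ?D (h x) (a' v)" for v
    unfolding sum.distrib e2[where w = "a x" and z = "h' v"] exp[OF assms(5), of "a' v"] ..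
  ultimately show ?thesis by (simp only:)
qed

lemma has_derivative_vec:
  fixes f :: "'i::finite \<Rightarrow> 'a::real_normed_vector \<Rightarrow> 'b::euclidean_space"
  assumes "\<And>i. (f i has_derivative f' i) (at x)"
  shows "((\<lambda>x. \<chi> i. f i x) has_derivative (\<lambda>h. \<chi> i. f' i h)) (at x)"
  unfolding has_derivative_componentwise_within[of "\<lambda>x. \<chi> i. f i x"]
  by (auto simp: Basis_vec_def inner_axis intro!: has_derivative_inner_left assms)

lemma linear_axis: "linear (axis b :: 'a::real_vector \<Rightarrow> 'a ^ 'i::finite)"
  by (rule linearI) (auto simp: vec_eq_iff axis_def)

lemma bounded_linear_axis: "bounded_linear (axis b :: 'a::euclidean_space \<Rightarrow> 'a ^ 'i::finite)"
  by (rule iffD1[OF linear_conv_bounded_linear linear_axis])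

lemma smooth_on_vec:
  fixes f :: "'i::finite \<Rightarrow> 'a::real_normed_vector \<Rightarrow> 'b::euclidean_space"
  assumes "open S" "\<And>i. smooth_on S (f i)"
  shows "smooth_on S (\<lambda>x. \<chi> i. f i x)"
proof (rule smooth_on_cong[OF assms(1)])
  show "smooth_on S (\<lambda>x. \<Sum>i\<in>UNIV. axis i (f i x) :: 'b ^ 'i)"
    by (intro smooth_on_sum assms) (rule smooth_on_bounded_linear[OF bounded_linear_axis assms])
  show "(\<Sum>i\<in>UNIV. axis i (f i x)) = (\<chi> i. f i x)" for x
    by (auto simp: vec_eq_iff axis_def if_distrib cong: if_cong)
qed

lemma smooth_on_vec_nth:
  assumes "open S" "smooth_on S f" shows "smooth_on S (\<lambda>x. f x $ i)"
  by (rule smooth_on_bounded_linear[OF bounded_linear_vec_nth assms])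

lemma smooth_on_det:
  fixes g :: "'a::real_normed_vector \<Rightarrow> real ^ 'n::finite ^ 'n"
  assumes "open S" "\<And>i j. smooth_on S (\<lambda>x. g x $ i $ j)"
  shows "smooth_on S (\<lambda>x. det (g x))"
  unfolding det_def by (intro smooth_on_sum smooth_on_mult smooth_on_prod smooth_on_const assms)

lemma matrix_inv_inverse:
  fixes g :: "'a::semiring_1 ^ 'n::finite ^ 'm::finite"
  assumes "invertible g"
  shows "g ** matrix_inv g = mat 1" "matrix_inv g ** g = mat 1"
  using someI_ex[OF assms[unfolded invertible_def]] unfolding matrix_inv_def by blast+

text \<open>Cramer's rule writes the solution of a linear system as a quotient of determinants, hence it
  depends smoothly on the matrix and on the right-hand side.\<close>

lemma smooth_on_matrix_inv_vector_mult:
  fixes g :: "'a::real_normed_vector \<Rightarrow> real ^ 'n::finite ^ 'n"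
  assumes "open S" "\<And>i j. smooth_on S (\<lambda>x. g x $ i $ j)" "\<And>i. smooth_on S (\<lambda>x. w x $ i)"
    and inv: "\<And>x. x \<in> S \<Longrightarrow> invertible (g x)"
  shows "smooth_on S (\<lambda>x. (matrix_inv (g x) *v w x) $ l)"
proof (rule smooth_on_cong[OF assms(1)])
  have nz: "det (g x) \<noteq> 0" if "x \<in> S" for x using inv[OF that] invertible_det_nz by blast
  have "smooth_on S (\<lambda>x. (\<chi> i j. if j = l then w x $ i else g x $ i $ j) $ i $ j)" for i j
    using assms(2,3) by (cases "j = l") auto
  then show "smooth_on S (\<lambda>x. det (\<chi> i j. if j = l then w x $ i else g x $ i $ j) * inverse (det (g x)))"
    by (intro smooth_on_mult smooth_on_inverse smooth_on_det assms nz) auto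
  fix x assume x: "x \<in> S"
  have "g x *v (matrix_inv (g x) *v w x) = w x"
    using inv[OF x] by (simp add: matrix_vector_mul_assoc matrix_inv_inverse)
  then have "matrix_inv (g x) *v w x =
      (\<chi> l. det (\<chi> i j. if j = l then w x $ i else g x $ i $ j) / det (g x))"
    using cramer[OF nz[OF x]] by blast
  then show "det (\<chi> i j. if j = l then w x $ i else g x $ i $ j) * inverse (det (g x)) =
      (matrix_inv (g x) *v w x) $ l"
    by (simp add: divide_inverse)
qed

section \<open>Symmetry of second derivatives\<close>

text \<open>First differentiate along \<open>v\<close>, then along \<open>w\<close>.\<close>

definition second_derivative ::
  "('a::real_normed_vector \<Rightarrow> 'b::real_normed_vector) \<Rightarrow> 'a \<Rightarrow> 'a \<Rightarrow> 'a \<Rightarrow> 'b" where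
  "second_derivative f x v w = frechet_derivative (\<lambda>y. frechet_derivative f (at y) v) (at x) w"

lemma has_derivative_along_line:
  fixes f :: "'a::real_normed_vector \<Rightarrow> real"
  assumes "(f has_derivative f') (at (a + s *\<^sub>R w))"
  shows "((\<lambda>s. f (a + s *\<^sub>R w)) has_real_derivative f' w) (at s)"
proof -
  have "((\<lambda>s. f (a + s *\<^sub>R w)) has_derivative (\<lambda>h. f' (h *\<^sub>R w))) (at s)"
  proof (rule has_derivative_compose[where g = f and f = "\<lambda>s. a + s *\<^sub>R w"])
    show "((\<lambda>s. a + s *\<^sub>R w) has_derivative (\<lambda>h. h *\<^sub>R w)) (at s)"
      by (auto intro!: derivative_eq_intros)
  qed (fact assms)
  moreover have "(\<lambda>h. f' (h *\<^sub>R w)) = (*) (f' w)"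
    using linear_scale[OF has_derivative_linear[OF assms]] by (auto simp: mult.commute)
  ultimately show ?thesis by (simp only: has_field_derivative_def)
qed

text \<open>The second difference of \<open>f\<close> over a parallelogram is symmetric in its two sides; two applications
  of the mean value theorem turn it into a second derivative.\<close>

lemma second_difference_mean_value:
  fixes f :: "'a::real_normed_vector \<Rightarrow> real"
  assumes f: "smooth_on S f" and h: "h > 0"
    and S: "\<And>s t. 0 \<le> s \<Longrightarrow> s \<le> h \<Longrightarrow> 0 \<le> t \<Longrightarrow> t \<le> h \<Longrightarrow> x + s *\<^sub>R v + t *\<^sub>R w \<in> S"
  shows "\<exists>s t. 0 < s \<and> s < h \<and> 0 < t \<and> t < h \<and>
    f (x + h *\<^sub>R v + h *\<^sub>R w) - f (x + h *\<^sub>R v) - f (x + h *\<^sub>R w) + f x =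
      h * (h * second_derivative f (x + s *\<^sub>R v + t *\<^sub>R w) v w)"
proof -
  define \<phi> where "\<phi> s = f ((x + h *\<^sub>R w) + s *\<^sub>R v) - f (x + s *\<^sub>R v)" for s
  define \<phi>' where "\<phi>' s = frechet_derivative f (at ((x + h *\<^sub>R w) + s *\<^sub>R v)) v
      - frechet_derivative f (at (x + s *\<^sub>R v)) v" for s
  have "(\<phi> has_real_derivative \<phi>' s) (at s)" if "0 \<le> s" "s \<le> h" for s
    unfolding \<phi>_def \<phi>'_def
    using S[OF that, of h] S[OF that, of 0] h
    by (intro DERIV_diff has_derivative_along_line smooth_on_has_derivative[OF f])
      (auto simp: algebra_simps)
  from MVT2[OF h this] obtain s where s: "0 < s" "s < h" "\<phi> h - \<phi> 0 = h * \<phi>' s" by auto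
  define \<psi> where "\<psi> t = frechet_derivative f (at ((x + s *\<^sub>R v) + t *\<^sub>R w)) v" for t
  have "(\<psi> has_real_derivative second_derivative f (x + s *\<^sub>R v + t *\<^sub>R w) v w) (at t)"
    if "0 \<le> t" "t \<le> h" for t
    unfolding \<psi>_def second_derivative_def
    using S[of s t] s that
    by (intro has_derivative_along_line
        smooth_on_has_derivative[OF smooth_on_frechet_derivative[OF f]]) auto
  from MVT2[OF h this] obtain t where t: "0 < t" "t < h"
    "\<psi> h - \<psi> 0 = h * second_derivative f (x + s *\<^sub>R v + t *\<^sub>R w) v w" by auto
  have "\<phi>' s = \<psi> h - \<psi> 0" by (simp add: \<phi>'_def \<psi>_def algebra_simps)
  then have "\<phi> h - \<phi> 0 = h * (h * second_derivative f (x + s *\<^sub>R v + t *\<^sub>R w) v w)"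
    using s t by simp
  moreover have "\<phi> h - \<phi> 0 = f (x + h *\<^sub>R v + h *\<^sub>R w) - f (x + h *\<^sub>R v) - f (x + h *\<^sub>R w) + f x"
    by (simp add: \<phi>_def algebra_simps)
  ultimately show ?thesis using s(1,2) t(1,2) by metis
qed

text \<open>The same second difference equals \<open>h\<^sup>2\<close> times the second derivative in either order, each at some point
  of the small parallelogram; by continuity the two values agree in the limit.\<close>

lemma second_derivative_symmetric_real:
  fixes f :: "'a::real_normed_vector \<Rightarrow> real"
  assumes "open S" "smooth_on S f" "x \<in> S"
  shows "second_derivative f x v w = second_derivative f x w v"
proof (rule ccontr)
  assume neq: "second_derivative f x v w \<noteq> second_derivative f x w v"
  \<comment> \<open>Half the gap: two values that are closer than this to the two sides cannot coincide.\<close>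
  define \<epsilon> where "\<epsilon> = \<bar>second_derivative f x v w - second_derivative f x w v\<bar> / 2"
  have \<epsilon>: "\<epsilon> > 0" using neq by (simp add: \<epsilon>_def)
  have "\<exists>d>0. \<forall>y. dist y x < d \<longrightarrow> \<bar>second_derivative f y v w - second_derivative f x v w\<bar> < \<epsilon>" for v w
  proof -
    have "continuous_on S (\<lambda>y. second_derivative f y v w)"
      unfolding second_derivative_def
      by (intro smooth_on_continuous_on smooth_on_frechet_derivative assms)
    then have "isCont (\<lambda>y. second_derivative f y v w) x"
      using assms by (simp add: continuous_on_eq_continuous_at)
    then show ?thesis using \<epsilon> unfolding continuous_at_eps_delta dist_real_def by blast
  qed
  then obtain d1 d2 where d: "d1 > 0" "d2 > 0"
    "\<And>y. dist y x < d1 \<Longrightarrow> \<bar>second_derivative f y v w - second_derivative f x v w\<bar> < \<epsilon>"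
    "\<And>y. dist y x < d2 \<Longrightarrow> \<bar>second_derivative f y w v - second_derivative f x w v\<bar> < \<epsilon>"
    by metis
  obtain d3 where d3: "d3 > 0" "ball x d3 \<subseteq> S" using assms openE by blast
  define d where "d = min d1 (min d2 d3)"
  \<comment> \<open>So small that the parallelogram spanned by \<open>h v\<close> and \<open>h w\<close> at \<open>x\<close> stays within distance \<open>d\<close>.\<close>
  define h where "h = d / (2 * (norm v + norm w + 1))"
  have pos: "norm v + norm w + 1 > 0" using norm_ge_zero[of v] norm_ge_zero[of w] by linarith
  have dpos: "d > 0" using d d3 by (simp add: d_def)
  have h: "h > 0" using dpos pos by (simp add: h_def)
  have small: "dist (x + s *\<^sub>R v + t *\<^sub>R w) x < d" if "0 \<le> s" "s \<le> h" "0 \<le> t" "t \<le> h" for s t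
  proof -
    have "dist (x + s *\<^sub>R v + t *\<^sub>R w) x = norm (s *\<^sub>R v + t *\<^sub>R w)"
      by (simp add: dist_norm add.assoc)
    also have "\<dots> \<le> s * norm v + t * norm w"
      using norm_triangle_ineq[of "s *\<^sub>R v" "t *\<^sub>R w"] that by simp
    also have "\<dots> \<le> h * norm v + h * norm w" using that by (intro add_mono mult_right_mono) auto
    also have "\<dots> \<le> h * (norm v + norm w + 1)" using h by (simp add: algebra_simps)
    also have "\<dots> = d / 2" using pos unfolding h_def times_divide_eq_left mult.commute[of 2]
      by (subst frac_eq_eq) auto
    also have "\<dots> < d" using dpos by simp
    finally show ?thesis .
  qed
  have inS: "x + s *\<^sub>R v + t *\<^sub>R w \<in> S" if "0 \<le> s" "s \<le> h" "0 \<le> t" "t \<le> h" for s t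
    using small[OF that] d3(2) by (auto simp: d_def dist_commute)
  have inS': "x + s *\<^sub>R w + t *\<^sub>R v \<in> S" if "0 \<le> s" "s \<le> h" "0 \<le> t" "t \<le> h" for s t
    using inS[OF that(3,4,1,2)] by (simp add: algebra_simps)
  obtain s t where st: "0 < s" "s < h" "0 < t" "t < h"
    "f (x + h *\<^sub>R v + h *\<^sub>R w) - f (x + h *\<^sub>R v) - f (x + h *\<^sub>R w) + f x =
      h * (h * second_derivative f (x + s *\<^sub>R v + t *\<^sub>R w) v w)"
    using second_difference_mean_value[OF assms(2) h inS] by blast
  obtain s' t' where st': "0 < s'" "s' < h" "0 < t'" "t' < h"
    "f (x + h *\<^sub>R w + h *\<^sub>R v) - f (x + h *\<^sub>R w) - f (x + h *\<^sub>R v) + f x =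
      h * (h * second_derivative f (x + s' *\<^sub>R w + t' *\<^sub>R v) w v)"
    using second_difference_mean_value[OF assms(2) h inS'] by blast
  have "h * (h * second_derivative f (x + s *\<^sub>R v + t *\<^sub>R w) v w) =
      h * (h * second_derivative f (x + s' *\<^sub>R w + t' *\<^sub>R v) w v)"
    using st(5) st'(5) by (simp add: algebra_simps)
  then have eq: "second_derivative f (x + s *\<^sub>R v + t *\<^sub>R w) v w =
      second_derivative f (x + s' *\<^sub>R w + t' *\<^sub>R v) w v"
    using h by simp
  have "\<bar>second_derivative f (x + s *\<^sub>R v + t *\<^sub>R w) v w - second_derivative f x v w\<bar> < \<epsilon>"
    by (rule d(3)) (use small[of s t] st in \<open>auto simp: d_def\<close>)
  moreover have "\<bar>second_derivative f (x + s' *\<^sub>R w + t' *\<^sub>R v) w v - second_derivative f x w v\<bar> < \<epsilon>"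
    by (rule d(4)) (use small[of t' s'] st' in \<open>auto simp: d_def algebra_simps\<close>)
  moreover have "\<bar>a - b\<bar> \<le> \<bar>c - a\<bar> + \<bar>c - b\<bar>" for a b c :: real by arith
  ultimately show False using eq unfolding \<epsilon>_def by (metis add_strict_mono field_sum_of_halves not_le)
qed

lemma second_derivative_inner:
  fixes f :: "'a::real_normed_vector \<Rightarrow> 'b::euclidean_space"
  assumes "open S" "smooth_on S f" "x \<in> S"
  shows "second_derivative (\<lambda>x. f x \<bullet> b) x v w = second_derivative f x v w \<bullet> b"
proof -
  have 1: "((\<lambda>y. frechet_derivative f (at y) v \<bullet> b) has_derivative (\<lambda>w. second_derivative f x v w \<bullet> b)) (at x)"
    unfolding second_derivative_def
    by (rule has_derivative_inner_left[OF
          smooth_on_has_derivative[OF smooth_on_frechet_derivative[OF assms(2)] assms(3)]])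
  have 2: "frechet_derivative f (at y) v \<bullet> b = frechet_derivative (\<lambda>x. f x \<bullet> b) (at y) v"
    if "y \<in> S" for y
    using frechet_derivative_eq[OF has_derivative_inner_left[OF smooth_on_has_derivative[OF assms(2) that]]]
    by metis
  have "((\<lambda>y. frechet_derivative (\<lambda>x. f x \<bullet> b) (at y) v) has_derivative
      (\<lambda>w. second_derivative f x v w \<bullet> b)) (at x)"
    by (rule has_derivative_transform_within_open[OF 1 assms(1,3) 2])
  from frechet_derivative_eq[OF this] show ?thesis by (simp add: second_derivative_def)
qed

lemma second_derivative_symmetric:
  fixes f :: "'a::real_normed_vector \<Rightarrow> 'b::euclidean_space"
  assumes "open S" "smooth_on S f" "x \<in> S"
  shows "second_derivative f x v w = second_derivative f x w v"
proof (rule euclidean_eqI)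
  fix b :: 'b
  show "second_derivative f x v w \<bullet> b = second_derivative f x w v \<bullet> b"
    using second_derivative_symmetric_real[OF assms(1)
        smooth_on_bounded_linear[OF bounded_linear_inner_left assms(1,2)] assms(3)]
    by (simp add: second_derivative_inner[OF assms])
qed

lemma linear_second_derivative:
  assumes "smooth_on S f" "x \<in> S"
  shows "linear (second_derivative f x v)"
  using smooth_on_linear_derivative[OF smooth_on_frechet_derivative[OF assms(1)] assms(2)]
  unfolding second_derivative_def[abs_def] .

section \<open>Iterated derivatives of curves\<close>

lemma vector_derivative_cong_open:
  assumes "open S" "t \<in> S" "\<And>s. s \<in> S \<Longrightarrow> f s = g s"
  shows "vector_derivative f (at t) = vector_derivative g (at t)"
proof -
  have "(f has_vector_derivative D) (at t) \<longleftrightarrow> (g has_vector_derivative D) (at t)" for D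
    using has_vector_derivative_transform_within_open[of f D t S g]
      has_vector_derivative_transform_within_open[of g D t S f] assms by auto
  then show ?thesis by (simp add: vector_derivative_def)
qed

lemma frechet_derivative_cong_open:
  assumes "open S" "x \<in> S" "\<And>y. y \<in> S \<Longrightarrow> f y = g y"
  shows "frechet_derivative f (at x) = frechet_derivative g (at x)"
proof -
  have "(f has_derivative D) (at x) \<longleftrightarrow> (g has_derivative D) (at x)" for D
    using has_derivative_transform_within_open[of f D x UNIV S g]
      has_derivative_transform_within_open[of g D x UNIV S f] assms by auto
  then show ?thesis by (simp add: frechet_derivative_def)
qed

lemma nth_deriv_0 [simp]: "nth_deriv 0 f = f"
  by (simp add: nth_deriv_def)

lemma nth_deriv_Suc: "nth_deriv (Suc r) f = (\<lambda>t. vector_derivative (nth_deriv r f) (at t))"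
  by (simp add: nth_deriv_def)

lemma nth_deriv_cong_open:
  assumes "open S" "t \<in> S" "\<And>s. s \<in> S \<Longrightarrow> f s = g s"
  shows "nth_deriv r f t = nth_deriv r g t"
  using assms(2)
proof (induction r arbitrary: t)
  case 0
  then show ?case using assms(3) by simp
next
  case (Suc r)
  then show ?case
    using vector_derivative_cong_open[OF assms(1) Suc.prems Suc.IH] by (simp add: nth_deriv_Suc)
qed

lemma nth_deriv_translate: "nth_deriv r (\<lambda>s. f (t + s)) s = nth_deriv r f (t + s)"
proof (induction r arbitrary: s)
  case (Suc r)
  have shift: "((\<lambda>s. g (t + s)) has_vector_derivative D) (at s) \<longleftrightarrow>
      (g has_vector_derivative D) (at (t + s))" for g :: "real \<Rightarrow> 'a" and D s
  proof
    assume "((\<lambda>s. g (t + s)) has_vector_derivative D) (at s)"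
    then have "(((\<lambda>s. g (t + s)) \<circ> (\<lambda>s. s - t)) has_vector_derivative 1 *\<^sub>R D) (at (t + s))"
      by (intro vector_diff_chain_at) (auto intro!: derivative_eq_intros)
    then show "(g has_vector_derivative D) (at (t + s))" by (simp add: o_def)
  next
    assume "(g has_vector_derivative D) (at (t + s))"
    then have "((g \<circ> (\<lambda>s. t + s)) has_vector_derivative 1 *\<^sub>R D) (at s)"
      by (intro vector_diff_chain_at) (auto intro!: derivative_eq_intros)
    then show "((\<lambda>s. g (t + s)) has_vector_derivative D) (at s)" by (simp add: o_def)
  qed
  have "nth_deriv r (\<lambda>s. f (t + s)) = (\<lambda>s. nth_deriv r f (t + s))" using Suc.IH by auto
  then show ?case unfolding nth_deriv_Suc vector_derivative_def by (simp add: shift)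
qed simp

lemma smooth_on_vector_derivative:
  fixes f :: "real \<Rightarrow> 'a::real_normed_vector"
  assumes "open I" "smooth_on I f"
  shows "smooth_on I (\<lambda>t. vector_derivative f (at t))"
proof (rule smooth_on_cong[OF assms(1) smooth_on_frechet_derivative[OF assms(2), of 1]])
  fix t assume "t \<in> I"
  then have "f differentiable (at t)"
    using smooth_on_has_derivative[OF assms(2)] by (auto simp: differentiable_def)
  then show "frechet_derivative f (at t) 1 = vector_derivative f (at t)"
    by (simp add: frechet_derivative_eq_vector_derivative)
qed

lemma smooth_on_has_vector_derivative:
  fixes f :: "real \<Rightarrow> 'a::real_normed_vector"
  assumes "smooth_on I f" "t \<in> I"
  shows "(f has_vector_derivative vector_derivative f (at t)) (at t)"
  using smooth_on_has_derivative[OF assms]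
  by (auto simp: vector_derivative_works[symmetric] differentiable_def)

lemma smooth_on_nth_deriv:
  assumes "open I" "smooth_on I f"
  shows "smooth_on I (nth_deriv r f)"
  by (induction r) (simp_all add: assms nth_deriv_Suc smooth_on_vector_derivative)

lemma nth_deriv_has_vector_derivative:
  assumes "open I" "smooth_on I f" "t \<in> I"
  shows "(nth_deriv r f has_vector_derivative nth_deriv (Suc r) f t) (at t)"
  using smooth_on_has_vector_derivative[OF smooth_on_nth_deriv[OF assms(1,2)] assms(3)]
  by (simp add: nth_deriv_Suc)

lemma nth_deriv_const: "nth_deriv (Suc r) (\<lambda>t. c) = (\<lambda>t. 0)"
  by (induction r) (auto simp: nth_deriv_Suc)

lemma smooth_on_polynomial_curve: "smooth_on UNIV (\<lambda>t::real. \<Sum>\<beta>\<le>m. t ^ \<beta> *\<^sub>R a \<beta>)"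
proof -
  have "smooth_on UNIV (\<lambda>t::real. t ^ \<beta>)" for \<beta>
    by (induction \<beta>) (simp_all add: smooth_on_mult[OF _ smooth_on_ident] smooth_on_const)
  then show ?thesis by (intro smooth_on_sum smooth_on_scaleR smooth_on_const) auto
qed

text \<open>Polynomial curves realize every prescribed list of derivatives at 0, hence every vector of jet
  coordinates.\<close>

lemma nth_deriv_polynomial_curve:
  fixes a :: "nat \<Rightarrow> 'a::real_normed_vector"
  assumes "r \<le> m"
  shows "nth_deriv r (\<lambda>t. \<Sum>\<beta>\<le>m. t ^ \<beta> *\<^sub>R a \<beta>) 0 = fact r *\<^sub>R a r"
proof -
  define p where "p b t = (\<Sum>\<beta>\<le>m. t ^ \<beta> *\<^sub>R b \<beta>)" for b :: "nat \<Rightarrow> 'a" and t :: real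
  \<comment> \<open>The coefficients of the derivative of the polynomial with coefficients \<open>b\<close>.\<close>
  define d where "d b \<beta> = (if \<beta> < m then real (Suc \<beta>) *\<^sub>R b (Suc \<beta>) else 0)"
    for b :: "nat \<Rightarrow> 'a" and \<beta>
  have p': "(p b has_vector_derivative p (d b) t) (at t)" for b t
  proof -
    have "(p b has_vector_derivative (\<Sum>\<beta>\<le>m. (real \<beta> * t ^ (\<beta> - 1)) *\<^sub>R b \<beta>)) (at t)"
      unfolding p_def[abs_def]
      by (auto intro!: derivative_eq_intros has_vector_derivative_sum
          simp: has_vector_derivative_def scaleR_sum_right ac_simps)
    moreover have "(\<Sum>\<beta>\<le>m. (real \<beta> * t ^ (\<beta> - 1)) *\<^sub>R b \<beta>) = p (d b) t"
    proof -
      have "p (d b) t = (\<Sum>\<beta><m. t ^ \<beta> *\<^sub>R (real (Suc \<beta>) *\<^sub>R b (Suc \<beta>)))"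
        unfolding p_def lessThan_Suc_atMost[symmetric] by (simp add: d_def)
      moreover have "(\<Sum>\<beta>\<le>m. (real \<beta> * t ^ (\<beta> - 1)) *\<^sub>R b \<beta>) =
          (\<Sum>\<beta><m. (real (Suc \<beta>) * t ^ \<beta>) *\<^sub>R b (Suc \<beta>))"
        by (subst sum.atMost_shift) simp
      ultimately show ?thesis by (simp add: mult.commute)
    qed
    ultimately show ?thesis by simp
  qed
  have "nth_deriv r (p b) = p ((d ^^ r) b)" for r b
  proof (induction r)
    case (Suc r)
    then show ?case using vector_derivative_at[OF p'] by (auto simp: nth_deriv_Suc)
  qed simp
  moreover have "p b 0 = b 0" for b
    unfolding p_def by (simp add: sum.atMost_shift)
  moreover have "(d ^^ r) b \<beta> = (fact (\<beta> + r) / fact \<beta>) *\<^sub>R b (\<beta> + r)" if "\<beta> + r \<le> m" for r b \<beta>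
    using that
  proof (induction r arbitrary: \<beta>)
    case (Suc r)
    have "(d ^^ Suc r) b \<beta> = real (Suc \<beta>) *\<^sub>R (d ^^ r) b (Suc \<beta>)" using Suc.prems by (simp add: d_def)
    also have "\<dots> = (real (Suc \<beta>) * (fact (Suc \<beta> + r) / fact (Suc \<beta>))) *\<^sub>R b (Suc \<beta> + r)"
      using Suc by simp
    finally show ?case by (simp add: divide_simps)
  qed simp
  ultimately show ?thesis using assms by (simp add: p_def[abs_def])
qed

section \<open>Prolongation of coordinate changes\<close>

locale block_numbering =
  fixes k :: nat and e :: "nat \<Rightarrow> 'j::finite"
  assumes order_pos: "k \<ge> 1" and bij: "bij_betw e {..k} UNIV"
begin

lemma inv_e [simp]: "\<alpha> \<le> k \<Longrightarrow> inv_into {..k} e (e \<alpha>) = \<alpha>"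
  using bij by (auto simp: bij_betw_def)

lemma e_eq_iff [simp]: "\<alpha> \<le> k \<Longrightarrow> \<beta> \<le> k \<Longrightarrow> e \<alpha> = e \<beta> \<longleftrightarrow> \<alpha> = \<beta>"
  using bij by (auto simp: bij_betw_def inj_on_def)

lemma e_cases: obtains \<alpha> where "b = e \<alpha>" "\<alpha> \<le> k"
  using bij by (metis UNIV_I atMost_iff bij_betw_imp_surj_on imageE)

lemma block_eqI: "(\<And>\<alpha>. \<alpha> \<le> k \<Longrightarrow> u $ e \<alpha> = v $ e \<alpha>) \<Longrightarrow> u = v"
  by (metis e_cases vec_eq_iff)

lemma axis_block [simp]:
  "\<alpha> \<le> k \<Longrightarrow> \<beta> \<le> k \<Longrightarrow> axis (e \<alpha>) z $ e \<beta> = (if \<alpha> = \<beta> then z else 0)"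
  by (simp add: axis_def)

text \<open>The vector of coefficients of the operator \<open>\<Gamma>\<close>: \<open>\<Gamma> f (u) = Df(u)(shift u)\<close>.\<close>

definition shift :: "real ^ 'n ^ 'j \<Rightarrow> real ^ 'n::finite ^ 'j" where
  "shift u = (\<chi> b. let \<alpha> = inv_into {..k} e b in
     if \<alpha> < k then real (Suc \<alpha>) *\<^sub>R u $ e (Suc \<alpha>) else 0)"

lemma shift_block: "\<alpha> < k \<Longrightarrow> shift u $ e \<alpha> = real (Suc \<alpha>) *\<^sub>R u $ e (Suc \<alpha>)"
  by (simp add: shift_def)

lemma shift_top [simp]: "shift u $ e k = 0"
  by (simp add: shift_def)

lemma linear_shift: "linear shift"
  by (rule linearI)
    (auto simp: shift_def Let_def vec_eq_iff scaleR_right_distrib algebra_simps)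

lemma shift_axis:
  assumes "\<beta> \<le> k" shows "shift (axis (e \<beta>) z) = real \<beta> *\<^sub>R axis (e (\<beta> - 1)) z"
proof (rule block_eqI)
  fix \<alpha> assume "\<alpha> \<le> k"
  then show "shift (axis (e \<beta>) z) $ e \<alpha> = (real \<beta> *\<^sub>R axis (e (\<beta> - 1)) z) $ e \<alpha>"
    using assms by (cases "\<alpha> < k"; cases \<beta>) (auto simp: shift_block less_le)
qed

lemma bounded_linear_shift: "bounded_linear shift"
  using linear_shift by (simp only: linear_conv_bounded_linear)

text \<open>\<open>prol \<tau> \<alpha>\<close> is the Taylor coefficient of order \<open>\<alpha>\<close> of \<open>\<tau> \<circ> x\<close>, as a function of the Taylor
  coefficients of the curve \<open>x\<close>; the recursion is \<open>(\<alpha> + 1) T\<^sub>\<alpha>\<^sub>+\<^sub>1 = \<Gamma> T\<^sub>\<alpha>\<close>. This meaning is limited to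
  \<open>\<alpha> \<le> k\<close>, since \<open>shift\<close> stops at block \<open>k\<close>.\<close>

primrec prol :: "(real ^ 'n \<Rightarrow> real ^ 'n) \<Rightarrow> nat \<Rightarrow> real ^ 'n ^ 'j \<Rightarrow> real ^ 'n::finite" where
  "prol \<tau> 0 = (\<lambda>u. \<tau> (u $ e 0))"
| "prol \<tau> (Suc \<alpha>) = (\<lambda>u. (1 / real (Suc \<alpha>)) *\<^sub>R frechet_derivative (prol \<tau> \<alpha>) (at u) (shift u))"

definition prolongation :: "(real ^ 'n \<Rightarrow> real ^ 'n) \<Rightarrow> real ^ 'n ^ 'j \<Rightarrow> real ^ 'n::finite ^ 'j" where
  "prolongation \<tau> u = (\<chi> b. prol \<tau> (inv_into {..k} e b) u)"

lemma prolongation_block [simp]: "\<alpha> \<le> k \<Longrightarrow> prolongation \<tau> u $ e \<alpha> = prol \<tau> \<alpha> u"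
  by (simp add: prolongation_def)

text \<open>The coordinate vectors of the jets whose base point has its coordinates in \<open>P\<close>.\<close>

definition cyl :: "(real ^ 'n) set \<Rightarrow> (real ^ 'n::finite ^ 'j) set" where
  "cyl P = {u. u $ e 0 \<in> P}"

lemma open_cyl:
  fixes P :: "(real ^ 'n::finite) set"
  assumes "open P" shows "open (cyl P)"
proof -
  from assms have "open ((\<lambda>u :: real ^ 'n ^ 'j. u $ e 0) -` P)"
    by (intro open_vimage continuous_on_component) auto
  then show ?thesis by (simp add: cyl_def vimage_def)
qed

end

locale coordinate_change = block_numbering k e for k and e :: "nat \<Rightarrow> 'j::finite" +
  fixes P :: "(real ^ 'n::finite) set" and \<tau> :: "real ^ 'n \<Rightarrow> real ^ 'n"
  assumes open_P: "open P" and smooth_\<tau>: "smooth_on P \<tau>"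
begin

lemma open_cyl_P: "open (cyl P)"
  by (rule open_cyl[OF open_P])

lemma smooth_prol: "smooth_on (cyl P) (prol \<tau> \<alpha>)"
proof (induction \<alpha>)
  case 0
  have "smooth_on (cyl P) (\<lambda>u. \<tau> (u $ e 0))"
    by (rule smooth_on_compose[OF open_cyl_P _
          smooth_on_vec_nth[OF open_cyl_P smooth_on_ident[OF open_cyl_P]] smooth_\<tau>])
      (auto simp: cyl_def)
  then show ?case by simp
next
  case (Suc \<alpha>)
  have "smooth_on (cyl P) (\<lambda>u. frechet_derivative (prol \<tau> \<alpha>) (at u) (shift u))"
    by (rule smooth_on_directional_derivative[where h = "\<lambda>u. u", OF open_cyl_P _ _ Suc])
      (auto intro: smooth_on_bounded_linear[OF bounded_linear_shift, where f = "\<lambda>u. u"]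
        smooth_on_ident open_cyl_P)
  then have "smooth_on (cyl P)
      (\<lambda>u. (1 / real (Suc \<alpha>)) *\<^sub>R frechet_derivative (prol \<tau> \<alpha>) (at u) (shift u))"
    by (intro smooth_on_scaleR smooth_on_const open_cyl_P)
  then show ?case by simp
qed

text \<open>The commutation rule of a partial derivative with \<open>\<Gamma>\<close>: differentiating \<open>DT\<^sub>\<alpha>(u)(shift u)\<close> along \<open>v\<close> gives
  \<open>\<Gamma>\<close> applied to the derivative of \<open>T\<^sub>\<alpha>\<close> along \<open>v\<close>, plus the derivative of \<open>T\<^sub>\<alpha>\<close> along \<open>shift v\<close>. If \<open>v\<close> lies
  in block \<open>\<beta>\<close>, then \<open>shift v\<close> lies in block \<open>\<beta> - 1\<close>, which drives the inductions below.\<close>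

lemma prol_Suc_derivative:
  assumes u: "u \<in> cyl P"
  shows "real (Suc \<alpha>) *\<^sub>R frechet_derivative (prol \<tau> (Suc \<alpha>)) (at u) v =
    second_derivative (prol \<tau> \<alpha>) u v (shift u) + frechet_derivative (prol \<tau> \<alpha>) (at u) (shift v)"
proof -
  have "((\<lambda>u. frechet_derivative (prol \<tau> \<alpha>) (at u) (shift u)) has_derivative
      (\<lambda>v. second_derivative (prol \<tau> \<alpha>) u (shift u) v
         + frechet_derivative (prol \<tau> \<alpha>) (at u) (shift v))) (at u)"
    unfolding second_derivative_def
    by (rule has_derivative_directional_derivative[where h = "\<lambda>u. u" and h' = "\<lambda>v. v",
          OF open_cyl_P smooth_prol _ bounded_linear_imp_has_derivative[OF bounded_linear_shift] u])
      (rule has_derivative_ident)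
  then have "((prol \<tau> (Suc \<alpha>)) has_derivative
      (\<lambda>v. (1 / real (Suc \<alpha>)) *\<^sub>R (second_derivative (prol \<tau> \<alpha>) u (shift u) v
         + frechet_derivative (prol \<tau> \<alpha>) (at u) (shift v)))) (at u)"
    unfolding prol.simps by (rule has_derivative_scaleR_right)
  from frechet_derivative_eq[OF this] show ?thesis
    using second_derivative_symmetric[OF open_cyl_P smooth_prol u, of \<alpha> v "shift u"] by simp
qed

lemma second_derivative_prol_eq:
  assumes "u \<in> cyl P" "\<And>w. w \<in> cyl P \<Longrightarrow> frechet_derivative (prol \<tau> \<alpha>) (at w) v = g w"
  shows "second_derivative (prol \<tau> \<alpha>) u v x = frechet_derivative g (at u) x"
  unfolding second_derivative_def
  using frechet_derivative_cong_open[OF open_cyl_P assms] by simp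

lemma prol_0_derivative:
  assumes "u \<in> cyl P"
  shows "frechet_derivative (prol \<tau> 0) (at u) v = frechet_derivative \<tau> (at (u $ e 0)) (v $ e 0)"
proof -
  have "((\<lambda>u. \<tau> (u $ e 0)) has_derivative (\<lambda>v. frechet_derivative \<tau> (at (u $ e 0)) (v $ e 0))) (at u)"
    by (rule has_derivative_compose[OF bounded_linear_imp_has_derivative[OF bounded_linear_vec_nth]
          smooth_on_has_derivative[OF smooth_\<tau>]]) (use assms in \<open>simp add: cyl_def\<close>)
  from frechet_derivative_eq[OF this] show ?thesis by simp
qed

text \<open>The Taylor coefficient of order \<open>\<alpha>\<close> of \<open>\<tau> \<circ> x\<close> involves the coefficients of \<open>x\<close> up to order \<open>\<alpha>\<close> only.\<close>

lemma prol_derivative_above: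
  assumes "u \<in> cyl P" "\<alpha> < \<beta>" "\<beta> \<le> k"
  shows "frechet_derivative (prol \<tau> \<alpha>) (at u) (axis (e \<beta>) z) = 0"
  using assms
proof (induction \<alpha> arbitrary: \<beta> u)
  case 0
  then show ?case
    using linear_0[OF smooth_on_linear_derivative[OF smooth_\<tau>]]
    by (simp add: prol_0_derivative cyl_def del: prol.simps)
next
  case (Suc \<alpha>)
  have "second_derivative (prol \<tau> \<alpha>) u (axis (e \<beta>) z) (shift u) =
      frechet_derivative (\<lambda>w. 0) (at u) (shift u)"
    by (rule second_derivative_prol_eq[OF Suc.prems(1) Suc.IH]) (use Suc.prems in auto)
  moreover have "frechet_derivative (prol \<tau> \<alpha>) (at u) (shift (axis (e \<beta>) z)) = 0"
    using Suc.IH[OF Suc.prems(1), of "\<beta> - 1"] Suc.prems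
      linear_scale[OF smooth_on_linear_derivative[OF smooth_prol Suc.prems(1)]]
    by (simp add: shift_axis)
  ultimately have "real (Suc \<alpha>) *\<^sub>R frechet_derivative (prol \<tau> (Suc \<alpha>)) (at u) (axis (e \<beta>) z) = 0"
    unfolding prol_Suc_derivative[OF Suc.prems(1)] by simp
  then show ?case by (simp del: prol.simps)
qed

lemma prol_derivative_top:
  assumes "u \<in> cyl P" "\<alpha> \<le> k"
  shows "frechet_derivative (prol \<tau> \<alpha>) (at u) (axis (e \<alpha>) z) = frechet_derivative \<tau> (at (u $ e 0)) z"
  using assms
proof (induction \<alpha> arbitrary: u)
  case 0
  then show ?case by (simp add: prol_0_derivative del: prol.simps)
next
  case (Suc \<alpha>)
  have "second_derivative (prol \<tau> \<alpha>) u (axis (e (Suc \<alpha>)) z) (shift u) =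
      frechet_derivative (\<lambda>w. 0) (at u) (shift u)"
    by (rule second_derivative_prol_eq[OF Suc.prems(1) prol_derivative_above]) (use Suc.prems in auto)
  moreover have "frechet_derivative (prol \<tau> \<alpha>) (at u) (shift (axis (e (Suc \<alpha>)) z)) =
      real (Suc \<alpha>) *\<^sub>R frechet_derivative \<tau> (at (u $ e 0)) z"
    using Suc.IH[OF Suc.prems(1)] Suc.prems
      linear_scale[OF smooth_on_linear_derivative[OF smooth_prol Suc.prems(1)]]
    by (simp add: shift_axis)
  ultimately have "real (Suc \<alpha>) *\<^sub>R frechet_derivative (prol \<tau> (Suc \<alpha>)) (at u) (axis (e (Suc \<alpha>)) z)
      = real (Suc \<alpha>) *\<^sub>R frechet_derivative \<tau> (at (u $ e 0)) z"
    unfolding prol_Suc_derivative[OF Suc.prems(1)] by simp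
  then show ?case by (simp del: prol.simps)
qed

text \<open>The value on the right is the derivative of \<open>D\<tau>\<close> along the curve. At each step of the induction \<open>\<Gamma>\<close>
  applied to the top derivative \<open>D\<tau>\<close> contributes it once and the shifted direction contributes it
  \<open>\<alpha> + 1\<close> times; these add up to the factor \<open>\<alpha> + 2\<close> that the recursion divides by.\<close>

lemma prol_derivative_below_top:
  assumes "u \<in> cyl P" "Suc \<alpha> \<le> k"
  shows "frechet_derivative (prol \<tau> (Suc \<alpha>)) (at u) (axis (e \<alpha>) z) =
    second_derivative \<tau> (u $ e 0) z (u $ e 1)"
  using assms(2)
proof (induction \<alpha>)
  have u: "u $ e 0 \<in> P" using assms(1) by (simp add: cyl_def)
  have "((\<lambda>w. frechet_derivative \<tau> (at (w $ e 0)) z) has_derivative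
      (\<lambda>v. second_derivative \<tau> (u $ e 0) z (v $ e 0))) (at u)"
    unfolding second_derivative_def
    by (rule has_derivative_compose[OF bounded_linear_imp_has_derivative[OF bounded_linear_vec_nth]
          smooth_on_has_derivative[OF smooth_on_frechet_derivative[OF smooth_\<tau>] u]])
  from frechet_derivative_eq[OF this]
  have "frechet_derivative (\<lambda>w. frechet_derivative \<tau> (at (w $ e 0)) z) (at u) (shift u) =
      second_derivative \<tau> (u $ e 0) z (u $ e 1)"
    using order_pos by (simp add: shift_block)
  then have *: "second_derivative (prol \<tau> \<alpha>) u (axis (e \<alpha>) z) (shift u) =
      second_derivative \<tau> (u $ e 0) z (u $ e 1)" if "\<alpha> \<le> k" for \<alpha>
    using second_derivative_prol_eq[OF assms(1) prol_derivative_top[OF _ that]] by simp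
  {
    case 0
    then show ?case
      using prol_Suc_derivative[OF assms(1), of 0 "axis (e 0) z"] *[of 0]
        linear_0[OF smooth_on_linear_derivative[OF smooth_prol[of 0] assms(1)]]
      by (simp add: shift_axis del: prol.simps)
  next
    case (Suc \<alpha>)
    have "frechet_derivative (prol \<tau> (Suc \<alpha>)) (at u) (shift (axis (e (Suc \<alpha>)) z)) =
        real (Suc \<alpha>) *\<^sub>R second_derivative \<tau> (u $ e 0) z (u $ e 1)"
      using Suc linear_scale[OF smooth_on_linear_derivative[OF smooth_prol[of "Suc \<alpha>"] assms(1)]]
      by (simp add: shift_axis del: prol.simps)
    then have "real (Suc (Suc \<alpha>)) *\<^sub>R
        frechet_derivative (prol \<tau> (Suc (Suc \<alpha>))) (at u) (axis (e (Suc \<alpha>)) z) =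
        real (Suc (Suc \<alpha>)) *\<^sub>R second_derivative \<tau> (u $ e 0) z (u $ e 1)"
      unfolding prol_Suc_derivative[OF assms(1)] using *[of "Suc \<alpha>"] Suc.prems
      by (simp only: of_nat_Suc[of "Suc \<alpha>"] scaleR_left_distrib scaleR_one)
    then show ?case by (simp del: prol.simps)
  }
qed

lemma smooth_prolongation: "smooth_on (cyl P) (prolongation \<tau>)"
  unfolding prolongation_def[abs_def] by (intro smooth_on_vec open_cyl_P smooth_prol)

lemma prolongation_derivative_block:
  assumes "u \<in> cyl P" "\<alpha> \<le> k"
  shows "frechet_derivative (prolongation \<tau>) (at u) v $ e \<alpha> = frechet_derivative (prol \<tau> \<alpha>) (at u) v"
proof -
  have "((\<lambda>u. prolongation \<tau> u $ e \<alpha>) has_derivative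
      (\<lambda>v. frechet_derivative (prolongation \<tau>) (at u) v $ e \<alpha>)) (at u)"
    by (rule bounded_linear.has_derivative[OF bounded_linear_vec_nth
          smooth_on_has_derivative[OF smooth_prolongation assms(1)]])
  from frechet_derivative_eq[OF this] show ?thesis using assms(2) by (simp del: prol.simps)
qed

lemma prolongation_derivative_top:
  assumes "u \<in> cyl P"
  shows "frechet_derivative (prolongation \<tau>) (at u) (axis (e k) z) =
    axis (e k) (frechet_derivative \<tau> (at (u $ e 0)) z)"
proof (rule block_eqI)
  fix \<alpha> assume "\<alpha> \<le> k"
  then show "frechet_derivative (prolongation \<tau>) (at u) (axis (e k) z) $ e \<alpha> =
      axis (e k) (frechet_derivative \<tau> (at (u $ e 0)) z) $ e \<alpha>"
    using prol_derivative_above[OF assms, of \<alpha> k] prol_derivative_top[OF assms, of k]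
    by (auto simp: prolongation_derivative_block[OF assms])
qed

lemma prolongation_derivative_below_top:
  assumes "u \<in> cyl P"
  shows "frechet_derivative (prolongation \<tau>) (at u) (axis (e (k - 1)) z) =
    axis (e (k - 1)) (frechet_derivative \<tau> (at (u $ e 0)) z) +
    axis (e k) (second_derivative \<tau> (u $ e 0) z (u $ e 1))"
proof (rule block_eqI)
  fix \<alpha> assume \<alpha>: "\<alpha> \<le> k"
  have *: "frechet_derivative (prol \<tau> k) (at u) (axis (e (k - 1)) z) =
      second_derivative \<tau> (u $ e 0) z (u $ e 1)"
    using prol_derivative_below_top[OF assms, of "k - 1"] order_pos by simp
  consider "\<alpha> < k - 1" | "\<alpha> = k - 1" | "\<alpha> = k" using \<alpha> by linarith
  then show "frechet_derivative (prolongation \<tau>) (at u) (axis (e (k - 1)) z) $ e \<alpha> =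
     (axis (e (k - 1)) (frechet_derivative \<tau> (at (u $ e 0)) z) +
      axis (e k) (second_derivative \<tau> (u $ e 0) z (u $ e 1))) $ e \<alpha>"
    by cases (use order_pos * prol_derivative_above[OF assms, of \<alpha> "k - 1"]
        prol_derivative_top[OF assms, of "k - 1"] in
        \<open>auto simp: prolongation_derivative_block[OF assms]\<close>)
qed

lemma prol_derivative_semispray:
  assumes "u \<in> cyl P" "\<alpha> < k" "\<And>\<beta>. \<beta> < k \<Longrightarrow> v $ e \<beta> = real (Suc \<beta>) *\<^sub>R u $ e (Suc \<beta>)"
  shows "frechet_derivative (prol \<tau> \<alpha>) (at u) v = real (Suc \<alpha>) *\<^sub>R prol \<tau> (Suc \<alpha>) u"
proof -
  have "v = shift u + axis (e k) (v $ e k)"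
  proof (rule block_eqI)
    fix \<beta> assume "\<beta> \<le> k"
    then show "v $ e \<beta> = (shift u + axis (e k) (v $ e k)) $ e \<beta>"
      using assms(3) by (cases "\<beta> = k") (auto simp: shift_block)
  qed
  then have "frechet_derivative (prol \<tau> \<alpha>) (at u) v = frechet_derivative (prol \<tau> \<alpha>) (at u) (shift u)"
    using linear_add[OF smooth_on_linear_derivative[OF smooth_prol assms(1)]]
      prol_derivative_above[OF assms(1,2)] by (metis add.right_neutral order_refl)
  then show ?thesis by simp
qed

text \<open>The form of a semispray vector does not depend on the chart.\<close>

lemma prolongation_derivative_semispray:
  assumes "u \<in> cyl P"
  shows "\<exists>w'. frechet_derivative (prolongation \<tau>) (at u) (shift u + axis (e k) w) =
    shift (prolongation \<tau> u) + axis (e k) w'"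
proof -
  let ?v = "shift u + axis (e k) w"
  have "frechet_derivative (prolongation \<tau>) (at u) ?v = shift (prolongation \<tau> u) +
      axis (e k) (frechet_derivative (prol \<tau> k) (at u) ?v)"
  proof (rule block_eqI)
    fix \<alpha> assume \<alpha>: "\<alpha> \<le> k"
    show "frechet_derivative (prolongation \<tau>) (at u) ?v $ e \<alpha> = (shift (prolongation \<tau> u) +
        axis (e k) (frechet_derivative (prol \<tau> k) (at u) ?v)) $ e \<alpha>"
    proof (cases "\<alpha> = k")
      case False
      then have "frechet_derivative (prol \<tau> \<alpha>) (at u) ?v = real (Suc \<alpha>) *\<^sub>R prol \<tau> (Suc \<alpha>) u"
        using \<alpha> by (intro prol_derivative_semispray[OF assms]) (auto simp: shift_block)
      then show ?thesis
        using \<alpha> False by (simp add: prolongation_derivative_block[OF assms] shift_block del: prol.simps)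
    qed (simp add: prolongation_derivative_block[OF assms])
  qed
  then show ?thesis by blast
qed

text \<open>Faa di Bruno's formula in recursive form: along the extension of a curve \<open>\<Gamma>\<close> is the time
  derivative.\<close>

lemma nth_deriv_compose:
  assumes I: "open I" "smooth_on I y" "y ` I \<subseteq> P"
    and u: "\<And>t \<beta>. t \<in> I \<Longrightarrow> \<beta> \<le> k \<Longrightarrow> u t $ e \<beta> = (1 / fact \<beta>) *\<^sub>R nth_deriv \<beta> y t"
    and "t \<in> I" "\<alpha> \<le> k"
  shows "nth_deriv \<alpha> (\<lambda>t. \<tau> (y t)) t = fact \<alpha> *\<^sub>R prol \<tau> \<alpha> (u t)"
  using assms(5,6)
proof (induction \<alpha> arbitrary: t)
  case 0
  then show ?case using u[of t 0] by simp
next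
  case (Suc \<alpha>)
  \<comment> \<open>Only the values of \<open>u\<close> on \<open>I\<close> are given; \<open>U\<close> agrees with it there and is an explicit formula.\<close>
  define U where "U s = (\<chi> b. (1 / fact (inv_into {..k} e b)) *\<^sub>R nth_deriv (inv_into {..k} e b) y s)" for s
  have U_block: "U s $ e \<beta> = (1 / fact \<beta>) *\<^sub>R nth_deriv \<beta> y s" if "\<beta> \<le> k" for s \<beta>
    using that by (simp add: U_def)
  have uU: "u s = U s" if "s \<in> I" for s using u[OF that] U_block by (intro block_eqI) auto
  define v where "v = (\<chi> b. (1 / fact (inv_into {..k} e b)) *\<^sub>R nth_deriv (Suc (inv_into {..k} e b)) y t)"
  have U': "(U has_derivative (\<lambda>h. h *\<^sub>R v)) (at t)"
  proof -
    have "((\<lambda>s. (1 / fact r) *\<^sub>R nth_deriv r y s) has_derivative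
        (\<lambda>h. h *\<^sub>R ((1 / fact r) *\<^sub>R nth_deriv (Suc r) y t))) (at t)" for r
      using has_derivative_scaleR_right[OF nth_deriv_has_vector_derivative[OF I(1,2) Suc.prems(1),
            unfolded has_vector_derivative_def], of "1 / fact r"]
      by (simp add: mult.commute)
    then show ?thesis
      using has_derivative_vec[of "\<lambda>b s. (1 / fact (inv_into {..k} e b)) *\<^sub>R nth_deriv (inv_into {..k} e b) y s"]
      unfolding U_def[abs_def] v_def scaleR_vec_def by simp
  qed
  have Ut: "U t \<in> cyl P" using U_block[of 0 t] I(3) Suc.prems by (auto simp: cyl_def)
  have v: "v $ e \<beta> = real (Suc \<beta>) *\<^sub>R U t $ e (Suc \<beta>)" if "\<beta> < k" for \<beta>
    using that by (simp add: v_def U_block)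
  have "((\<lambda>s. prol \<tau> \<alpha> (U s)) has_derivative
      (\<lambda>h. frechet_derivative (prol \<tau> \<alpha>) (at (U t)) (h *\<^sub>R v))) (at t)"
    by (rule has_derivative_compose[OF U' smooth_on_has_derivative[OF smooth_prol Ut]])
  moreover have "frechet_derivative (prol \<tau> \<alpha>) (at (U t)) (h *\<^sub>R v) =
      h *\<^sub>R (real (Suc \<alpha>) *\<^sub>R prol \<tau> (Suc \<alpha>) (U t))" for h
    using prol_derivative_semispray[OF Ut _ v, of \<alpha>] Suc.prems
      linear_scale[OF smooth_on_linear_derivative[OF smooth_prol Ut]] by (simp del: prol.simps)
  ultimately have "((\<lambda>s. prol \<tau> \<alpha> (U s)) has_vector_derivative
      real (Suc \<alpha>) *\<^sub>R prol \<tau> (Suc \<alpha>) (U t)) (at t)"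
    unfolding has_vector_derivative_def by (simp only:)
  then have "((\<lambda>s. fact \<alpha> *\<^sub>R prol \<tau> \<alpha> (U s)) has_vector_derivative
      fact \<alpha> *\<^sub>R (real (Suc \<alpha>) *\<^sub>R prol \<tau> (Suc \<alpha>) (U t))) (at t)"
    by (rule bounded_linear.has_vector_derivative[OF bounded_linear_scaleR_right])
  then have "vector_derivative (\<lambda>s. fact \<alpha> *\<^sub>R prol \<tau> \<alpha> (U s)) (at t) =
      fact (Suc \<alpha>) *\<^sub>R prol \<tau> (Suc \<alpha>) (U t)"
    by (subst vector_derivative_at, assumption) (simp add: mult.commute del: prol.simps)
  moreover have "vector_derivative (\<lambda>s. fact \<alpha> *\<^sub>R prol \<tau> \<alpha> (U s)) (at t) =
      vector_derivative (nth_deriv \<alpha> (\<lambda>t. \<tau> (y t))) (at t)"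
    by (rule vector_derivative_cong_open[OF I(1) Suc.prems(1)]) (use Suc uU in auto)
  ultimately show ?case using uU[OF Suc.prems(1)] by (simp add: nth_deriv_Suc del: prol.simps)
qed

text \<open>Two terms with second derivatives of \<open>\<tau>\<close> arise: one from differentiating \<open>\<partial>L/\<partial>y\<^sup>(\<^sup>k\<^sup>)\<close> in time, since
  \<open>D\<tau>\<close> depends on the base point, and one from \<open>\<partial>L/\<partial>y\<^sup>(\<^sup>k\<^sup>-\<^sup>1\<^sup>)\<close>, since block \<open>k\<close> of the prolongation depends
  on \<open>y\<^sup>(\<^sup>k\<^sup>-\<^sup>1\<^sup>)\<close>. They are equal and cancel, because the velocity of the base point is \<open>y\<^sup>(\<^sup>1\<^sup>)\<close>.\<close>

lemma Lagrange_expression_transform: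
  fixes L L' :: "real ^ 'n ^ 'j \<Rightarrow> real"
  assumes u: "u \<in> cyl P" and O: "open O'" "prolongation \<tau> u \<in> O'" "smooth_on O' L'"
    and O2: "open O2" "u \<in> O2" "\<And>v. v \<in> O2 \<Longrightarrow> L v = L' (prolongation \<tau> v)"
    and \<xi>: "\<xi> = shift u + axis (e k) w"
  shows "second_derivative L u (axis (e k) z) \<xi> - frechet_derivative L (at u) (axis (e (k - 1)) z) =
    second_derivative L' (prolongation \<tau> u) (axis (e k) (frechet_derivative \<tau> (at (u $ e 0)) z))
        (frechet_derivative (prolongation \<tau>) (at u) \<xi>)
      - frechet_derivative L' (at (prolongation \<tau> u))
          (axis (e (k - 1)) (frechet_derivative \<tau> (at (u $ e 0)) z))"
proof -
  let ?T = "prolongation \<tau>"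
  \<comment> \<open>A neighbourhood of \<open>u\<close> on which \<open>L = L' \<circ> T\<close> can be differentiated by the chain rule.\<close>
  define Q where "Q = cyl P \<inter> O2 \<inter> ?T -` O'"
  have Q: "open Q" "u \<in> Q"
  proof -
    have "open (cyl P \<inter> ?T -` O')"
      using smooth_on_continuous_on[OF smooth_prolongation] open_cyl_P O(1)
      by (simp add: continuous_on_open_vimage Int_commute)
    moreover have "Q = (cyl P \<inter> ?T -` O') \<inter> O2" by (auto simp: Q_def)
    ultimately show "open Q" using O2(1) by auto
    show "u \<in> Q" using u O O2 by (simp add: Q_def)
  qed
  have DT: "(?T has_derivative frechet_derivative ?T (at v)) (at v)" if "v \<in> cyl P" for v
    by (rule smooth_on_has_derivative[OF smooth_prolongation that])
  have DL: "frechet_derivative L (at v) x =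
      frechet_derivative L' (at (?T v)) (frechet_derivative ?T (at v) x)" if "v \<in> Q" for v x
  proof -
    have v: "v \<in> cyl P" "?T v \<in> O'" using that by (auto simp: Q_def)
    have "((\<lambda>v. L' (?T v)) has_derivative
        (\<lambda>x. frechet_derivative L' (at (?T v)) (frechet_derivative ?T (at v) x))) (at v)"
      by (rule has_derivative_compose[OF DT[OF v(1)] smooth_on_has_derivative[OF O(3) v(2)]])
    from frechet_derivative_eq[OF this] have
      "frechet_derivative (\<lambda>v. L' (?T v)) (at v) x =
        frechet_derivative L' (at (?T v)) (frechet_derivative ?T (at v) x)" by simp
    moreover have "frechet_derivative L (at v) = frechet_derivative (\<lambda>v. L' (?T v)) (at v)"
      by (rule frechet_derivative_cong_open[OF Q(1) that]) (simp add: Q_def O2(3))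
    ultimately show ?thesis by simp
  qed
  let ?z = "\<lambda>v. frechet_derivative \<tau> (at (v $ e 0)) z"
  have "((\<lambda>v. ?z v) has_derivative (\<lambda>v. second_derivative \<tau> (u $ e 0) z (v $ e 0))) (at u)"
    unfolding second_derivative_def
    by (rule has_derivative_compose[OF bounded_linear_imp_has_derivative[OF bounded_linear_vec_nth]
          smooth_on_has_derivative[OF smooth_on_frechet_derivative[OF smooth_\<tau>]]])
      (use u in \<open>simp add: cyl_def\<close>)
  then have "((\<lambda>v. axis (e k) (?z v) :: real ^ 'n ^ 'j) has_derivative
      (\<lambda>v. axis (e k) (second_derivative \<tau> (u $ e 0) z (v $ e 0)))) (at u)"
    by (rule bounded_linear.has_derivative[OF bounded_linear_axis])
  note has_derivative_directional_derivative[OF O(1,3) DT[OF u] this O(2)]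
  then have "frechet_derivative (\<lambda>v. frechet_derivative L' (at (?T v)) (axis (e k) (?z v))) (at u) \<xi> =
      second_derivative L' (?T u) (axis (e k) (?z u)) (frechet_derivative ?T (at u) \<xi>)
      + frechet_derivative L' (at (?T u)) (axis (e k) (second_derivative \<tau> (u $ e 0) z (\<xi> $ e 0)))"
    unfolding second_derivative_def by (subst frechet_derivative_eq, assumption) simp
  moreover have "second_derivative L u (axis (e k) z) \<xi> =
      frechet_derivative (\<lambda>v. frechet_derivative L' (at (?T v)) (axis (e k) (?z v))) (at u) \<xi>"
    unfolding second_derivative_def
    by (subst frechet_derivative_cong_open[OF Q,
          where g = "\<lambda>v. frechet_derivative L' (at (?T v)) (axis (e k) (?z v))"])
      (auto simp: DL prolongation_derivative_top Q_def)
  moreover have "\<xi> $ e 0 = u $ e 1" using order_pos by (simp add: \<xi> shift_block)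
  moreover have "frechet_derivative L (at u) (axis (e (k - 1)) z) =
      frechet_derivative L' (at (?T u)) (axis (e (k - 1)) (?z u)) +
      frechet_derivative L' (at (?T u)) (axis (e k) (second_derivative \<tau> (u $ e 0) z (u $ e 1)))"
    using linear_add[OF smooth_on_linear_derivative[OF O(3,2)]]
    by (simp only: DL[OF Q(2)] prolongation_derivative_below_top[OF u])
  ultimately show ?thesis by simp
qed

end

section \<open>Coordinates on the bundle of accelerations\<close>

locale jet_coordinates = block_numbering k e for k and e :: "nat \<Rightarrow> 'j::finite" +
  fixes A :: "('m::{t2_space,second_countable_topology}, 'n::finite) chart set"
  assumes manifold: "smooth_manifold A"
begin

lemma chart_open: "c \<in> A \<Longrightarrow> open (fst c)"
  and chart_image_open: "c \<in> A \<Longrightarrow> open (snd c ` fst c)"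
  and chart_homeomorphism: "c \<in> A \<Longrightarrow> \<exists>\<psi>. homeomorphism (fst c) (snd c ` fst c) (snd c) \<psi>"
  using manifold unfolding smooth_manifold_def by (auto simp: case_prod_beta)

lemma chart_ex: "\<exists>c\<in>A. a \<in> fst c"
proof -
  have "a \<in> (\<Union>(U, \<phi>)\<in>A. U)" using manifold by (simp add: smooth_manifold_def)
  then show ?thesis by force
qed

lemma chart_inj: assumes "c \<in> A" shows "inj_on (snd c) (fst c)"
proof -
  obtain \<psi> where "homeomorphism (fst c) (snd c ` fst c) (snd c) \<psi>" using chart_homeomorphism[OF assms] by blast
  then show ?thesis unfolding homeomorphism_def by (metis inj_on_inverseI)
qed

lemma chart_inverse_continuous:
  assumes "c \<in> A" shows "continuous_on (snd c ` fst c) (inv_into (fst c) (snd c))"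
proof -
  obtain \<psi> where h: "homeomorphism (fst c) (snd c ` fst c) (snd c) \<psi>"
    using chart_homeomorphism[OF assms] by blast
  have "continuous_on (snd c ` fst c) \<psi>" using h by (simp add: homeomorphism_def)
  moreover have "\<psi> x = inv_into (fst c) (snd c) x" if "x \<in> snd c ` fst c" for x
    using h that chart_inj[OF assms] by (auto simp: homeomorphism_def)
  ultimately show ?thesis using continuous_on_cong by (metis (no_types, lifting))
qed

lemma chart_image_subset_open:
  assumes "c \<in> A" "open V" shows "open (snd c ` (fst c \<inter> V))"
proof -
  have "open ((inv_into (fst c) (snd c)) -` V \<inter> (snd c ` fst c))"
    using chart_inverse_continuous[OF assms(1)] chart_image_open[OF assms(1)] assms(2)
    by (simp add: continuous_on_open_vimage)
  moreover have "(inv_into (fst c) (snd c)) -` V \<inter> (snd c ` fst c) = snd c ` (fst c \<inter> V)"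
    using chart_inj[OF assms(1)] by (auto simp: inv_into_f_f)
  ultimately show ?thesis by simp
qed

definition overlap where "overlap c d = snd c ` (fst c \<inter> fst d)"
  for c d :: "('m, 'n) chart"

definition transition where "transition c d = snd d \<circ> inv_into (fst c) (snd c)"
  for c d :: "('m, 'n) chart"

lemma coordinate_change: "c \<in> A \<Longrightarrow> d \<in> A \<Longrightarrow> coordinate_change k e (overlap c d) (transition c d)"
proof unfold_locales
  assume "c \<in> A" "d \<in> A"
  then show "open (overlap c d)"
    unfolding overlap_def using chart_image_subset_open chart_open by blast
  show "smooth_on (overlap c d) (transition c d)"
    using manifold \<open>c \<in> A\<close> \<open>d \<in> A\<close>
    by (auto simp: smooth_manifold_def overlap_def transition_def case_prod_beta)
qed

lemma transition_chart: "c \<in> A \<Longrightarrow> a \<in> fst c \<Longrightarrow> transition c d (snd c a) = snd d a"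
  using chart_inj by (simp add: transition_def)

definition curve_coord :: "('m, 'n) chart \<Rightarrow> (real \<Rightarrow> 'm) \<Rightarrow> real ^ 'n ^ 'j" where
  "curve_coord c x = (\<chi> b. let \<alpha> = inv_into {..k} e b in (1 / fact \<alpha>) *\<^sub>R nth_deriv \<alpha> (snd c \<circ> x) 0)"

lemma curve_coord_block:
  "\<alpha> \<le> k \<Longrightarrow> curve_coord c x $ e \<alpha> = (1 / fact \<alpha>) *\<^sub>R nth_deriv \<alpha> (snd c \<circ> x) 0"
  by (simp add: curve_coord_def)

lemma curve_coord_eq_iff:
  "curve_coord c x = curve_coord c z \<longleftrightarrow>
    (\<forall>\<alpha>\<le>k. nth_deriv \<alpha> (snd c \<circ> x) 0 = nth_deriv \<alpha> (snd c \<circ> z) 0)"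
proof
  assume *: "curve_coord c x = curve_coord c z"
  show "\<forall>\<alpha>\<le>k. nth_deriv \<alpha> (snd c \<circ> x) 0 = nth_deriv \<alpha> (snd c \<circ> z) 0"
  proof (intro allI impI)
    fix \<alpha> assume "\<alpha> \<le> k"
    with * have "curve_coord c x $ e \<alpha> = curve_coord c z $ e \<alpha>" "\<alpha> \<le> k" by auto
    then show "nth_deriv \<alpha> (snd c \<circ> x) 0 = nth_deriv \<alpha> (snd c \<circ> z) 0"
      by (simp add: curve_coord_block)
  qed
qed (auto intro!: block_eqI simp: curve_coord_block)

lemma smooth_curve_chart_open:
  assumes "smooth_curve A I x" "open I" "c \<in> A" shows "open (I \<inter> x -` fst c)"
  using assms chart_open[OF assms(3)] unfolding smooth_curve_def
  by (metis continuous_on_open_vimage Int_commute)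

lemma smooth_curve_chart:
  "smooth_curve A I x \<Longrightarrow> c \<in> A \<Longrightarrow> smooth_on (I \<inter> x -` fst c) (snd c \<circ> x)"
  by (auto simp: smooth_curve_def case_prod_beta)

lemma curve_coord_transform:
  assumes "smooth_near_0 A x" "c \<in> A" "d \<in> A" "x 0 \<in> fst c" "x 0 \<in> fst d"
  shows "curve_coord d x = prolongation (transition c d) (curve_coord c x)"
proof -
  interpret coordinate_change k e "overlap c d" "transition c d"
    by (rule coordinate_change[OF assms(2,3)])
  obtain I where I: "open I" "0 \<in> I" "smooth_curve A I x"
    using assms(1) by (auto simp: smooth_near_0_def)
  define J where "J = (I \<inter> x -` fst c) \<inter> (I \<inter> x -` fst d)"
  have J: "open J" "0 \<in> J"
    unfolding J_def using smooth_curve_chart_open[OF I(3,1)] assms(2-5) I(2)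
    by (blast intro: open_Int)+
  have y: "smooth_on J (snd c \<circ> x)"
    by (rule smooth_on_subset[OF smooth_curve_chart[OF I(3) assms(2)]]) (auto simp: J_def)
  have im: "(snd c \<circ> x) ` J \<subseteq> overlap c d" by (auto simp: J_def overlap_def)
  define u :: "real \<Rightarrow> real ^ 'n ^ 'j" where "u t =
    (\<chi> b. let \<alpha> = inv_into {..k} e b in (1 / fact \<alpha>) *\<^sub>R nth_deriv \<alpha> (snd c \<circ> x) t)" for t
  have u0: "u 0 = curve_coord c x" by (simp add: u_def curve_coord_def)
  show ?thesis
  proof (rule block_eqI)
    fix \<alpha> assume \<alpha>: "\<alpha> \<le> k"
    have "nth_deriv \<alpha> (\<lambda>t. transition c d ((snd c \<circ> x) t)) 0 = fact \<alpha> *\<^sub>R prol (transition c d) \<alpha> (u 0)"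
      by (rule nth_deriv_compose[OF J(1) y im _ J(2) \<alpha>]) (simp add: u_def)
    moreover have "nth_deriv \<alpha> (\<lambda>t. transition c d ((snd c \<circ> x) t)) 0 = nth_deriv \<alpha> (snd d \<circ> x) 0"
      by (rule nth_deriv_cong_open[OF J]) (auto simp: J_def transition_chart[OF assms(2)])
    ultimately have "nth_deriv \<alpha> (snd d \<circ> x) 0 =
        fact \<alpha> *\<^sub>R prol (transition c d) \<alpha> (curve_coord c x)"
      by (simp only: u0)
    then show "curve_coord d x $ e \<alpha> = prolongation (transition c d) (curve_coord c x) $ e \<alpha>"
      using \<alpha> by (simp add: curve_coord_block)
  qed
qed

lemma jet_memI: "smooth_near_0 A x \<Longrightarrow> x \<in> jet A k x"
  by (auto simp: jet_def)

lemma jet_eq_of_mem: "z \<in> jet A k x \<Longrightarrow> jet A k z = jet A k x"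
  by (auto simp: jet_def case_prod_beta)

lemma jet_in_bundle: "smooth_near_0 A x \<Longrightarrow> jet A k x \<in> jet_bundle A k"
  by (auto simp: jet_bundle_def)

lemma jet_rep_mem: "smooth_near_0 A x \<Longrightarrow> jet_rep (jet A k x) \<in> jet A k x"
  unfolding jet_rep_def by (rule someI[where P = "\<lambda>z. z \<in> jet A k x", OF jet_memI])

lemma jet_rep_jet:
  assumes "smooth_near_0 A x"
  shows "smooth_near_0 A (jet_rep (jet A k x))" "jet_rep (jet A k x) 0 = x 0"
  using jet_rep_mem[OF assms] by (auto simp: jet_def)

lemma jet_bundle_rep:
  assumes "p \<in> jet_bundle A k"
  shows "smooth_near_0 A (jet_rep p)" "jet A k (jet_rep p) = p"
  using assms jet_rep_jet(1) jet_eq_of_mem[OF jet_rep_mem] by (auto simp: jet_bundle_def)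

lemma jet_coord_rep: "jet_coord k e c p = curve_coord c (jet_rep p)" for c :: "('m, 'n) chart"
  by (simp add: jet_coord_def curve_coord_def)

lemma jet_coord_jet:
  assumes "smooth_near_0 A x" "c \<in> A" "x 0 \<in> fst c"
  shows "jet_coord k e c (jet A k x) = curve_coord c x"
  using jet_rep_mem[OF assms(1)] assms(2,3)
  by (auto simp: jet_coord_rep curve_coord_eq_iff jet_def case_prod_beta)

lemma jet_dom_jet:
  assumes "smooth_near_0 A x" shows "jet A k x \<in> jet_dom A k c \<longleftrightarrow> x 0 \<in> fst c"
  using assms jet_rep_jet(2) jet_in_bundle by (auto simp: jet_dom_def)

text \<open>Contact of order \<open>k\<close> in one chart implies it in all charts, since the prolongation of the coordinate
  change computes one set of coordinates from the other.\<close>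

lemma jet_eqI:
  assumes "smooth_near_0 A x" "smooth_near_0 A z" "c \<in> A" "x 0 \<in> fst c" "z 0 \<in> fst c"
    and "curve_coord c x = curve_coord c z"
  shows "jet A k x = jet A k z"
proof -
  have "(snd c \<circ> x) 0 = (snd c \<circ> z) 0" using assms(6) unfolding curve_coord_eq_iff by (metis le0 nth_deriv_0)
  then have 0: "x 0 = z 0" using chart_inj[OF assms(3)] assms(4,5) by (auto dest: inj_onD)
  have "curve_coord d x = curve_coord d z" if "d \<in> A" "x 0 \<in> fst d" for d
    unfolding curve_coord_transform[OF assms(1,3) that(1) assms(4) that(2)]
      curve_coord_transform[OF assms(2,3) that(1) assms(5) that(2)[unfolded 0]] assms(6) ..
  then have "x \<in> jet A k z"
    using assms(1) 0 by (auto simp: jet_def curve_coord_eq_iff)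
  then show ?thesis by (rule jet_eq_of_mem)
qed

lemma jet_domD: "p \<in> jet_dom A k c \<Longrightarrow> p \<in> jet_bundle A k" "p \<in> jet_dom A k c \<Longrightarrow> jet_rep p 0 \<in> fst c"
  by (auto simp: jet_dom_def)

lemma jet_dom_ex: "p \<in> jet_bundle A k \<Longrightarrow> \<exists>c\<in>A. p \<in> jet_dom A k c"
  using chart_ex[of "jet_rep p 0"] by (auto simp: jet_dom_def)

lemma inj_on_jet_coord: assumes "c \<in> A" shows "inj_on (jet_coord k e c) (jet_dom A k c)"
proof (rule inj_onI)
  fix p q assume p: "p \<in> jet_dom A k c" and q: "q \<in> jet_dom A k c"
    and eq: "jet_coord k e c p = jet_coord k e c q"
  show "p = q"
    using jet_eqI[OF jet_bundle_rep(1)[OF jet_domD(1)[OF p]] jet_bundle_rep(1)[OF jet_domD(1)[OF q]] assms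
        jet_domD(2)[OF p] jet_domD(2)[OF q]] eq
      jet_bundle_rep(2)[OF jet_domD(1)[OF p]] jet_bundle_rep(2)[OF jet_domD(1)[OF q]]
    by (simp add: jet_coord_rep)
qed

lemma jet_coord_base: "jet_coord k e c p $ e 0 = snd c (jet_rep p 0)" for c :: "('m, 'n) chart"
  by (simp add: jet_coord_rep curve_coord_block)

lemma smooth_curve_from_chart:
  assumes c: "c \<in> A" and I: "open I" "smooth_on I y" "y ` I \<subseteq> snd c ` fst c"
    and x: "\<And>t. t \<in> I \<Longrightarrow> x t = inv_into (fst c) (snd c) (y t)"
  shows "smooth_curve A I x"
proof -
  have cont: "continuous_on I x"
    using continuous_on_compose2[OF chart_inverse_continuous[OF c] smooth_on_continuous_on[OF I(2)] I(3)] x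
      continuous_on_cong by (metis (no_types, lifting))
  have "smooth_on (I \<inter> x -` fst d) (snd d \<circ> x)" if d: "d \<in> A" for d
  proof -
    interpret coordinate_change k e "overlap c d" "transition c d"
      by (rule coordinate_change[OF c d])
    have op: "open (I \<inter> x -` fst d)"
      using cont I(1) chart_open[OF d] by (metis continuous_on_open_vimage Int_commute)
    have "y ` (I \<inter> x -` fst d) \<subseteq> overlap c d"
    proof
      fix v assume "v \<in> y ` (I \<inter> x -` fst d)"
      then obtain t where t: "t \<in> I" "x t \<in> fst d" "v = y t" by auto
      then have "y t \<in> snd c ` fst c" using I(3) by auto
      then have "snd c (x t) = y t" "x t \<in> fst c" using x[OF t(1)] by (auto simp: f_inv_into_f inv_into_into)
      then show "v \<in> overlap c d" using t unfolding overlap_def by (metis IntI imageI)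
    qed
    then have "smooth_on (I \<inter> x -` fst d) (\<lambda>t. transition c d (y t))"
      by (rule smooth_on_compose[OF op _ smooth_on_subset[OF I(2)] smooth_\<tau>]) auto
    then show ?thesis
      by (rule smooth_on_cong[OF op]) (auto simp: transition_def x)
  qed
  then show ?thesis using cont by (auto simp: smooth_curve_def)
qed

text \<open>A vector of coordinates is realized by the curve that is polynomial in the chart with these
  coefficients.\<close>

lemma jet_coord_image:
  assumes c: "c \<in> A" shows "jet_coord k e c ` jet_dom A k c = cyl (snd c ` fst c)"
proof
  show "jet_coord k e c ` jet_dom A k c \<subseteq> cyl (snd c ` fst c)"
    by (auto simp: cyl_def jet_coord_base jet_dom_def)
  show "cyl (snd c ` fst c) \<subseteq> jet_coord k e c ` jet_dom A k c"
  proof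
    fix u :: "real ^ 'n ^ 'j" assume u: "u \<in> cyl (snd c ` fst c)"
    define y where "y t = (\<Sum>\<beta>\<le>k. t ^ \<beta> *\<^sub>R u $ e \<beta>)" for t :: real
    define x where "x = inv_into (fst c) (snd c) \<circ> y"
    define I where "I = y -` (snd c ` fst c)"
    have y: "smooth_on UNIV y" unfolding y_def[abs_def] by (rule smooth_on_polynomial_curve)
    have y0: "y 0 = u $ e 0"
      using nth_deriv_polynomial_curve[of 0 k "\<lambda>\<beta>. u $ e \<beta>"] by (simp add: y_def)
    have I: "open I" unfolding I_def
      by (rule open_vimage[OF chart_image_open[OF c] smooth_on_continuous_on[OF y]])
    have 0: "0 \<in> I" using u by (simp add: I_def cyl_def y0)
    have "smooth_curve A I x"
      by (rule smooth_curve_from_chart[OF c I smooth_on_subset[OF y]]) (auto simp: I_def x_def)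
    then have x: "smooth_near_0 A x" using I 0 by (auto simp: smooth_near_0_def)
    have x0: "x 0 \<in> fst c" using 0 by (auto simp: x_def I_def inv_into_into)
    have "curve_coord c x = u"
    proof (rule block_eqI)
      fix \<alpha> assume \<alpha>: "\<alpha> \<le> k"
      have "nth_deriv \<alpha> (snd c \<circ> x) 0 = nth_deriv \<alpha> y 0"
        by (rule nth_deriv_cong_open[OF I 0]) (auto simp: I_def x_def f_inv_into_f)
      also have "\<dots> = fact \<alpha> *\<^sub>R u $ e \<alpha>"
        unfolding y_def[abs_def] by (rule nth_deriv_polynomial_curve[OF \<alpha>])
      finally show "curve_coord c x $ e \<alpha> = u $ e \<alpha>" using \<alpha> by (simp add: curve_coord_block)
    qed
    then show "u \<in> jet_coord k e c ` jet_dom A k c"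
      using jet_coord_jet[OF x c x0] jet_dom_jet[OF x, of c] x0 by (metis imageI)
  qed
qed

lemma jet_coord_overlap:
  assumes "c \<in> A" "p \<in> jet_dom A k c" "p \<in> jet_dom A k d"
  shows "jet_coord k e c p \<in> cyl (overlap c d)"
  using assms by (auto simp: cyl_def jet_coord_base overlap_def jet_dom_def)

lemma jet_coord_overlapD:
  assumes "c \<in> A" "u \<in> cyl (overlap c d)"
  obtains p where "p \<in> jet_dom A k c" "p \<in> jet_dom A k d" "u = jet_coord k e c p"
proof -
  have "u \<in> cyl (snd c ` fst c)" using assms(2) by (auto simp: cyl_def overlap_def)
  then obtain p where p: "p \<in> jet_dom A k c" "u = jet_coord k e c p"
    using jet_coord_image[OF assms(1)] by blast
  then have "snd c (jet_rep p 0) \<in> snd c ` (fst c \<inter> fst d)"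
    using assms(2) by (simp add: cyl_def jet_coord_base overlap_def)
  then have "jet_rep p 0 \<in> fst d" using chart_inj[OF assms(1)] p(1) by (auto simp: jet_dom_def dest: inj_onD)
  then show ?thesis using p that by (auto simp: jet_dom_def)
qed

lemma jet_coord_transform:
  assumes "c \<in> A" "d \<in> A" "p \<in> jet_dom A k c" "p \<in> jet_dom A k d"
  shows "jet_coord k e d p = prolongation (transition c d) (jet_coord k e c p)"
  unfolding jet_coord_rep
  by (rule curve_coord_transform[OF jet_bundle_rep(1)[OF jet_domD(1)[OF assms(3)]] assms(1,2)
        jet_domD(2)[OF assms(3)] jet_domD(2)[OF assms(4)]])

lemma local_rep_jet_coord:
  "c \<in> A \<Longrightarrow> p \<in> jet_dom A k c \<Longrightarrow> local_rep k e A c f (jet_coord k e c p) = f p"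
  using inj_on_jet_coord by (simp add: local_rep_def)

lemma local_rep_transform:
  assumes "c \<in> A" "d \<in> A" "u \<in> cyl (overlap c d)"
  shows "local_rep k e A c f u = local_rep k e A d f (prolongation (transition c d) u)"
proof -
  obtain p where p: "p \<in> jet_dom A k c" "p \<in> jet_dom A k d" "u = jet_coord k e c p"
    using jet_coord_overlapD[OF assms(1,3)] .
  then show ?thesis
    using local_rep_jet_coord assms jet_coord_transform[OF assms(1,2) p(1,2)] by metis
qed

lemma openin_jet_dom_coord: "c \<in> A \<Longrightarrow> open W \<Longrightarrow>
    openin (jet_topology k e A) (jet_dom A k c \<inter> jet_coord k e c -` W)"
  unfolding jet_topology_def by (rule topology_generated_by_Basis) blast

lemma openin_jet_dom: "c \<in> A \<Longrightarrow> openin (jet_topology k e A) (jet_dom A k c)"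
  using openin_jet_dom_coord[of c UNIV] by simp

text \<open>The coordinates of every chart are open maps for the jet topology: on a generating set that comes from
  another chart this is continuity of the prolonged coordinate change.\<close>

lemma open_jet_coord_image:
  assumes c: "c \<in> A" and "openin (jet_topology k e A) W"
  shows "open (jet_coord k e c ` (W \<inter> jet_dom A k c))"
proof -
  let ?S = "{jet_dom A k c \<inter> jet_coord k e c -` W | c W. c \<in> A \<and> open W}"
  have "generate_topology_on ?S W"
    using assms(2) unfolding jet_topology_def openin_topology_generated_by_iff .
  then show ?thesis
  proof induction
    case (Int a b)
    have "jet_coord k e c ` (a \<inter> b \<inter> jet_dom A k c) =
        jet_coord k e c ` (a \<inter> jet_dom A k c) \<inter> jet_coord k e c ` (b \<inter> jet_dom A k c)"
      using inj_on_image_Int[OF inj_on_jet_coord[OF c], of "a \<inter> jet_dom A k c" "b \<inter> jet_dom A k c"]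
      by (simp add: Int_ac)
    then show ?case using Int by (simp add: open_Int)
  next
    case (UN K)
    have "jet_coord k e c ` (\<Union> K \<inter> jet_dom A k c) = (\<Union>a\<in>K. jet_coord k e c ` (a \<inter> jet_dom A k c))"
      by auto
    then show ?case using UN by auto
  next
    case (Basis s)
    then obtain d V where d: "d \<in> A" "open V" "s = jet_dom A k d \<inter> jet_coord k e d -` V" by auto
    interpret coordinate_change k e "overlap c d" "transition c d"
      by (rule coordinate_change[OF c d(1)])
    have "jet_coord k e c ` (s \<inter> jet_dom A k c) =
        prolongation (transition c d) -` V \<inter> cyl (overlap c d)"
    proof
      show "jet_coord k e c ` (s \<inter> jet_dom A k c) \<subseteq> prolongation (transition c d) -` V \<inter> cyl (overlap c d)"
        using jet_coord_transform[OF c d(1)] jet_coord_overlap[OF c, of _ d] d(3) by auto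
      show "prolongation (transition c d) -` V \<inter> cyl (overlap c d) \<subseteq> jet_coord k e c ` (s \<inter> jet_dom A k c)"
      proof
        fix u assume u: "u \<in> prolongation (transition c d) -` V \<inter> cyl (overlap c d)"
        then obtain p where "p \<in> jet_dom A k c" "p \<in> jet_dom A k d" "u = jet_coord k e c p"
          using jet_coord_overlapD[OF c] by blast
        then show "u \<in> jet_coord k e c ` (s \<inter> jet_dom A k c)"
          using u jet_coord_transform[OF c d(1)] d(3) by auto
      qed
    qed
    then show ?case
      using smooth_on_continuous_on[OF smooth_prolongation] open_cyl_P d(2)
      by (simp add: continuous_on_open_vimage)
  qed simp
qed

text \<open>Smoothness of a function is required in all charts, but prolonged coordinate changes are smooth, so one
  chart around its domain suffices.\<close>

lemma smooth_fun_from_chart: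
  assumes c: "c \<in> A" and W: "openin (jet_topology k e A) W" "W \<subseteq> jet_dom A k c"
    and f: "smooth_on (jet_coord k e c ` W) (local_rep k e A c f)"
  shows "smooth_fun k e A W f"
  unfolding smooth_fun_def
proof
  fix d assume d: "d \<in> A"
  interpret coordinate_change k e "overlap d c" "transition d c"
    by (rule coordinate_change[OF d c])
  have op: "open (jet_coord k e d ` (W \<inter> jet_dom A k d))" by (rule open_jet_coord_image[OF d W(1)])
  have sub: "jet_coord k e d ` (W \<inter> jet_dom A k d) \<subseteq> cyl (overlap d c)"
    using jet_coord_overlap[OF d, of _ c] W(2) by auto
  have "prolongation (transition d c) ` jet_coord k e d ` (W \<inter> jet_dom A k d) \<subseteq> jet_coord k e c ` W"
    using jet_coord_transform[OF d c] W(2) by (auto simp: image_iff) (metis subsetD)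
  then have "smooth_on (jet_coord k e d ` (W \<inter> jet_dom A k d))
      (\<lambda>u. local_rep k e A c f (prolongation (transition d c) u))"
    by (rule smooth_on_compose[OF op _ smooth_on_subset[OF smooth_prolongation sub] f])
  then show "smooth_on (jet_coord k e d ` (W \<inter> jet_dom A k d)) (local_rep k e A d f)"
    by (rule smooth_on_cong[OF op]) (use sub local_rep_transform[OF d c] in auto)
qed

definition slit_coord :: "('m, 'n) chart \<Rightarrow> (real ^ 'n ^ 'j) set" where
  "slit_coord c = {u \<in> cyl (snd c ` fst c). \<exists>\<beta>\<in>{1..k}. u $ e \<beta> \<noteq> 0}"

lemma open_slit_coord: assumes "c \<in> A" shows "open (slit_coord c)"
proof -
  have "open {u :: real ^ 'n ^ 'j. u $ e \<beta> \<noteq> 0}" for \<beta>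
    by (intro open_Collect_neq continuous_on_component) (auto intro: continuous_intros)
  moreover have "slit_coord c = cyl (snd c ` fst c) \<inter> (\<Union>\<beta>\<in>{1..k}. {u. u $ e \<beta> \<noteq> 0})"
    by (auto simp: slit_coord_def)
  ultimately show ?thesis using open_cyl[OF chart_image_open[OF assms]] by (auto intro!: open_Int open_UN)
qed

lemma smooth_near_0_const: "smooth_near_0 A (\<lambda>t. a)"
proof -
  have "smooth_curve A UNIV (\<lambda>t. a)"
    by (auto simp: smooth_curve_def o_def intro: smooth_on_const)
  then show ?thesis unfolding smooth_near_0_def by blast
qed

lemma curve_coord_const: "1 \<le> \<beta> \<Longrightarrow> \<beta> \<le> k \<Longrightarrow> curve_coord c (\<lambda>t. a) $ e \<beta> = 0"
  by (cases \<beta>) (auto simp: curve_coord_block o_def nth_deriv_const)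

text \<open>The null section is the zero set of the higher blocks. So the slit bundle is open, which gives derivatives
  on it their meaning.\<close>

lemma slit_bundle_iff:
  assumes c: "c \<in> A" and p: "p \<in> jet_dom A k c"
  shows "p \<in> slit_bundle A k \<longleftrightarrow> jet_coord k e c p \<in> slit_coord c"
proof -
  have "p \<in> null_section A k \<longleftrightarrow> (\<forall>\<beta>\<in>{1..k}. jet_coord k e c p $ e \<beta> = 0)"
  proof
    assume "p \<in> null_section A k"
    then obtain a where a: "p = jet A k (\<lambda>t. a)" by (auto simp: null_section_def)
    then have "a \<in> fst c" using p jet_dom_jet[OF smooth_near_0_const] by simp
    then have "jet_coord k e c p = curve_coord c (\<lambda>t. a)"
      unfolding a by (intro jet_coord_jet smooth_near_0_const c)
    then show "\<forall>\<beta>\<in>{1..k}. jet_coord k e c p $ e \<beta> = 0" using curve_coord_const by simp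
  next
    assume *: "\<forall>\<beta>\<in>{1..k}. jet_coord k e c p $ e \<beta> = 0"
    let ?a = "jet_rep p 0"
    have "curve_coord c (jet_rep p) = curve_coord c (\<lambda>t. ?a)"
    proof (rule block_eqI)
      fix \<alpha> assume "\<alpha> \<le> k"
      then show "curve_coord c (jet_rep p) $ e \<alpha> = curve_coord c (\<lambda>t. ?a) $ e \<alpha>"
        using * curve_coord_const[of \<alpha>] unfolding jet_coord_rep
        by (cases "\<alpha> = 0") (auto simp: curve_coord_block)
    qed
    then have "jet A k (jet_rep p) = jet A k (\<lambda>t. ?a)"
      using jet_domD[OF p] by (intro jet_eqI[OF _ smooth_near_0_const c] jet_bundle_rep(1)) auto
    then show "p \<in> null_section A k"
      using jet_bundle_rep(2)[OF jet_domD(1)[OF p]] by (auto simp: null_section_def)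
  qed
  moreover have "jet_coord k e c p \<in> cyl (snd c ` fst c)" using jet_coord_image[OF c] p by blast
  ultimately show ?thesis using jet_domD(1)[OF p] by (auto simp: slit_bundle_def slit_coord_def)
qed

lemma slit_coord_image:
  assumes c: "c \<in> A" shows "jet_coord k e c ` (slit_bundle A k \<inter> jet_dom A k c) = slit_coord c"
proof
  show "jet_coord k e c ` (slit_bundle A k \<inter> jet_dom A k c) \<subseteq> slit_coord c"
    using slit_bundle_iff[OF c] by auto
  show "slit_coord c \<subseteq> jet_coord k e c ` (slit_bundle A k \<inter> jet_dom A k c)"
  proof
    fix u assume u: "u \<in> slit_coord c"
    then have "u \<in> jet_coord k e c ` jet_dom A k c" using jet_coord_image[OF c] by (simp add: slit_coord_def)
    then show "u \<in> jet_coord k e c ` (slit_bundle A k \<inter> jet_dom A k c)"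
      using slit_bundle_iff[OF c] u by auto
  qed
qed

lemma openin_slit_dom:
  assumes c: "c \<in> A" shows "openin (jet_topology k e A) (slit_bundle A k \<inter> jet_dom A k c)"
proof -
  have "slit_bundle A k \<inter> jet_dom A k c = jet_dom A k c \<inter> jet_coord k e c -` slit_coord c"
    using slit_bundle_iff[OF c] by auto
  then show ?thesis using openin_jet_dom_coord[OF c open_slit_coord[OF c]] by simp
qed

end

section \<open>Differential operators in coordinates\<close>

context block_numbering
begin

lemma block_expansion:
  fixes v :: "real ^ 'n::finite ^ 'j"
  shows "v = (\<Sum>\<alpha>\<le>k. \<Sum>i\<in>UNIV. v $ e \<alpha> $ i *\<^sub>R axis (e \<alpha>) (axis i 1))"
proof (rule block_eqI)
  fix \<beta> assume \<beta>: "\<beta> \<le> k"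
  have *: "(\<Sum>\<alpha>\<le>k. \<Sum>i\<in>UNIV. v $ e \<alpha> $ i *\<^sub>R axis (e \<alpha>) (axis i 1)) $ e \<beta> $ l = v $ e \<beta> $ l" for l
  proof -
    have "(\<Sum>\<alpha>\<le>k. \<Sum>i\<in>UNIV. v $ e \<alpha> $ i *\<^sub>R axis (e \<alpha>) (axis i 1)) $ e \<beta> $ l =
        (\<Sum>\<alpha>\<le>k. \<Sum>i\<in>UNIV. if \<alpha> = \<beta> \<and> i = l then v $ e \<alpha> $ i else 0)"
      using \<beta> by (simp add: axis_def if_distrib) (intro sum.cong refl, auto)
    also have "\<dots> = (\<Sum>\<alpha>\<le>k. if \<alpha> = \<beta> then v $ e \<beta> $ l else 0)"
      by (intro sum.cong refl) auto
    finally show ?thesis using \<beta> by simp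
  qed
  show "v $ e \<beta> = (\<Sum>\<alpha>\<le>k. \<Sum>i\<in>UNIV. v $ e \<alpha> $ i *\<^sub>R axis (e \<alpha>) (axis i 1)) $ e \<beta>"
    unfolding vec_eq_iff using * by auto
qed

lemma linear_block_expansion:
  fixes D :: "real ^ 'n::finite ^ 'j \<Rightarrow> real"
  assumes "linear D"
  shows "D v = (\<Sum>\<alpha>\<le>k. \<Sum>i\<in>UNIV. v $ e \<alpha> $ i * D (axis (e \<alpha>) (axis i 1)))"
proof -
  have "D v = D (\<Sum>\<alpha>\<le>k. \<Sum>i\<in>UNIV. v $ e \<alpha> $ i *\<^sub>R axis (e \<alpha>) (axis i 1))"
    by (subst block_expansion[of v]) simp
  then show ?thesis by (simp add: linear_sum[OF assms] linear_scale[OF assms])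
qed

lemma linear_shift_expansion:
  fixes D :: "real ^ 'n::finite ^ 'j \<Rightarrow> real"
  assumes "linear D"
  shows "D (shift u) = (\<Sum>\<alpha>=1..k. \<Sum>i\<in>UNIV. real \<alpha> * u $ e \<alpha> $ i * D (axis (e (\<alpha> - 1)) (axis i 1)))"
proof -
  have "D (shift u) = (\<Sum>\<alpha><k. \<Sum>i\<in>UNIV. shift u $ e \<alpha> $ i * D (axis (e \<alpha>) (axis i 1)))"
    unfolding linear_block_expansion[OF assms, of "shift u"]
    by (simp add: lessThan_Suc_atMost[symmetric])
  also have "\<dots> = (\<Sum>\<alpha><k. \<Sum>i\<in>UNIV. real (Suc \<alpha>) * u $ e (Suc \<alpha>) $ i * D (axis (e \<alpha>) (axis i 1)))"
    by (intro sum.cong refl) (auto simp: shift_block)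
  also have "\<dots> = (\<Sum>\<alpha>=1..k. \<Sum>i\<in>UNIV. real \<alpha> * u $ e \<alpha> $ i * D (axis (e (\<alpha> - 1)) (axis i 1)))"
    by (rule sum.reindex_bij_witness[where i = "\<lambda>\<alpha>. \<alpha> - 1" and j = Suc]) auto
  finally show ?thesis .
qed

lemma linear_top_expansion:
  fixes D :: "real ^ 'n::finite ^ 'j \<Rightarrow> real"
  assumes "linear D"
  shows "D (axis (e k) w) = (\<Sum>i\<in>UNIV. w $ i * D (axis (e k) (axis i 1)))"
proof -
  have "D (axis (e k) w) = (\<Sum>\<alpha>\<le>k. if \<alpha> = k then \<Sum>i\<in>UNIV. w $ i * D (axis (e k) (axis i 1)) else 0)"
    unfolding linear_block_expansion[OF assms, of "axis (e k) w"]
    by (intro sum.cong refl) auto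
  then show ?thesis by simp
qed

lemma block_has_vector_derivativeI:
  fixes u :: "real \<Rightarrow> real ^ 'n::finite ^ 'j"
  assumes "\<And>\<alpha>. \<alpha> \<le> k \<Longrightarrow> ((\<lambda>s. u s $ e \<alpha>) has_vector_derivative v $ e \<alpha>) (at t)"
  shows "(u has_vector_derivative v) (at t)"
proof -
  have "((\<lambda>s. u s $ b) has_derivative (\<lambda>h. h *\<^sub>R v $ b)) (at t)" for b
    using assms by (metis e_cases has_vector_derivative_def)
  then have "((\<lambda>s. \<chi> b. u s $ b) has_derivative (\<lambda>h. \<chi> b. h *\<^sub>R v $ b)) (at t)"
    by (rule has_derivative_vec)
  then show ?thesis by (simp add: has_vector_derivative_def scaleR_vec_def)
qed

end

context jet_coordinates
begin

lemma smooth_near_local_rep: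
  assumes "c \<in> A" "p \<in> jet_dom A k c" "smooth_near k e A p f"
  obtains Q where "open Q" "jet_coord k e c p \<in> Q" "smooth_on Q (local_rep k e A c f)"
proof -
  obtain W where W: "openin (jet_topology k e A) W" "p \<in> W" "smooth_fun k e A W f"
    using assms(3) by (auto simp: smooth_near_def)
  show ?thesis
    by (rule that[OF open_jet_coord_image[OF assms(1) W(1)]])
      (use W assms in \<open>auto simp: smooth_fun_def\<close>)
qed

lemma smooth_near_linear:
  assumes "c \<in> A" "p \<in> jet_dom A k c" "smooth_near k e A p f"
  shows "linear (frechet_derivative (local_rep k e A c f) (at (jet_coord k e c p)))"
  using smooth_near_local_rep[OF assms] smooth_on_linear_derivative by metis

lemma smooth_near_from_chart:
  assumes "c \<in> A" "open Q" "smooth_on Q (local_rep k e A c f)" "p \<in> jet_dom A k c" "jet_coord k e c p \<in> Q"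
  shows "smooth_near k e A p f"
  unfolding smooth_near_def
proof (intro exI conjI)
  let ?W = "jet_dom A k c \<inter> jet_coord k e c -` Q"
  show "openin (jet_topology k e A) ?W" by (rule openin_jet_dom_coord[OF assms(1,2)])
  then show "smooth_fun k e A ?W f"
    by (rule smooth_fun_from_chart[OF assms(1)]) (auto intro: smooth_on_subset[OF assms(3)])
  show "p \<in> ?W" using assms by simp
qed

lemma local_rep_from_coord:
  assumes "c \<in> A" "\<And>p. p \<in> jet_dom A k c \<Longrightarrow> f p = g (jet_coord k e c p)"
    and "u \<in> cyl (snd c ` fst c)"
  shows "local_rep k e A c f u = g u"
proof -
  obtain p where p: "p \<in> jet_dom A k c" "u = jet_coord k e c p"
    using assms(3) jet_coord_image[OF assms(1)] by blast
  show ?thesis unfolding p(2) local_rep_jet_coord[OF assms(1) p(1)] by (rule assms(2)[OF p(1)])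
qed

lemma local_rep_pd:
  assumes "c \<in> A" "u \<in> cyl (snd c ` fst c)"
  shows "local_rep k e A c (pd k e A c \<alpha> i f) u =
    frechet_derivative (local_rep k e A c f) (at u) (axis (e \<alpha>) (axis i 1))"
  by (rule local_rep_from_coord[OF assms(1) _ assms(2)]) (simp add: pd_def)

lemma open_chart_cyl: "c \<in> A \<Longrightarrow> open (cyl (snd c ` fst c) :: (real ^ 'n ^ 'j) set)"
  by (rule open_cyl[OF chart_image_open])

lemma coord_in_cyl: "c \<in> A \<Longrightarrow> p \<in> jet_dom A k c \<Longrightarrow> jet_coord k e c p \<in> cyl (snd c ` fst c)"
  using jet_coord_image by blast

lemma smooth_on_coordinate:
  fixes Q :: "(real ^ 'n ^ 'j) set"
  assumes "open Q" shows "smooth_on Q (\<lambda>u. u $ b $ i)"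
  using smooth_on_vec_nth[OF assms smooth_on_vec_nth[OF assms smooth_on_ident[OF assms]]] .

lemma smooth_near_yc:
  assumes "c \<in> A" "p \<in> jet_dom A k c" shows "smooth_near k e A p (yc k e c \<alpha> i)"
proof (rule smooth_near_from_chart[OF assms(1) open_chart_cyl[OF assms(1)] _ assms(2) coord_in_cyl[OF assms]])
  show "smooth_on (cyl (snd c ` fst c)) (local_rep k e A c (yc k e c \<alpha> i))"
    by (rule smooth_on_cong[OF open_chart_cyl[OF assms(1)]
          smooth_on_coordinate[OF open_chart_cyl[OF assms(1)], of "e \<alpha>" i]])
      (subst local_rep_from_coord[OF assms(1), where g = "\<lambda>u. u $ e \<alpha> $ i"], auto simp: yc_def)
qed

lemma derivative_yc:
  assumes "c \<in> A" "p \<in> jet_dom A k c"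
  shows "frechet_derivative (local_rep k e A c (yc k e c \<alpha> i)) (at (jet_coord k e c p)) v = v $ e \<alpha> $ i"
proof -
  have "frechet_derivative (local_rep k e A c (yc k e c \<alpha> i)) (at (jet_coord k e c p)) =
      frechet_derivative (\<lambda>u. u $ e \<alpha> $ i) (at (jet_coord k e c p))"
    by (rule frechet_derivative_cong_open[OF open_chart_cyl[OF assms(1)] coord_in_cyl[OF assms]],
        rule local_rep_from_coord[OF assms(1)]) (auto simp: yc_def)
  moreover have "((\<lambda>u :: real ^ 'n ^ 'j. u $ e \<alpha> $ i) has_derivative (\<lambda>v. v $ e \<alpha> $ i)) (at u)" for u
    by (intro bounded_linear_imp_has_derivative bounded_linear_compose[OF bounded_linear_vec_nth bounded_linear_vec_nth])
  note frechet_derivative_eq[OF this]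
  ultimately show ?thesis by (simp only:)
qed

lemma derivative_pd_expansion:
  assumes "c \<in> A" "p \<in> jet_dom A k c" "smooth_near k e A p f"
  shows "frechet_derivative (local_rep k e A c f) (at (jet_coord k e c p)) v =
    (\<Sum>\<alpha>\<le>k. \<Sum>i\<in>UNIV. v $ e \<alpha> $ i * pd k e A c \<alpha> i f p)"
  unfolding pd_def by (rule linear_block_expansion[OF smooth_near_linear[OF assms]])

lemma Gamma_op_eq:
  assumes "c \<in> A" "p \<in> jet_dom A k c" "smooth_near k e A p f"
  shows "Gamma_op k e A c f p =
    frechet_derivative (local_rep k e A c f) (at (jet_coord k e c p)) (shift (jet_coord k e c p))"
  unfolding Gamma_op_def pd_def yc_def
  by (rule linear_shift_expansion[OF smooth_near_linear[OF assms], symmetric])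

lemma derivative_local_rep_transform:
  assumes "c \<in> A" "d \<in> A" "p \<in> jet_dom A k c" "p \<in> jet_dom A k d" "smooth_near k e A p f"
  shows "frechet_derivative (local_rep k e A c f) (at (jet_coord k e c p)) v =
    frechet_derivative (local_rep k e A d f) (at (jet_coord k e d p))
      (frechet_derivative (prolongation (transition c d)) (at (jet_coord k e c p)) v)"
proof -
  interpret coordinate_change k e "overlap c d" "transition c d"
    by (rule coordinate_change[OF assms(1,2)])
  let ?u = "jet_coord k e c p" and ?T = "prolongation (transition c d)"
  have u: "?u \<in> cyl (overlap c d)" by (rule jet_coord_overlap[OF assms(1,3,4)])
  have Tu: "jet_coord k e d p = ?T ?u" by (rule jet_coord_transform[OF assms(1-4)])
  obtain Q where Q: "open Q" "?T ?u \<in> Q" "smooth_on Q (local_rep k e A d f)"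
    using smooth_near_local_rep[OF assms(2,4,5)] unfolding Tu by blast
  have "frechet_derivative (local_rep k e A c f) (at ?u) =
      frechet_derivative (\<lambda>u. local_rep k e A d f (?T u)) (at ?u)"
    by (rule frechet_derivative_cong_open[OF open_cyl_P u]) (rule local_rep_transform[OF assms(1,2)])
  moreover have "((\<lambda>u. local_rep k e A d f (?T u)) has_derivative
      (\<lambda>v. frechet_derivative (local_rep k e A d f) (at (?T ?u)) (frechet_derivative ?T (at ?u) v))) (at ?u)"
    by (rule has_derivative_compose[OF smooth_on_has_derivative[OF smooth_prolongation u]
          smooth_on_has_derivative[OF Q(3,2)]])
  note frechet_derivative_eq[OF this]
  ultimately show ?thesis unfolding Tu by (simp only:)
qed

text \<open>Differentiate the composition of the coordinate change with its inverse.\<close>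

lemma transition_derivative_surj:
  assumes "c \<in> A" "d \<in> A" "x \<in> overlap c d"
  shows "\<exists>z. frechet_derivative (transition c d) (at x) z = y"
proof -
  interpret cd: coordinate_change k e "overlap c d" "transition c d"
    by (rule coordinate_change[OF assms(1,2)])
  interpret dc: coordinate_change k e "overlap d c" "transition d c"
    by (rule coordinate_change[OF assms(2,1)])
  have inv: "transition c d (transition d c v) = v" if "v \<in> overlap d c" for v
    using that transition_chart[OF assms(1), of _ d] transition_chart[OF assms(2), of _ c]
    by (auto simp: overlap_def)
  let ?y = "transition c d x"
  have x: "?y \<in> overlap d c" "transition d c ?y = x"
    using assms(3) transition_chart[OF assms(1), of _ d] transition_chart[OF assms(2), of _ c]
    by (auto simp: overlap_def)
  have "((\<lambda>v. transition c d (transition d c v)) has_derivative (\<lambda>w.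
      frechet_derivative (transition c d) (at (transition d c ?y))
        (frechet_derivative (transition d c) (at ?y) w))) (at ?y)"
    by (rule has_derivative_compose[OF smooth_on_has_derivative[OF dc.smooth_\<tau> x(1)]
          smooth_on_has_derivative[OF cd.smooth_\<tau>]]) (use x assms(3) in simp)
  then have "((\<lambda>v. v) has_derivative (\<lambda>w. frechet_derivative (transition c d) (at (transition d c ?y))
        (frechet_derivative (transition d c) (at ?y) w))) (at ?y)"
    by (rule has_derivative_transform_within_open[OF _ dc.open_P x(1) inv])
  from fun_cong[OF frechet_derivative_eq[OF this], of y]
  have "frechet_derivative (transition c d) (at x) (frechet_derivative (transition d c) (at ?y) y) = y"
    by (simp add: x)
  then show ?thesis by blast
qed

end

section \<open>The spray of a Finslerian mechanical system\<close>

lemma linear_eq_0_on_axes: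
  fixes h :: "real ^ 'n::finite \<Rightarrow> 'a::real_vector"
  assumes "linear h" "\<And>i. h (axis i 1) = 0"
  shows "h z = 0"
  unfolding linear_basis_expansion[OF assms(1), of z]
  by (rule sum.neutral) (auto simp: Basis_vec_def assms(2))

lemma invertible_if_definite:
  fixes g :: "real ^ 'n::finite ^ 'n"
  assumes "\<And>v. v \<noteq> 0 \<Longrightarrow> v \<bullet> (g *v v) > 0"
  shows "invertible g"
proof -
  have "v = 0" if "g *v v = 0" for v using assms[of v] that by auto
  then show ?thesis using matrix_left_invertible_ker[of g] invertible_left_inverse[of g] by blast
qed

locale finsler_mechanics = jet_coordinates k e A
  for k and e :: "nat \<Rightarrow> 'j::finite"
    and A :: "('m::{t2_space,second_countable_topology}, 'n::finite) chart set" +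
  fixes F :: "'m jet \<Rightarrow> real" and Fe :: "'m operator"
  assumes mechanics: "mechanical_system k e A F Fe"
begin

abbreviation "slit \<equiv> slit_bundle A k"
abbreviation "coord \<equiv> jet_coord k e"

definition energy :: "('m, 'n) chart \<Rightarrow> real ^ 'n ^ 'j \<Rightarrow> real" where
  "energy c = local_rep k e A c (\<lambda>q. (F q)\<^sup>2)"

definition metric :: "('m, 'n) chart \<Rightarrow> real ^ 'n ^ 'j \<Rightarrow> real ^ 'n ^ 'n" where
  "metric c u = (\<chi> i j. 1 / 2 * second_derivative (energy c) u
     (axis (e k) (axis j 1)) (axis (e k) (axis i 1)))"

text \<open>The force-free Lagrange expression for the velocity whose last block is 0.\<close>

definition Lagrange_base :: "('m, 'n) chart \<Rightarrow> real ^ 'n ^ 'j \<Rightarrow> real ^ 'n" where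
  "Lagrange_base c u = (\<chi> j. second_derivative (energy c) u (axis (e k) (axis j 1)) (shift u)
     - frechet_derivative (energy c) (at u) (axis (e (k - 1)) (axis j 1)))"

text \<open>The coefficients \<open>-(k + 1) G\<^sup>i\<close>, as functions of the coordinates.\<close>

definition geodesic_top :: "('m, 'n) chart \<Rightarrow> real ^ 'n ^ 'j \<Rightarrow> real ^ 'n" where
  "geodesic_top c u = - (1 / 2) *\<^sub>R (matrix_inv (metric c u) *v Lagrange_base c u)"

definition force :: "('m, 'n) chart \<Rightarrow> real ^ 'n ^ 'j \<Rightarrow> real ^ 'n" where
  "force c u = (\<chi> i. local_rep k e A c (Fe (yc k e c k i)) u)"

definition spray_field :: "('m, 'n) chart \<Rightarrow> real ^ 'n ^ 'j \<Rightarrow> real ^ 'n ^ 'j" where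
  "spray_field c u = shift u + axis (e k) (geodesic_top c u + (1 / 2) *\<^sub>R force c u)"

lemma slit_coord_sub: "slit_coord c \<subseteq> cyl (snd c ` fst c)"
  by (auto simp: slit_coord_def)

lemma coord_in_slit: "c \<in> A \<Longrightarrow> p \<in> slit \<inter> jet_dom A k c \<Longrightarrow> coord c p \<in> slit_coord c"
  using slit_coord_image by blast

lemma smooth_energy:
  assumes "c \<in> A" shows "smooth_on (slit_coord c) (energy c)"
proof -
  have "smooth_fun k e A slit F"
    using mechanics by (simp add: mechanical_system_def finsler_space_def)
  then have "smooth_on (slit_coord c) (local_rep k e A c F)"
    using assms unfolding slit_coord_image[OF assms, symmetric] smooth_fun_def by blast
  then have "smooth_on (slit_coord c) (\<lambda>u. local_rep k e A c F u * local_rep k e A c F u)"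
    by (intro smooth_on_mult open_slit_coord assms)
  then show ?thesis by (simp add: energy_def local_rep_def[abs_def] power2_eq_square)
qed

lemma local_rep_pd_energy:
  assumes "c \<in> A" "u \<in> slit_coord c"
  shows "local_rep k e A c (pd k e A c \<alpha> i (\<lambda>q. (F q)\<^sup>2)) u =
    frechet_derivative (energy c) (at u) (axis (e \<alpha>) (axis i 1))"
  using local_rep_pd[OF assms(1)] assms(2) slit_coord_sub unfolding energy_def by blast

lemma smooth_local_rep_pd_energy:
  assumes "c \<in> A"
  shows "smooth_on (slit_coord c) (local_rep k e A c (pd k e A c \<alpha> i (\<lambda>q. (F q)\<^sup>2)))"
  by (rule smooth_on_cong[OF open_slit_coord[OF assms]
        smooth_on_frechet_derivative[OF smooth_energy[OF assms]]])
    (rule local_rep_pd_energy[OF assms, symmetric])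

lemma smooth_near_pd_energy:
  assumes "c \<in> A" "p \<in> slit \<inter> jet_dom A k c"
  shows "smooth_near k e A p (pd k e A c \<alpha> i (\<lambda>q. (F q)\<^sup>2))"
  using assms smooth_near_from_chart[OF assms(1) open_slit_coord smooth_local_rep_pd_energy _ coord_in_slit]
  by blast

lemma derivative_pd_energy:
  assumes "c \<in> A" "u \<in> slit_coord c"
  shows "frechet_derivative (local_rep k e A c (pd k e A c \<alpha> i (\<lambda>q. (F q)\<^sup>2))) (at u) v =
    second_derivative (energy c) u (axis (e \<alpha>) (axis i 1)) v"
  unfolding second_derivative_def
  by (subst frechet_derivative_cong_open[OF open_slit_coord[OF assms(1)] assms(2)
        local_rep_pd_energy[OF assms(1)]]) auto

lemma metric_tensor_eq:
  assumes "c \<in> A" "p \<in> slit \<inter> jet_dom A k c"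
  shows "metric_tensor k e A F c p = metric c (coord c p)"
  unfolding metric_tensor_def metric_def pd_def[of k e A c k _ "pd k e A c k _ _"]
    derivative_pd_energy[OF assms(1) coord_in_slit[OF assms]] ..

lemma metric_invertible:
  assumes "c \<in> A" "u \<in> slit_coord c" shows "invertible (metric c u)"
proof -
  obtain p where p: "p \<in> slit \<inter> jet_dom A k c" "u = coord c p"
    using assms(2) slit_coord_image[OF assms(1)] by blast
  have "\<forall>v. v \<noteq> 0 \<longrightarrow> v \<bullet> (metric_tensor k e A F c p *v v) > 0"
    using mechanics assms(1) p(1) by (simp add: mechanical_system_def finsler_space_def)
  then show ?thesis
    using invertible_if_definite[of "metric c u"] by (simp add: metric_tensor_eq[OF assms(1) p(1)] p(2))
qed

lemma G_coeff_eq: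
  assumes "c \<in> A" "p \<in> slit \<inter> jet_dom A k c"
  shows "- (real k + 1) * G_coeff k e A F c i p = geodesic_top c (coord c p) $ i"
proof -
  have "Gamma_op k e A c (pd k e A c k j (\<lambda>q. (F q)\<^sup>2)) p - pd k e A c (k - 1) j (\<lambda>q. (F q)\<^sup>2) p =
      Lagrange_base c (coord c p) $ j" for j
    using assms Gamma_op_eq[OF assms(1) _ smooth_near_pd_energy[OF assms]]
      derivative_pd_energy[OF assms(1) coord_in_slit[OF assms]]
    by (simp add: Lagrange_base_def pd_def[of k e A c "k - 1"] energy_def pd_def[of k e A c "k - Suc 0"])
  then show ?thesis
    by (simp add: G_coeff_def geodesic_top_def metric_tensor_eq[OF assms] matrix_vector_mult_def field_simps)
qed

lemma lower_force_eq:
  assumes "c \<in> A" "p \<in> slit \<inter> jet_dom A k c"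
  shows "lower_force k e A F Fe c i p = (metric c (coord c p) *v force c (coord c p)) $ i"
  using assms
  by (simp add: lower_force_def metric_tensor_eq matrix_vector_mult_def force_def local_rep_jet_coord)

text \<open>The Lagrange equation at a point with velocity \<open>\<xi>\<close> is linear in the last block of \<open>\<xi>\<close>, with
  twice the metric as its matrix; this is where the symmetry of the second derivatives enters.\<close>

lemma Lagrange_equation_iff:
  assumes "c \<in> A" "u \<in> slit_coord c" and \<xi>: "\<xi> = shift u + axis (e k) w"
  shows "(\<forall>j. second_derivative (energy c) u (axis (e k) (axis j 1)) \<xi>
      - frechet_derivative (energy c) (at u) (axis (e (k - 1)) (axis j 1)) = (metric c u *v r) $ j) \<longleftrightarrow>
    w = geodesic_top c u + (1 / 2) *\<^sub>R r"
proof -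
  let ?g = "metric c u" and ?b = "Lagrange_base c u"
  let ?E = "\<lambda>i. axis (e k) (axis i 1) :: real ^ 'n ^ 'j"
  have "second_derivative (energy c) u (?E j) \<xi>
      - frechet_derivative (energy c) (at u) (axis (e (k - 1)) (axis j 1)) = (?b + 2 *\<^sub>R (?g *v w)) $ j" for j
  proof -
    have lin: "linear (second_derivative (energy c) u (?E j))"
      by (rule linear_second_derivative[OF smooth_energy[OF assms(1)] assms(2)])
    have "second_derivative (energy c) u (?E j) (axis (e k) w) =
        (\<Sum>i\<in>UNIV. w $ i * second_derivative (energy c) u (?E j) (?E i))"
      by (rule linear_top_expansion[OF lin])
    also have "\<dots> = (\<Sum>i\<in>UNIV. w $ i * second_derivative (energy c) u (?E i) (?E j))"
      using second_derivative_symmetric[OF open_slit_coord[OF assms(1)] smooth_energy[OF assms(1)] assms(2)]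
      by (intro sum.cong refl arg_cong2[where f = "(*)"])
    also have "\<dots> = 2 * (?g *v w) $ j"
      by (simp add: metric_def matrix_vector_mult_def sum_distrib_left mult.commute)
    finally show ?thesis by (simp add: \<xi> linear_add[OF lin] Lagrange_base_def)
  qed
  then have "?thesis \<longleftrightarrow> (?b + 2 *\<^sub>R (?g *v w) = ?g *v r \<longleftrightarrow> w = geodesic_top c u + (1 / 2) *\<^sub>R r)"
    by (simp add: vec_eq_iff)
  moreover have "?b + 2 *\<^sub>R (?g *v w) = ?g *v r \<longleftrightarrow> w = geodesic_top c u + (1 / 2) *\<^sub>R r"
  proof -
    note inv = matrix_inv_inverse[OF metric_invertible[OF assms(1,2)]]
    have b: "?b = ?g *v (- 2 *\<^sub>R geodesic_top c u)"
      by (simp add: geodesic_top_def matrix_vector_mul_assoc inv(1))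
    have inj: "?g *v x = ?g *v y \<longleftrightarrow> x = y" for x y
      by (metis inv(2) matrix_vector_mul_assoc matrix_vector_mul_lid)
    have "?b + 2 *\<^sub>R (?g *v w) = ?g *v (2 *\<^sub>R w - 2 *\<^sub>R geodesic_top c u)"
      unfolding b linear_scale[OF matrix_vector_mul_linear, symmetric] matrix_vector_right_distrib[symmetric]
      by (simp add: algebra_simps)
    then have "?b + 2 *\<^sub>R (?g *v w) = ?g *v r \<longleftrightarrow> 2 *\<^sub>R w - 2 *\<^sub>R geodesic_top c u = r"
      by (simp only: inj)
    also have "\<dots> \<longleftrightarrow> w = geodesic_top c u + (1 / 2) *\<^sub>R r"
      by (auto simp: vec_eq_iff field_simps)
    finally show ?thesis .
  qed
  ultimately show ?thesis by blast
qed

text \<open>A change of chart does not map coordinate axes to coordinate axes, so the equations are needed in every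
  direction \<open>z\<close>. Symmetry of the second derivative shows that they are linear in \<open>z\<close>.\<close>

lemma Lagrange_equation_all_directions:
  assumes "c \<in> A" "u \<in> slit_coord c"
    and "\<And>j. second_derivative (energy c) u (axis (e k) (axis j 1)) \<xi> =
      frechet_derivative (energy c) (at u) (axis (e (k - 1)) (axis j 1))"
  shows "second_derivative (energy c) u (axis (e k) z) \<xi> =
    frechet_derivative (energy c) (at u) (axis (e (k - 1)) z)"
proof -
  let ?h = "\<lambda>z. second_derivative (energy c) u \<xi> (axis (e k) z)
      - frechet_derivative (energy c) (at u) (axis (e (k - 1)) z)"
  have sym: "second_derivative (energy c) u v w = second_derivative (energy c) u w v" for v w
    by (rule second_derivative_symmetric[OF open_slit_coord[OF assms(1)] smooth_energy[OF assms(1)] assms(2)])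
  have "linear ?h"
    using linear_compose_sub[OF
        linear_compose[OF linear_axis[of "e k"] linear_second_derivative[OF smooth_energy[OF assms(1)] assms(2), of \<xi>]]
        linear_compose[OF linear_axis[of "e (k - 1)"] smooth_on_linear_derivative[OF smooth_energy[OF assms(1)] assms(2)]]]
    by (simp add: o_def)
  from linear_eq_0_on_axes[OF this, of z] show ?thesis
    using assms(3) by (simp add: sym[of \<xi>])
qed

text \<open>The image of the geodesic vector is a semispray vector and satisfies the force-free Lagrange equations of
  the other chart; these equations have only one such solution.\<close>

lemma geodesic_field_transform:
  assumes "c \<in> A" "d \<in> A" "p \<in> slit" "p \<in> jet_dom A k c" "p \<in> jet_dom A k d"
  shows "frechet_derivative (prolongation (transition c d)) (at (coord c p))
      (shift (coord c p) + axis (e k) (geodesic_top c (coord c p))) =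
    shift (coord d p) + axis (e k) (geodesic_top d (coord d p))"
proof -
  interpret cd: coordinate_change k e "overlap c d" "transition c d"
    by (rule coordinate_change[OF assms(1,2)])
  let ?T = "prolongation (transition c d)"
  define u where "u = coord c p"
  define v where "v = coord d p"
  define \<xi> where "\<xi> = shift u + axis (e k) (geodesic_top c u)"
  have u: "u \<in> cyl (overlap c d)" unfolding u_def by (rule jet_coord_overlap[OF assms(1,4,5)])
  have v: "v = ?T u" unfolding u_def v_def by (rule jet_coord_transform[OF assms(1,2,4,5)])
  have us: "u \<in> slit_coord c" using coord_in_slit[OF assms(1)] assms by (simp add: u_def)
  have vs: "v \<in> slit_coord d" using coord_in_slit[OF assms(2)] assms by (simp add: v_def)
  have "second_derivative (energy c) u (axis (e k) (axis j 1)) \<xi> =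
      frechet_derivative (energy c) (at u) (axis (e (k - 1)) (axis j 1))" for j
    using Lagrange_equation_iff[OF assms(1) us \<xi>_def, of 0] by (simp add: matrix_vector_mult_def)
  then have eq: "second_derivative (energy c) u (axis (e k) z) \<xi> =
      frechet_derivative (energy c) (at u) (axis (e (k - 1)) z)" for z
    by (rule Lagrange_equation_all_directions[OF assms(1) us])
  have tr: "energy c w = energy d (?T w)" if "w \<in> cyl (overlap c d)" for w
    unfolding energy_def by (rule local_rep_transform[OF assms(1,2) that])
  have eq': "second_derivative (energy d) v
        (axis (e k) (frechet_derivative (transition c d) (at (u $ e 0)) z)) (frechet_derivative ?T (at u) \<xi>)
      - frechet_derivative (energy d) (at v)
          (axis (e (k - 1)) (frechet_derivative (transition c d) (at (u $ e 0)) z)) = 0" for z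
    using cd.Lagrange_expression_transform[OF u open_slit_coord[OF assms(2)] vs[unfolded v]
        smooth_energy[OF assms(2)] cd.open_cyl_P u tr \<xi>_def, of z] eq[of z]
    unfolding v by simp
  obtain w where w: "frechet_derivative ?T (at u) \<xi> = shift v + axis (e k) w"
    using cd.prolongation_derivative_semispray[OF u] unfolding \<xi>_def v by blast
  have "second_derivative (energy d) v (axis (e k) (axis j 1)) (shift v + axis (e k) w)
      - frechet_derivative (energy d) (at v) (axis (e (k - 1)) (axis j 1)) = 0" for j
  proof -
    obtain z where "frechet_derivative (transition c d) (at (u $ e 0)) z = axis j 1"
      using transition_derivative_surj[OF assms(1,2), of "u $ e 0" "axis j 1"] u by (auto simp: cyl_def)
    then show ?thesis using eq'[of z] unfolding w by simp
  qed
  then have "w = geodesic_top d v"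
    using Lagrange_equation_iff[OF assms(2) vs refl, of w 0] by simp
  then show ?thesis using w by (simp add: u_def v_def \<xi>_def)
qed

lemma canonical_spray_in_eq:
  assumes "c \<in> A" "p \<in> slit \<inter> jet_dom A k c" "smooth_near k e A p f"
  shows "canonical_spray_in k e A F c f p =
    frechet_derivative (local_rep k e A c f) (at (coord c p))
      (shift (coord c p) + axis (e k) (geodesic_top c (coord c p)))"
proof -
  let ?D = "frechet_derivative (local_rep k e A c f) (at (coord c p))"
  have p: "p \<in> jet_dom A k c" using assms(2) by simp
  have lin: "linear ?D" by (rule smooth_near_linear[OF assms(1) p assms(3)])
  have "?D (axis (e k) (geodesic_top c (coord c p))) =
      (\<Sum>i\<in>UNIV. (- (real k + 1) * G_coeff k e A F c i p) * pd k e A c k i f p)"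
    using linear_top_expansion[OF lin, of "geodesic_top c (coord c p)"]
    by (simp only: G_coeff_eq[OF assms(1,2)] pd_def)
  also have "\<dots> = - ((real k + 1) * (\<Sum>i\<in>UNIV. G_coeff k e A F c i p * pd k e A c k i f p))"
    by (simp add: sum_distrib_left sum_negf[symmetric] algebra_simps)
  finally show ?thesis
    unfolding canonical_spray_in_def linear_add[OF lin] Gamma_op_eq[OF assms(1) p assms(3)] by simp
qed

lemma canonical_spray_in_chart_independent:
  assumes "c \<in> A" "d \<in> A" "p \<in> slit" "p \<in> jet_dom A k c" "p \<in> jet_dom A k d" "smooth_near k e A p f"
  shows "canonical_spray_in k e A F c f p = canonical_spray_in k e A F d f p"
  using canonical_spray_in_eq[OF assms(1) _ assms(6)] canonical_spray_in_eq[OF assms(2) _ assms(6)]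
    derivative_local_rep_transform[OF assms(1,2,4,5,6)] geodesic_field_transform[OF assms(1-5)] assms
  by simp

text \<open>The force term is the same operator in all charts, so only the geodesic part has to be compared.\<close>

lemma mechanical_spray_eq_in_chart:
  assumes "c \<in> A" "p \<in> slit \<inter> jet_dom A k c" "smooth_near k e A p f"
  shows "mechanical_spray k e A F Fe f p = mechanical_spray_in k e A F Fe c f p"
proof -
  let ?d = "SOME d. d \<in> A \<and> p \<in> jet_dom A k d"
  have "?d \<in> A \<and> p \<in> jet_dom A k ?d" by (rule someI[of _ c]) (use assms in auto)
  then have "canonical_spray_in k e A F ?d f p = canonical_spray_in k e A F c f p"
    using canonical_spray_in_chart_independent[of ?d c] assms by blast
  then show ?thesis by (simp add: mechanical_spray_def mechanical_spray_in_def)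
qed

lemma force_derivative:
  assumes "c \<in> A" "p \<in> slit \<inter> jet_dom A k c" "smooth_near k e A p f"
  shows "Fe f p = frechet_derivative (local_rep k e A c f) (at (coord c p)) (axis (e k) (force c (coord c p)))"
proof -
  have p: "p \<in> jet_dom A k c" using assms(2) by simp
  have "Fe f p = (\<Sum>\<alpha>\<le>k. \<Sum>i\<in>UNIV. Fe (yc k e c \<alpha> i) p * pd k e A c \<alpha> i f p)"
    using mechanics assms unfolding mechanical_system_def vector_field_def by blast
  also have "\<dots> = (\<Sum>\<alpha>\<le>k. if \<alpha> = k then \<Sum>i\<in>UNIV. Fe (yc k e c k i) p * pd k e A c k i f p else 0)"
  proof (intro sum.cong refl)
    fix \<alpha> assume "\<alpha> \<in> {..k}"
    moreover have "\<forall>\<alpha><k. \<forall>i. Fe (yc k e c \<alpha> i) p = 0"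
      using mechanics assms unfolding mechanical_system_def by blast
    ultimately show "(\<Sum>i\<in>UNIV. Fe (yc k e c \<alpha> i) p * pd k e A c \<alpha> i f p) =
        (if \<alpha> = k then \<Sum>i\<in>UNIV. Fe (yc k e c k i) p * pd k e A c k i f p else 0)"
      by auto
  qed
  also have "\<dots> = (\<Sum>i\<in>UNIV. force c (coord c p) $ i * pd k e A c k i f p)"
    by (simp add: force_def local_rep_jet_coord[OF assms(1) p])
  also have "\<dots> = frechet_derivative (local_rep k e A c f) (at (coord c p)) (axis (e k) (force c (coord c p)))"
    unfolding pd_def by (rule linear_top_expansion[OF smooth_near_linear[OF assms(1) p assms(3)], symmetric])
  finally show ?thesis .
qed

lemma mechanical_spray_eq:
  assumes "c \<in> A" "p \<in> slit \<inter> jet_dom A k c" "smooth_near k e A p f"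
  shows "mechanical_spray k e A F Fe f p =
    frechet_derivative (local_rep k e A c f) (at (coord c p)) (spray_field c (coord c p))"
proof -
  let ?D = "frechet_derivative (local_rep k e A c f) (at (coord c p))"
  have lin: "linear ?D" using smooth_near_linear[OF assms(1) _ assms(3)] assms(2) by blast
  have "spray_field c (coord c p) = (shift (coord c p) + axis (e k) (geodesic_top c (coord c p)))
      + (1 / 2) *\<^sub>R axis (e k) (force c (coord c p))"
    by (simp add: spray_field_def vec_eq_iff axis_def)
  then show ?thesis
    unfolding mechanical_spray_eq_in_chart[OF assms] mechanical_spray_in_def
      canonical_spray_in_eq[OF assms] force_derivative[OF assms]
    by (simp only: linear_add[OF lin] linear_scale[OF lin] real_scaleR_def)
qed

lemma mechanical_spray_yc:
  assumes "c \<in> A" "p \<in> slit \<inter> jet_dom A k c"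
  shows "mechanical_spray k e A F Fe (yc k e c \<alpha> i) p = spray_field c (coord c p) $ e \<alpha> $ i"
  using mechanical_spray_eq[OF assms smooth_near_yc] derivative_yc[OF assms(1)] assms by simp

lemma spray_field_below_top: "\<alpha> < k \<Longrightarrow> spray_field c u $ e \<alpha> = real (Suc \<alpha>) *\<^sub>R u $ e (Suc \<alpha>)"
  by (simp add: spray_field_def shift_block)

lemma smooth_spray_field:
  assumes c: "c \<in> A" shows "smooth_on (slit_coord c) (spray_field c)"
proof -
  let ?Q = "slit_coord c"
  have Q: "open ?Q" by (rule open_slit_coord[OF c])
  have s2: "smooth_on ?Q (\<lambda>u. second_derivative (energy c) u v w)" for v w
    unfolding second_derivative_def by (intro smooth_on_frechet_derivative smooth_energy c)
  have sh: "smooth_on ?Q shift"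
    using smooth_on_bounded_linear[OF bounded_linear_shift Q smooth_on_ident[OF Q]] .
  have "smooth_on ?Q (\<lambda>u. second_derivative (energy c) u v (shift u))" for v
    unfolding second_derivative_def
    by (rule smooth_on_directional_derivative[where h = "\<lambda>u. u", OF Q _ smooth_on_ident[OF Q]
          smooth_on_frechet_derivative[OF smooth_energy[OF c]] sh]) auto
  then have b: "smooth_on ?Q (\<lambda>u. Lagrange_base c u $ j)" for j
    unfolding Lagrange_base_def
    by (simp add: smooth_on_diff[OF Q _ smooth_on_frechet_derivative[OF smooth_energy[OF c]]])
  have g: "smooth_on ?Q (\<lambda>u. metric c u $ i $ j)" for i j
    unfolding metric_def using smooth_on_mult[OF Q smooth_on_const[of _ "1 / 2"] s2] by simp
  have inv: "smooth_on ?Q (\<lambda>u. (matrix_inv (metric c u) *v Lagrange_base c u) $ i)" for i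
    by (rule smooth_on_matrix_inv_vector_mult[OF Q g b metric_invertible[OF c]])
  have "smooth_fun k e A (slit \<inter> jet_dom A k c) (Fe (yc k e c k i))" for i
    using mechanics c unfolding mechanical_system_def vector_field_def by blast
  then have "smooth_on (coord c ` (slit \<inter> jet_dom A k c \<inter> jet_dom A k c)) (local_rep k e A c (Fe (yc k e c k i)))" for i
    using c unfolding smooth_fun_def by blast
  then have "smooth_on ?Q (local_rep k e A c (Fe (yc k e c k i)))" for i
    by (simp add: slit_coord_image[OF c, symmetric] Int_assoc)
  then have "smooth_on ?Q (\<lambda>u. - (1 / 2) * (matrix_inv (metric c u) *v Lagrange_base c u) $ i
      + (1 / 2) * local_rep k e A c (Fe (yc k e c k i)) u)" for i
    by (intro smooth_on_add smooth_on_mult smooth_on_const Q inv)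
  then have "smooth_on ?Q (\<lambda>u. \<chi> i. - (1 / 2) * (matrix_inv (metric c u) *v Lagrange_base c u) $ i
      + (1 / 2) * local_rep k e A c (Fe (yc k e c k i)) u)"
    by (rule smooth_on_vec[OF Q])
  moreover have "(\<chi> i. - (1 / 2) * (matrix_inv (metric c u) *v Lagrange_base c u) $ i
      + (1 / 2) * local_rep k e A c (Fe (yc k e c k i)) u) = geodesic_top c u + (1 / 2) *\<^sub>R force c u" for u
    by (simp add: vec_eq_iff geodesic_top_def force_def)
  ultimately have top: "smooth_on ?Q (\<lambda>u. geodesic_top c u + (1 / 2) *\<^sub>R force c u)" by (simp only:)
  from smooth_on_add[OF Q sh smooth_on_bounded_linear[OF bounded_linear_axis Q top]]
  show ?thesis unfolding spray_field_def[abs_def] .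
qed

lemma semispray_mechanical_spray: "semispray k e A (mechanical_spray k e A F Fe)"
  unfolding semispray_def vector_field_def
proof (intro conjI ballI allI impI)
  let ?S = "mechanical_spray k e A F Fe"
  fix c assume c: "c \<in> A"
  {
    fix \<alpha> i
    show "smooth_fun k e A (slit \<inter> jet_dom A k c) (?S (yc k e c \<alpha> i))"
    proof (rule smooth_fun_from_chart[OF c openin_slit_dom[OF c]])
      show "smooth_on (coord c ` (slit \<inter> jet_dom A k c)) (local_rep k e A c (?S (yc k e c \<alpha> i)))"
        unfolding slit_coord_image[OF c]
      proof (rule smooth_on_cong[OF open_slit_coord[OF c]])
        show "smooth_on (slit_coord c) (\<lambda>u. spray_field c u $ e \<alpha> $ i)"
          by (intro smooth_on_vec_nth open_slit_coord c smooth_spray_field)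
        fix u assume "u \<in> slit_coord c"
        then obtain p where p: "p \<in> slit \<inter> jet_dom A k c" "u = coord c p"
          using slit_coord_image[OF c] by blast
        then show "spray_field c u $ e \<alpha> $ i = local_rep k e A c (?S (yc k e c \<alpha> i)) u"
          using mechanical_spray_yc[OF c p(1)] local_rep_jet_coord[OF c] by simp
      qed
    qed simp
  next
    fix p f assume p: "p \<in> slit \<inter> jet_dom A k c" and f: "smooth_near k e A p f"
    show "?S f p = (\<Sum>\<alpha>\<le>k. \<Sum>i\<in>UNIV. ?S (yc k e c \<alpha> i) p * pd k e A c \<alpha> i f p)"
      unfolding mechanical_spray_eq[OF c p f] mechanical_spray_yc[OF c p]
      using derivative_pd_expansion[OF c _ f] p by blast
    have "?S (yc k e c (\<alpha> - 1) i) p = real \<alpha> * yc k e c \<alpha> i p" if "\<alpha> \<in> {1..k}" for \<alpha> i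
    proof -
      have "spray_field c (coord c p) $ e (\<alpha> - 1) = real \<alpha> *\<^sub>R coord c p $ e \<alpha>"
        using that spray_field_below_top[of "\<alpha> - 1" c "coord c p"] by auto
      then show ?thesis by (simp add: mechanical_spray_yc[OF c p] yc_def)
    qed
    then show "tangent_structure k e A c ?S f p = liouville k e A c f p"
      unfolding tangent_structure_def liouville_def by (intro sum.cong refl) simp
  }
qed

end

section \<open>Integral curves and evolution curves\<close>

text \<open>Bootstrapping: if \<open>u\<close> is \<open>r\<close> times differentiable, then so is its velocity \<open>Y \<circ> u\<close>, hence \<open>u\<close> is
  \<open>r + 1\<close> times differentiable.\<close>

lemma smooth_on_integral_curve:
  fixes u :: "real \<Rightarrow> 'a::euclidean_space"
  assumes "open J" "\<And>t. t \<in> J \<Longrightarrow> (u has_vector_derivative Y (u t)) (at t)" "u ` J \<subseteq> Q" "smooth_on Q Y"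
  shows "smooth_on J u"
  unfolding smooth_on_def
proof
  fix r show "times_differentiable_on r J u"
  proof (induction r)
    case 0
    have "isCont u t" if "t \<in> J" for t
      using assms(2)[OF that] by (rule has_vector_derivative_continuous)
    then show ?case by (simp add: continuous_at_imp_continuous_on)
  next
    case (Suc r)
    show ?case
    proof (rule times_differentiable_on_SucI[OF assms(1)])
      show "(u has_derivative (\<lambda>h. h *\<^sub>R Y (u t))) (at t)" if "t \<in> J" for t
        using assms(2)[OF that] by (simp add: has_vector_derivative_def)
      have "times_differentiable_on r J (\<lambda>t. Y (u t))"
        by (rule times_differentiable_on_compose[OF assms(1,3) Suc
              assms(4)[unfolded smooth_on_def, rule_format]])
      then show "times_differentiable_on r J (\<lambda>t. h *\<^sub>R Y (u t))" for h
        by (intro times_differentiable_on_scaleR assms(1) times_differentiable_on_const)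
    qed
  qed
qed

context jet_coordinates
begin

lemma smooth_near_0_translate:
  assumes "smooth_curve A I x" "open I" "t \<in> I"
  shows "smooth_near_0 A (\<lambda>s. x (t + s))"
proof -
  let ?I = "(\<lambda>s. t + s) -` I"
  have op: "open ?I" by (rule open_vimage[OF assms(2)]) (intro continuous_intros)
  have "smooth_curve A ?I (\<lambda>s. x (t + s))"
    unfolding smooth_curve_def
  proof (intro conjI ballI)
    show "continuous_on ?I (\<lambda>s. x (t + s))"
      using assms(1) by (intro continuous_on_compose2[of I x ?I "\<lambda>s. t + s"] continuous_intros)
        (auto simp: smooth_curve_def)
    fix c assume c: "c \<in> A"
    have op2: "open (?I \<inter> (\<lambda>s. x (t + s)) -` fst c)"
    proof -
      have "?I \<inter> (\<lambda>s. x (t + s)) -` fst c = (\<lambda>s. t + s) -` (I \<inter> x -` fst c)" by auto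
      moreover have "open ((\<lambda>s. t + s) -` (I \<inter> x -` fst c))"
        by (rule open_vimage[OF smooth_curve_chart_open[OF assms(1,2) c]]) (intro continuous_intros)
      ultimately show ?thesis by simp
    qed
    have "smooth_on (?I \<inter> (\<lambda>s. x (t + s)) -` fst c) (\<lambda>s. (snd c \<circ> x) (t + s))"
      by (rule smooth_on_compose[OF op2 _ _ smooth_curve_chart[OF assms(1) c]])
        (auto intro: smooth_on_add[OF op2 smooth_on_const smooth_on_ident[OF op2]])
    then show "case c of (U, \<phi>) \<Rightarrow> smooth_on (?I \<inter> (\<lambda>s. x (t + s)) -` U) (\<phi> \<circ> (\<lambda>s. x (t + s)))"
      by (simp add: case_prod_beta o_def)
  qed
  then show ?thesis unfolding smooth_near_0_def using op assms(3) by (intro exI[of _ ?I]) auto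
qed

lemma curve_coord_translate:
  "\<alpha> \<le> k \<Longrightarrow> curve_coord c (\<lambda>s. x (t + s)) $ e \<alpha> = (1 / fact \<alpha>) *\<^sub>R nth_deriv \<alpha> (snd c \<circ> x) t"
  using nth_deriv_translate[of \<alpha> "snd c \<circ> x" t 0] by (simp add: curve_coord_block o_def)

end

context finsler_mechanics
begin

lemma Lagrange_along_spray:
  assumes "c \<in> A" "p \<in> slit \<inter> jet_dom A k c"
  shows "mechanical_spray k e A F Fe (pd k e A c k i (\<lambda>q. (F q)\<^sup>2)) p =
    pd k e A c (k - 1) i (\<lambda>q. (F q)\<^sup>2) p + lower_force k e A F Fe c i p"
proof -
  let ?u = "coord c p"
  have u: "?u \<in> slit_coord c" by (rule coord_in_slit[OF assms])
  have "mechanical_spray k e A F Fe (pd k e A c k i (\<lambda>q. (F q)\<^sup>2)) p =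
      second_derivative (energy c) ?u (axis (e k) (axis i 1)) (spray_field c ?u)"
    unfolding mechanical_spray_eq[OF assms smooth_near_pd_energy[OF assms]]
    by (rule derivative_pd_energy[OF assms(1) u])
  also have "\<dots> = frechet_derivative (energy c) (at ?u) (axis (e (k - 1)) (axis i 1))
      + lower_force k e A F Fe c i p"
    using Lagrange_equation_iff[OF assms(1) u spray_field_def, where r = "force c ?u"]
    unfolding lower_force_eq[OF assms] by (metis add.commute diff_eq_eq)
  finally show ?thesis by (simp add: pd_def energy_def)
qed

text \<open>Applied to the coordinate functions, the defining property of an integral curve is the ordinary
  differential equation \<open>u' = Y u\<close>, which yields the projected curve and its extension; applied to
  \<open>\<partial>F\<^sup>2/\<partial>y\<^sup>(\<^sup>k\<^sup>)\<^sup>i\<close>, it is the Lagrange equation.\<close>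

lemma integral_curve_imp_evolution_curve:
  assumes I: "open I" and \<gamma>: "integral_curve k e A (mechanical_spray k e A F Fe) I \<gamma>"
  shows "evolution_curve k e A F Fe I \<gamma>"
proof -
  let ?S = "mechanical_spray k e A F Fe"
  have slit: "\<gamma> t \<in> slit" if "t \<in> I" for t using \<gamma> that by (auto simp: integral_curve_def)
  have cont: "continuous_map (top_of_set I) (jet_topology k e A) \<gamma>"
    using \<gamma> by (simp add: integral_curve_def)
  have der: "((\<lambda>s. f (\<gamma> s)) has_real_derivative ?S f (\<gamma> t)) (at t)"
    if "t \<in> I" "smooth_near k e A (\<gamma> t) f" for t f
    using \<gamma> that by (auto simp: integral_curve_def)
  have in_bundle: "\<gamma> t \<in> jet_bundle A k" if "t \<in> I" for t
    using slit[OF that] by (simp add: slit_bundle_def)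
  define x where "x t = jet_rep (\<gamma> t) 0" for t
  define J where "J c = I \<inter> \<gamma> -` jet_dom A k c" for c :: "('m, 'n) chart"
  have J_eq: "J c = I \<inter> x -` fst c" for c
    using in_bundle by (auto simp: J_def x_def jet_dom_def)
  have J_open: "open (J c)" if "c \<in> A" for c
  proof -
    have "openin (top_of_set I) {t \<in> topspace (top_of_set I). \<gamma> t \<in> jet_dom A k c}"
      by (rule openin_continuous_map_preimage[OF cont openin_jet_dom[OF that]])
    moreover have "{t \<in> topspace (top_of_set I). \<gamma> t \<in> jet_dom A k c} = J c" by (auto simp: J_def)
    ultimately show ?thesis using I openin_open_trans by metis
  qed
  have p: "\<gamma> t \<in> slit \<inter> jet_dom A k c" if "t \<in> J c" for t c
    using that slit by (auto simp: J_def)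
  have u': "((\<lambda>s. coord c (\<gamma> s)) has_vector_derivative spray_field c (coord c (\<gamma> t))) (at t)"
    if c: "c \<in> A" and t: "t \<in> J c" for c t
  proof (rule block_has_vector_derivativeI)
    fix \<alpha> assume "\<alpha> \<le> k"
    have "((\<lambda>s. yc k e c \<alpha> i (\<gamma> s)) has_derivative (\<lambda>h. h * spray_field c (coord c (\<gamma> t)) $ e \<alpha> $ i)) (at t)" for i
      using der[OF _ smooth_near_yc[OF c], of t \<alpha> i] t p[OF t] mechanical_spray_yc[OF c p[OF t]]
      by (simp add: J_def has_field_derivative_def mult_commute_abs)
    then have "((\<lambda>s. \<chi> i. yc k e c \<alpha> i (\<gamma> s)) has_derivative
        (\<lambda>h. \<chi> i. h * spray_field c (coord c (\<gamma> t)) $ e \<alpha> $ i)) (at t)"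
      by (rule has_derivative_vec)
    moreover have "(\<chi> i. h * spray_field c (coord c (\<gamma> t)) $ e \<alpha> $ i) =
        h *\<^sub>R spray_field c (coord c (\<gamma> t)) $ e \<alpha>" for h
      by (simp add: vec_eq_iff)
    moreover have "(\<chi> i. yc k e c \<alpha> i (\<gamma> s)) = coord c (\<gamma> s) $ e \<alpha>" for s
      by (simp add: vec_eq_iff yc_def)
    ultimately show "((\<lambda>s. coord c (\<gamma> s) $ e \<alpha>) has_vector_derivative
        spray_field c (coord c (\<gamma> t)) $ e \<alpha>) (at t)"
      by (simp add: has_vector_derivative_def)
  qed
  have u_smooth: "smooth_on (J c) (\<lambda>t. coord c (\<gamma> t))" if c: "c \<in> A" for c
    by (rule smooth_on_integral_curve[OF J_open[OF c] u'[OF c] _ smooth_spray_field[OF c]])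
      (use coord_in_slit[OF c p] in auto)
  have x_coord: "snd c (x t) = coord c (\<gamma> t) $ e 0" for c :: "('m, 'n) chart" and t
    by (simp add: jet_coord_base x_def)
  have x_smooth: "smooth_on (J c) (snd c \<circ> x)" if c: "c \<in> A" for c
    using smooth_on_vec_nth[OF J_open[OF c] u_smooth[OF c], of "e 0"] by (simp add: o_def x_coord)
  have nth: "nth_deriv \<alpha> (snd c \<circ> x) t = fact \<alpha> *\<^sub>R coord c (\<gamma> t) $ e \<alpha>"
    if c: "c \<in> A" and "t \<in> J c" "\<alpha> \<le> k" for c t \<alpha>
    using that(2,3)
  proof (induction \<alpha> arbitrary: t)
    case 0
    then show ?case by (simp add: x_coord)
  next
    case (Suc \<alpha>)
    have "((\<lambda>s. fact \<alpha> *\<^sub>R coord c (\<gamma> s) $ e \<alpha>) has_vector_derivative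
        fact \<alpha> *\<^sub>R spray_field c (coord c (\<gamma> t)) $ e \<alpha>) (at t)"
      by (intro bounded_linear.has_vector_derivative[OF bounded_linear_scaleR_right]
          bounded_linear.has_vector_derivative[OF bounded_linear_vec_nth] u' c Suc.prems)
    then have "(nth_deriv \<alpha> (snd c \<circ> x) has_vector_derivative
        fact \<alpha> *\<^sub>R spray_field c (coord c (\<gamma> t)) $ e \<alpha>) (at t)"
      by (rule has_vector_derivative_transform_within_open[OF _ J_open[OF c] Suc.prems(1)])
        (rule Suc.IH[symmetric], use Suc.prems in auto)
    from vector_derivative_at[OF this] show ?case
      using Suc.prems by (simp add: nth_deriv_Suc spray_field_below_top mult.commute del: o_apply)
  qed
  have x_curve: "smooth_curve A I x"
    unfolding smooth_curve_def
  proof (intro conjI ballI)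
    show "continuous_on I x"
    proof (intro continuous_at_imp_continuous_on ballI)
      fix t assume t: "t \<in> I"
      obtain c where c: "c \<in> A" "x t \<in> fst c" using chart_ex by blast
      have "continuous_on (J c) (\<lambda>t. inv_into (fst c) (snd c) ((snd c \<circ> x) t))"
        by (rule continuous_on_compose2[OF chart_inverse_continuous[OF c(1)]
              smooth_on_continuous_on[OF x_smooth[OF c(1)]]]) (auto simp: J_eq)
      moreover have "inv_into (fst c) (snd c) ((snd c \<circ> x) s) = x s" if "s \<in> J c" for s
        using that chart_inj[OF c(1)] by (simp add: J_eq)
      ultimately have "continuous_on (J c) x" using continuous_on_cong by (metis (no_types, lifting))
      then show "isCont x t"
        using J_open[OF c(1)] t c(2) by (simp add: continuous_on_eq_continuous_at J_eq)
    qed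
    fix c assume "c \<in> A"
    then show "case c of (U, \<phi>) \<Rightarrow> smooth_on (I \<inter> x -` U) (\<phi> \<circ> x)"
      using x_smooth[of c] by (simp add: case_prod_beta J_eq)
  qed
  have lift: "\<gamma> t = jet A k (\<lambda>s. x (t + s))" if t: "t \<in> I" for t
  proof -
    obtain c where c: "c \<in> A" "x t \<in> fst c" using chart_ex by blast
    have tJ: "t \<in> J c" using t c by (simp add: J_eq)
    have near: "smooth_near_0 A (\<lambda>s. x (t + s))" by (rule smooth_near_0_translate[OF x_curve I t])
    have "coord c (\<gamma> t) = curve_coord c (\<lambda>s. x (t + s))"
      by (rule block_eqI) (simp add: curve_coord_translate nth[OF c(1) tJ])
    also have "\<dots> = coord c (jet A k (\<lambda>s. x (t + s)))"
      using jet_coord_jet[OF near c(1)] c(2) by simp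
    finally show ?thesis
      using inj_onD[OF inj_on_jet_coord[OF c(1)]] p[OF tJ] jet_dom_jet[OF near, of c] c(2) by simp
  qed
  have lagrange: "((\<lambda>s. pd k e A c k i (\<lambda>q. (F q)\<^sup>2) (\<gamma> s)) has_real_derivative
      pd k e A c (k - 1) i (\<lambda>q. (F q)\<^sup>2) (\<gamma> t) + lower_force k e A F Fe c i (\<gamma> t)) (at t)"
    if "c \<in> A" "t \<in> I" "\<gamma> t \<in> jet_dom A k c" for c t i
  proof -
    have "\<gamma> t \<in> slit \<inter> jet_dom A k c" using that slit by simp
    then show ?thesis
      unfolding Lagrange_along_spray[OF that(1) \<open>\<gamma> t \<in> slit \<inter> jet_dom A k c\<close>, symmetric]
      by (intro der[OF that(2)] smooth_near_pd_energy[OF that(1)])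
  qed
  show ?thesis
    unfolding evolution_curve_def using x_curve lift slit lagrange by (intro exI[of _ x]) blast
qed

text \<open>The extension of a curve has a semispray vector as velocity. The Lagrange equation gives the time
  derivative of \<open>\<partial>F\<^sup>2/\<partial>y\<^sup>(\<^sup>k\<^sup>)\<^sup>i\<close>, the chain rule gives it in terms of that velocity, and comparing the two
  determines the last block.\<close>

lemma evolution_curve_imp_integral_curve:
  assumes I: "open I" and "evolution_curve k e A F Fe I \<gamma>"
  shows "integral_curve k e A (mechanical_spray k e A F Fe) I \<gamma>"
proof -
  let ?S = "mechanical_spray k e A F Fe"
  obtain x where x: "smooth_curve A I x"
    and \<gamma>: "\<And>t. t \<in> I \<Longrightarrow> \<gamma> t = jet A k (\<lambda>s. x (t + s))" and slit: "\<And>t. t \<in> I \<Longrightarrow> \<gamma> t \<in> slit"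
    and lagrange: "\<And>c t i. c \<in> A \<Longrightarrow> t \<in> I \<Longrightarrow> \<gamma> t \<in> jet_dom A k c \<Longrightarrow>
      ((\<lambda>s. pd k e A c k i (\<lambda>q. (F q)\<^sup>2) (\<gamma> s)) has_real_derivative
        pd k e A c (k - 1) i (\<lambda>q. (F q)\<^sup>2) (\<gamma> t) + lower_force k e A F Fe c i (\<gamma> t)) (at t)"
    using assms(2) unfolding evolution_curve_def by blast
  have near: "smooth_near_0 A (\<lambda>s. x (t + s))" if "t \<in> I" for t
    by (rule smooth_near_0_translate[OF x I that])
  have dom: "\<gamma> t \<in> jet_dom A k c \<longleftrightarrow> x t \<in> fst c" if "t \<in> I" for t and c :: "('m, 'n) chart"
    using \<gamma>[OF that] jet_dom_jet[OF near[OF that]] by simp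
  define J where "J c = I \<inter> x -` fst c" for c :: "('m, 'n) chart"
  have J_open: "open (J c)" if "c \<in> A" for c
    unfolding J_def by (rule smooth_curve_chart_open[OF x I that])
  have J_smooth: "smooth_on (J c) (snd c \<circ> x)" if "c \<in> A" for c
    unfolding J_def by (rule smooth_curve_chart[OF x that])
  have p: "\<gamma> t \<in> slit \<inter> jet_dom A k c" if "t \<in> J c" for t c
    using that slit dom by (auto simp: J_def)
  have u: "coord c (\<gamma> t) $ e \<alpha> = (1 / fact \<alpha>) *\<^sub>R nth_deriv \<alpha> (snd c \<circ> x) t"
    if "c \<in> A" "t \<in> J c" "\<alpha> \<le> k" for c t \<alpha>
    using that \<gamma>[of t] jet_coord_jet[OF near that(1), of t] curve_coord_translate[OF that(3), of c x t]
    by (simp add: J_def)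
  have u': "((\<lambda>s. coord c (\<gamma> s)) has_vector_derivative spray_field c (coord c (\<gamma> t))) (at t)"
    if c: "c \<in> A" and t: "t \<in> J c" for c t
  proof -
    let ?u = "\<lambda>s. coord c (\<gamma> s)"
    define w where "w = (1 / fact k) *\<^sub>R nth_deriv (Suc k) (snd c \<circ> x) t"
    define v where "v = shift (?u t) + axis (e k) w"
    have v: "(?u has_vector_derivative v) (at t)"
    proof (rule block_has_vector_derivativeI)
      fix \<alpha> assume \<alpha>: "\<alpha> \<le> k"
      have "((\<lambda>s. (1 / fact \<alpha>) *\<^sub>R nth_deriv \<alpha> (snd c \<circ> x) s) has_vector_derivative
          (1 / fact \<alpha>) *\<^sub>R nth_deriv (Suc \<alpha>) (snd c \<circ> x) t) (at t)"
        by (rule bounded_linear.has_vector_derivative[OF bounded_linear_scaleR_right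
              nth_deriv_has_vector_derivative[OF J_open[OF c] J_smooth[OF c] t]])
      then have "((\<lambda>s. ?u s $ e \<alpha>) has_vector_derivative
          (1 / fact \<alpha>) *\<^sub>R nth_deriv (Suc \<alpha>) (snd c \<circ> x) t) (at t)"
        by (rule has_vector_derivative_transform_within_open[OF _ J_open[OF c] t])
          (simp add: u[OF c _ \<alpha>])
      moreover have "(1 / fact \<alpha>) *\<^sub>R nth_deriv (Suc \<alpha>) (snd c \<circ> x) t = v $ e \<alpha>"
      proof (cases "\<alpha> = k")
        case True
        then show ?thesis by (simp add: v_def w_def)
      next
        case False
        then have "\<alpha> < k" using \<alpha> by simp
        then show ?thesis using u[OF c t, of "Suc \<alpha>"] by (simp add: v_def shift_block)
      qed
      ultimately show "((\<lambda>s. ?u s $ e \<alpha>) has_vector_derivative v $ e \<alpha>) (at t)" by simp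
    qed
    have ut: "?u t \<in> slit_coord c" by (rule coord_in_slit[OF c p[OF t]])
    have "second_derivative (energy c) (?u t) (axis (e k) (axis i 1)) v
        - frechet_derivative (energy c) (at (?u t)) (axis (e (k - 1)) (axis i 1)) =
        (metric c (?u t) *v force c (?u t)) $ i" for i
    proof -
      let ?L = "\<lambda>y. frechet_derivative (energy c) (at y) (axis (e k) (axis i 1))"
      have "((\<lambda>s. ?L (?u s)) has_derivative (\<lambda>h. frechet_derivative ?L (at (?u t)) (h *\<^sub>R v))) (at t)"
        by (rule has_derivative_compose[OF v[unfolded has_vector_derivative_def]
              smooth_on_has_derivative[OF smooth_on_frechet_derivative[OF smooth_energy[OF c]] ut]])
      moreover have "((\<lambda>s. ?L (?u s)) has_derivative (*)
          (pd k e A c (k - 1) i (\<lambda>q. (F q)\<^sup>2) (\<gamma> t) + lower_force k e A F Fe c i (\<gamma> t))) (at t)"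
        using lagrange[OF c, of t i] p[OF t] t
        by (simp add: pd_def[of k e A c k] energy_def J_def has_field_derivative_def)
      ultimately have "(\<lambda>h. frechet_derivative ?L (at (?u t)) (h *\<^sub>R v)) = (*)
          (pd k e A c (k - 1) i (\<lambda>q. (F q)\<^sup>2) (\<gamma> t) + lower_force k e A F Fe c i (\<gamma> t))"
        by (rule has_derivative_unique)
      from fun_cong[OF this, of 1] show ?thesis
        using lower_force_eq[OF c p[OF t]]
        by (simp add: second_derivative_def pd_def energy_def)
    qed
    then have "w = geodesic_top c (?u t) + (1 / 2) *\<^sub>R force c (?u t)"
      using Lagrange_equation_iff[OF c ut v_def] by blast
    then show ?thesis using v by (simp add: spray_field_def v_def)
  qed
  have der: "((\<lambda>s. f (\<gamma> s)) has_real_derivative ?S f (\<gamma> t)) (at t)"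
    if t: "t \<in> I" and f: "smooth_near k e A (\<gamma> t) f" for t f
  proof -
    obtain c where c: "c \<in> A" "x t \<in> fst c" using chart_ex by blast
    have tJ: "t \<in> J c" using t c by (simp add: J_def)
    obtain Q where Q: "open Q" "coord c (\<gamma> t) \<in> Q" "smooth_on Q (local_rep k e A c f)"
      using smooth_near_local_rep[OF c(1) _ f] p[OF tJ] by blast
    let ?D = "frechet_derivative (local_rep k e A c f) (at (coord c (\<gamma> t)))"
    have lin: "linear ?D" by (rule smooth_on_linear_derivative[OF Q(3,2)])
    have "((\<lambda>s. local_rep k e A c f (coord c (\<gamma> s))) has_derivative
        (\<lambda>h. ?D (h *\<^sub>R spray_field c (coord c (\<gamma> t))))) (at t)"
      by (rule has_derivative_compose[OF u'[OF c(1) tJ, unfolded has_vector_derivative_def]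
            smooth_on_has_derivative[OF Q(3,2)]])
    then have "((\<lambda>s. f (\<gamma> s)) has_derivative
        (\<lambda>h. ?D (h *\<^sub>R spray_field c (coord c (\<gamma> t))))) (at t)"
      by (rule has_derivative_transform_within_open[OF _ J_open[OF c(1)] tJ])
        (use p local_rep_jet_coord[OF c(1)] in blast)
    then show ?thesis
      unfolding mechanical_spray_eq[OF c(1) p[OF tJ] f] has_field_derivative_def
      by (simp add: linear_scale[OF lin] mult_commute_abs)
  qed
  have "continuous_map (top_of_set I) (jet_topology k e A) \<gamma>"
    unfolding jet_topology_def
  proof (rule continuous_on_generated_topo)
    fix V assume "V \<in> {jet_dom A k c \<inter> jet_coord k e c -` W | c W. c \<in> A \<and> open W}"
    then obtain c W where c: "c \<in> A" "open W" "V = jet_dom A k c \<inter> coord c -` W" by blast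
    have "continuous_on (J c) (\<lambda>t. coord c (\<gamma> t))"
      using u'[OF c(1)] by (intro continuous_at_imp_continuous_on) (blast intro: has_vector_derivative_continuous)
    then have "open ((\<lambda>t. coord c (\<gamma> t)) -` W \<inter> J c)"
      using c(2) J_open[OF c(1)] by (simp add: continuous_on_open_vimage)
    moreover have "\<gamma> -` V \<inter> topspace (top_of_set I) = (\<lambda>t. coord c (\<gamma> t)) -` W \<inter> J c"
      using dom[of _ c] c(3) by (auto simp: J_def)
    ultimately show "openin (top_of_set I) (\<gamma> -` V \<inter> topspace (top_of_set I))"
      by (auto simp: openin_open_eq[OF I] J_def)
  next
    show "\<gamma> ` topspace (top_of_set I) \<subseteq>
        \<Union> {jet_dom A k c \<inter> jet_coord k e c -` W | c W. c \<in> A \<and> open W}"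
    proof
      fix q assume "q \<in> \<gamma> ` topspace (top_of_set I)"
      then have "q \<in> jet_bundle A k" using slit by (auto simp: slit_bundle_def)
      then obtain c where "c \<in> A" "q \<in> jet_dom A k c" using jet_dom_ex by blast
      then have "q \<in> jet_dom A k c \<inter> coord c -` UNIV" "c \<in> A \<and> open (UNIV :: (real ^ 'n ^ 'j) set)" by auto
      then show "q \<in> \<Union> {jet_dom A k c \<inter> jet_coord k e c -` W | c W. c \<in> A \<and> open W}" by blast
    qed
  qed
  then show ?thesis using slit der by (auto simp: integral_curve_def)
qed

end

theorem theorem5p8p1:
  fixes A :: "('m::{t2_space,second_countable_topology}, 'n::finite) chart set"
    and k :: nat
    and e :: "nat \<Rightarrow> 'j::finite"
    and F :: "'m jet \<Rightarrow> real"
    and Fe :: "'m operator"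
  assumes "k \<ge> 1"
    and "bij_betw e {..k} UNIV"
    and "mechanical_system k e A F Fe"
  shows "semispray k e A (mechanical_spray k e A F Fe) \<and>
    (\<forall>c\<in>A. \<forall>p \<in> slit_bundle A k \<inter> jet_dom A k c. \<forall>f. smooth_near k e A p f \<longrightarrow>
       mechanical_spray k e A F Fe f p = mechanical_spray_in k e A F Fe c f p) \<and>
    (\<forall>I \<gamma>. open I \<longrightarrow> is_interval I \<longrightarrow>
       (integral_curve k e A (mechanical_spray k e A F Fe) I \<gamma> \<longleftrightarrow> evolution_curve k e A F Fe I \<gamma>))"
proof -
  interpret finsler_mechanics k e A F Fe
    by unfold_locales (use assms in \<open>auto simp: mechanical_system_def finsler_space_def\<close>)
  show ?thesis
    using semispray_mechanical_spray mechanical_spray_eq_in_chart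
      integral_curve_imp_evolution_curve evolution_curve_imp_integral_curve by blast
qed

end
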